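(* Let $\alpha>0$ and let $\xi$ be a subordinator with law $\mathbf{P}$ and Laplace exponent $\phi$. Let $I_\phi=\int_0^\infty e^{-\alpha\xi_s}\,ds$ and let $R_\phi$ be a $[0,\infty)$-valued random variable whose law is determined by its moments $\mathbf{E}(R_\phi^n)=\prod_{k=1}^n\phi(\alpha k)$, $n=1,2,\dots$. Assume that $\phi$ is regularly varying at $0$ with index $\beta\in[0,1]$. Then, as $s\to0+$, $$\mathbf{E}\left(1_{\{R_\phi>s\}}\frac1{R_\phi}\right)\sim\frac{1}{\alpha^\beta\,\Gamma(1+\beta)\,\phi(1/\log(1/s))},\qquad \mathbf{P}(R_\phi<s)=o\left(\frac{s}{\alpha^\beta\,\Gamma(1+\beta)\,\phi(1/\log(1/s))}\right).$$ If furthermore the function $\lambda\mapsto\lambda/\phi(\lambda)$, $\lambda>0$, is the Laplace exponent of a subordinator, then, as $s\to0+$, $$\mathbf{E}\left(1_{\{I_\phi>s\}}\frac1{I_\phi}\right)\sim\frac{\alpha^\beta\log(1/s)\,\phi(1/\log(1/s))}{\Gamma(2-\beta)},\qquad \mathbf{P}(I_\phi<s)=o\left(\frac{\alpha^\beta\, s\log(1/s)\,\phi(1/\log(1/s))}{\Gamma(2-\beta)}\right).$$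
   Context: A subordinator is a càdlàg real-valued process with stationary independent increments and nondecreasing paths (no killing), started at $0$. Its Laplace exponent is $\phi(\lambda)=-\log \mathbf{E}(e^{-\lambda\xi_1})=d\lambda+\int_{(0,\infty)}(1-e^{-\lambda x})\Pi(dx)$, $\lambda\ge 0$, where $d\ge 0$ and $\int (1\wedge x)\Pi(dx)<\infty$. $\phi$ is regularly varying at $0$ with index $\beta$ if $\lim_{\lambda\to0+}\phi(c\lambda)/\phi(\lambda)=c^\beta$ for every $c>0$. The existence of $R_\phi$ is due to Bertoin and Yor: its law is determined by the moments above; if $R_\phi$ is taken independent of $I_\phi$, the product $R_\phi I_\phi$ has the exponential law of parameter $1$; moreover $\mathbf{E}(e^{-tR_\phi})=\mathbf{E}(e^{-\alpha\xi_{\tau(t)}})$ for $t\ge0$, where $\tau$ is the inverse of $t\mapsto\int_0^te^{\alpha\xi_s}ds$. The notation $a(s)\sim b(s)$ means $a(s)/b(s)\to1$. *)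

theory Defs
  imports "HOL-Probability.Probability" "HOL-Library.Landau_Symbols"
begin

text \<open>
  Time is the half-line \<open>{0..}\<close>; the values of \<open>\<xi>\<close> at negative times are irrelevant.
\<close>

locale subordinator = prob_space M for M :: "'a measure" +
  fixes \<xi> :: "real \<Rightarrow> 'a \<Rightarrow> real"
  assumes measurable_process: "\<And>t. 0 \<le> t \<Longrightarrow> \<xi> t \<in> borel_measurable M"
    and starts_at_zero: "\<And>\<omega>. \<omega> \<in> space M \<Longrightarrow> \<xi> 0 \<omega> = 0"
    and right_continuous_paths:
      "\<And>\<omega> t. \<omega> \<in> space M \<Longrightarrow> 0 \<le> t \<Longrightarrow> continuous (at_right t) (\<lambda>u. \<xi> u \<omega>)"
    and left_limits:
      "\<And>\<omega> t. \<omega> \<in> space M \<Longrightarrow> 0 < t \<Longrightarrow> \<exists>l. ((\<lambda>u. \<xi> u \<omega>) \<longlongrightarrow> l) (at_left t)"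
    and nondecreasing_paths: "\<And>\<omega>. \<omega> \<in> space M \<Longrightarrow> mono_on {0..} (\<lambda>u. \<xi> u \<omega>)"
    and stationary_increments:
      "\<And>s h. 0 \<le> s \<Longrightarrow> 0 \<le> h \<Longrightarrow>
        distr M borel (\<lambda>\<omega>. \<xi> (s + h) \<omega> - \<xi> s \<omega>) = distr M borel (\<lambda>\<omega>. \<xi> h \<omega> - \<xi> 0 \<omega>)"
    and independent_increments:
      "\<And>(n :: nat) (t :: nat \<Rightarrow> real). 0 \<le> t 0 \<Longrightarrow> mono_on {..n} t \<Longrightarrow>
        indep_vars (\<lambda>_. borel) (\<lambda>i \<omega>. \<xi> (t (Suc i)) \<omega> - \<xi> (t i) \<omega>) {..<n}"

definition laplace_exponent :: "'a measure \<Rightarrow> (real \<Rightarrow> 'a \<Rightarrow> real) \<Rightarrow> real \<Rightarrow> real" where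
  "laplace_exponent M \<xi> q = - ln (\<integral>\<omega>. exp (- q * \<xi> 1 \<omega>) \<partial>M)"

text \<open>
  The exponential functional takes values in \<open>ennreal\<close>, since the integral may diverge on a null set
  of paths (and diverges on all of them if \<open>\<xi>\<close> is identically zero).
\<close>

definition exponential_functional ::
    "real \<Rightarrow> (real \<Rightarrow> 'a \<Rightarrow> real) \<Rightarrow> 'a \<Rightarrow> ennreal" where
  "exponential_functional \<alpha> \<xi> \<omega> = (\<integral>\<^sup>+s\<in>{0..}. ennreal (exp (- \<alpha> * \<xi> s \<omega>)) \<partial>lborel)"

text \<open>
  The convention \<open>x / 0 = 0\<close> does no harm here: if \<open>f\<close> vanished at points arbitrarily close
  to 0, the ratio would be 0 at those points and could not tend to \<open>c powr \<beta> > 0\<close>.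
\<close>

definition regularly_varying_at_0 :: "(real \<Rightarrow> real) \<Rightarrow> real \<Rightarrow> bool" where
  "regularly_varying_at_0 f \<beta> \<longleftrightarrow>
    (\<forall>c>0. ((\<lambda>x. f (c * x) / f x) \<longlongrightarrow> c powr \<beta>) (at_right 0))"

end

theory Submission
  imports Defs "HOL-Real_Asymp.Real_Asymp"
begin

text \<open>
  Splitting \<open>I\<close> at time \<open>s\<close> and using the Markov property gives \<open>E I\<^sup>z = z / \<phi>(\<alpha>z) \<cdot> E I\<^bsup>z-1\<^esup>\<close> for all real
  \<open>z > 0\<close>. In particular the \<open>n\<close>-th moments of independent copies of \<open>R\<close> and \<open>I\<close> multiply to \<open>n!\<close>, so the
  product is standard exponential and \<open>E R\<^bsup>z-1\<^esup> \<cdot> E I\<^bsup>z-1\<^esup> = \<Gamma>(z)\<close> for \<open>0 < z < 1\<close>. Letting \<open>z \<rightarrow> 0\<close>,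
  \<open>E R\<^bsup>z-1\<^esup> \<sim> 1 / \<phi>(\<alpha>z)\<close> and \<open>E I\<^bsup>z-1\<^esup> \<sim> \<phi>(\<alpha>z) / z\<close>. As a function of \<open>z\<close>, \<open>E X\<^bsup>z-1\<^esup>\<close> is the Laplace
  transform of the law of \<open>- log X\<close> weighted by \<open>1/X\<close>, and Karamata's Tauberian theorem turns its behaviour
  at \<open>0\<close> into that of \<open>V(s) = E(1/X; X > s)\<close>. Since \<open>V\<close> is slowly varying at \<open>0\<close>, summing
  \<open>P(s/2 < X \<le> s) \<le> s (V(s/2) - V(s)) = o(s V(s))\<close> over dyadic scales bounds \<open>P(X < s)\<close>.
\<close>

section \<open>Karamata's Tauberian theorem\<close>

text \<open>The transform E X^(z-1) may blow up as z tends to 0, because the law of - log X weighted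
  by 1/X may have infinite mass; the Tauberian argument reads the growth of this mass off the
  blow-up. The scale 1/log(1/s) arises here: X > s means - log X < log(1/s), so the threshold s
  corresponds to z = 1/log(1/s). Regular variation turns \<phi>(\<alpha> z) into \<alpha>^\<beta>
  \<phi>(z), the source of the factor \<alpha>^\<beta>. The transform has index -\<beta> for R and,
  through the extra 1/z, index -(1-\<beta>) for I; Karamata's constant 1/Gamma(1+\<rho>) with \<rho>
  = \<beta> and \<rho> = 1-\<beta> yields Gamma(1+\<beta>) and Gamma(2-\<beta>). Two obstacles shape
  the proof. Karamata's theorem wants a nonnegative variable, but - log X is negative where X > 1;
  clipping X at 1 costs at most z in the transform. And only integer moments of the product are
  known, while negative fractional ones are wanted: the moments n! give the Laplace transform
  1/(1+q) for all q \<ge> 0, and x^(-a) is a Mellin integral of exp(-q x).\<close>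

lemma method_of_moments_unit_interval:
  fixes M_seq :: "nat \<Rightarrow> real measure" and M :: "real measure"
  assumes seq: "\<And>n. real_distribution (M_seq n)" and lim: "real_distribution M"
    and seq_supp: "\<And>n. AE x in M_seq n. x \<in> {0..1}" and lim_supp: "AE x in M. x \<in> {0..1}"
    and moments: "\<And>k. (\<lambda>n. \<integral>x. x ^ k \<partial>M_seq n) \<longlonglongrightarrow> (\<integral>x. x ^ k \<partial>M)"
  shows "weak_conv_m M_seq M"
proof (rule integral_bdd_continuous_conv_imp_weak_conv[OF seq lim])
  fix f :: "real \<Rightarrow> real" assume f: "\<And>x. isCont f x" and f1: "\<And>x. \<bar>f x\<bar> \<le> 1"
  have f_cont: "continuous_on UNIV f" using f by (simp add: continuous_on_eq_continuous_at)
  have power_integrable: "integrable D (\<lambda>x. x ^ k)"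
    if "real_distribution D" "AE x in D. x \<in> {0..1}" for D :: "real measure" and k
  proof -
    interpret D: real_distribution D by fact
    have "AE x in D. norm (x ^ k) \<le> 1"
      using that(2) by eventually_elim (auto intro: power_le_one)
    then show ?thesis by (intro D.integrable_const_bound[of _ 1]) auto
  qed
  show "(\<lambda>n. integral\<^sup>L (M_seq n) f) \<longlonglongrightarrow> integral\<^sup>L M f"
  proof (rule LIMSEQ_I)
    fix e :: real assume e: "e > 0"
    \<comment> \<open>Weierstrass approximation on the common compact support. Replacing
      \<open>f\<close> by \<open>g\<close> costs \<open>e/4\<close> under each of the two laws, and
      the convergence of the integrals of \<open>g\<close> costs a third \<open>e/4\<close>.\<close>
    obtain g where g: "real_polynomial_function g" "\<And>x. x \<in> {0..1} \<Longrightarrow> \<bar>f x - g x\<bar> < e/4"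
      using Stone_Weierstrass_real_polynomial_function[of "{0..1::real}" f "e/4"] f_cont e
      by (metis compact_Icc continuous_on_subset subset_UNIV zero_less_divide_iff zero_less_numeral)
    obtain a m where gs: "g = (\<lambda>x. \<Sum>i\<le>m. a i * x ^ i)"
      using g(1) real_polynomial_function_iff_sum by blast
    have approx: "\<bar>integral\<^sup>L D f - integral\<^sup>L D g\<bar> \<le> e/4"
      if D: "real_distribution D" "AE x in D. x \<in> {0..1}" for D :: "real measure"
    proof -
      interpret D: real_distribution D by fact
      have [measurable]: "f \<in> borel_measurable borel"
        using f_cont by (rule borel_measurable_continuous_onI)
      have i1: "integrable D f" using f1 by (intro D.integrable_const_bound[of _ 1]) auto
      have i2: "integrable D g" unfolding gs using power_integrable[OF D] by simp
      have "\<bar>integral\<^sup>L D f - integral\<^sup>L D g\<bar> = \<bar>\<integral>x. f x - g x \<partial>D\<bar>"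
        using i1 i2 by simp
      also have "\<dots> \<le> (\<integral>x. \<bar>f x - g x\<bar> \<partial>D)" by (rule integral_abs_bound)
      also have "\<dots> \<le> (\<integral>x. e/4 \<partial>D)"
      proof (intro integral_mono_AE)
        show "AE x in D. \<bar>f x - g x\<bar> \<le> e/4"
          using D(2) by eventually_elim (use g(2) in \<open>auto intro: less_imp_le\<close>)
      qed (use i1 i2 in auto)
      finally show ?thesis by (simp add: D.prob_space[simplified])
    qed
    have int_g: "integral\<^sup>L D g = (\<Sum>i\<le>m. a i * (\<integral>x. x ^ i \<partial>D))"
      if D: "real_distribution D" "AE x in D. x \<in> {0..1}" for D :: "real measure"
      unfolding gs using power_integrable[OF D] by simp
    have "(\<lambda>n. integral\<^sup>L (M_seq n) g) \<longlonglongrightarrow> integral\<^sup>L M g"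
      unfolding int_g[OF seq seq_supp] int_g[OF lim lim_supp] by (intro tendsto_intros moments)
    then obtain n0 where n0: "\<And>n. n \<ge> n0 \<Longrightarrow> \<bar>integral\<^sup>L (M_seq n) g - integral\<^sup>L M g\<bar> < e/4"
      using LIMSEQ_D[of _ _ "e/4"] e by (metis real_norm_def zero_less_divide_iff zero_less_numeral)
    show "\<exists>n0. \<forall>n\<ge>n0. norm (integral\<^sup>L (M_seq n) f - integral\<^sup>L M f) < e"
    proof (intro exI allI impI)
      fix n assume "n \<ge> n0"
      then show "norm (integral\<^sup>L (M_seq n) f - integral\<^sup>L M f) < e"
        using n0[of n] approx[OF seq seq_supp, of n] approx[OF lim lim_supp] e
        unfolding real_norm_def by linarith
    qed
  qed
qed

lemma nn_integral_powr_exp: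
  fixes a b :: real
  assumes "a > 0" "b > 0"
  shows "(\<integral>\<^sup>+t. ennreal (indicator {0..} t * t powr (a - 1) * exp (- (b * t))) \<partial>lborel)
    = ennreal (Gamma a * b powr - a)"
proof -
  have "ennreal (Gamma a) = (\<integral>\<^sup>+t. ennreal (indicator {0..} t * t powr (a - 1) / exp t) \<partial>lborel)"
    by (rule Gamma_conv_nn_integral_real) fact
  also have "\<dots> = ennreal \<bar>b\<bar> * (\<integral>\<^sup>+t. ennreal (indicator {0..} (0 + b * t) * (0 + b * t) powr (a - 1) / exp (0 + b * t)) \<partial>lborel)"
    using assms by (intro nn_integral_real_affine) auto
  also have "\<dots> = ennreal b * (\<integral>\<^sup>+t. ennreal (b powr (a - 1)) * ennreal (indicator {0..} t * t powr (a - 1) * exp (- (b * t))) \<partial>lborel)"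
  proof -
    have "ennreal (indicator {0..} (0 + b * t) * (0 + b * t) powr (a - 1) / exp (0 + b * t))
      = ennreal (b powr (a - 1)) * ennreal (indicator {0..} t * t powr (a - 1) * exp (- (b * t)))" for t
      using assms by (cases "t \<ge> 0")
        (simp_all add: indicator_def powr_mult exp_minus zero_le_mult_iff divide_inverse mult_ac flip: ennreal_mult)
    then show ?thesis using assms by simp
  qed
  also have "\<dots> = ennreal b * ennreal (b powr (a - 1)) * (\<integral>\<^sup>+t. ennreal (indicator {0..} t * t powr (a - 1) * exp (- (b * t))) \<partial>lborel)"
    by (subst nn_integral_cmult) (auto simp: mult.assoc)
  also have "ennreal b * ennreal (b powr (a - 1)) = ennreal (b powr a)"
    using assms by (subst ennreal_mult[symmetric]) (auto simp: powr_diff)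
  finally have *: "ennreal (Gamma a) = ennreal (b powr a) *
    (\<integral>\<^sup>+t. ennreal (indicator {0..} t * t powr (a - 1) * exp (- (b * t))) \<partial>lborel)" .
  have "ennreal (Gamma a * b powr - a) = ennreal (b powr - a) * ennreal (Gamma a)"
    using assms by (simp add: ennreal_mult' mult.commute Gamma_real_pos less_imp_le)
  also have "\<dots> = ennreal (b powr - a * b powr a) * (\<integral>\<^sup>+t. ennreal (indicator {0..} t * t powr (a - 1) * exp (- (b * t))) \<partial>lborel)"
    unfolding * by (simp add: ennreal_mult mult.assoc)
  also have "b powr - a * b powr a = 1" using assms by (simp flip: powr_add)
  finally show ?thesis by simp
qed

text \<open>The law is that of exp(-T) with T Gamma distributed of shape \<open>\<rho>\<close> and
  rate 1; its moments are the Laplace transform of T at the integers. The function \<open>f\<close>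
  is Karamata's test function: x * f x is the indicator of x > 1/e. Its integral is that of
  t^(\<rho>-1)/Gamma(\<rho>) over [0,1], namely 1/(\<rho> Gamma(\<rho>)).\<close>

lemma gamma_limit_law:
  fixes \<rho> :: real
  assumes "0 \<le> \<rho>"
  defines "f \<equiv> \<lambda>x::real. if x > exp (- 1) then 1 / x else 0"
  shows "\<exists>D. real_distribution D \<and> (AE x in D. x \<in> {0..1}) \<and> emeasure D {exp (- 1)} = 0
    \<and> (\<forall>k. (\<integral>x. x ^ k \<partial>D) = real (k + 1) powr - \<rho>) \<and> (\<integral>x. f x \<partial>D) = 1 / Gamma (1 + \<rho>)"
proof (cases "\<rho> = 0")
  case True
  \<comment> \<open>At shape 0 the Gamma law degenerates to the point mass at T = 0, so exp(-T) =
    1.\<close>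
  let ?D = "return borel (1::real)"
  have "real_distribution ?D"
    by (simp add: real_distribution_def real_distribution_axioms_def prob_space_return)
  moreover have "f \<in> borel_measurable borel" unfolding f_def by measurable
  ultimately show ?thesis using True
    by (intro exI[of _ ?D]) (auto simp: AE_return integral_return f_def indicator_def)
next
  case False
  with assms have \<rho>: "\<rho> > 0" by simp
  have G: "Gamma \<rho> > 0" using \<rho> by (rule Gamma_real_pos)
  define g where "g t = indicator {0..} t * t powr (\<rho> - 1) * exp (- t) / Gamma \<rho>" for t :: real
  have g_nonneg: "g t \<ge> 0" for t using G by (auto simp: g_def indicator_def)
  have g_meas[measurable]: "g \<in> borel_measurable borel" unfolding g_def by measurable
  have f_meas[measurable]: "f \<in> borel_measurable borel" unfolding f_def by measurable
  define P where "P = density lborel g"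
  define D where "D = distr P borel (\<lambda>t. exp (- t))"
  have mellin: "(\<integral>\<^sup>+t. ennreal (exp (- t) ^ k * g t) \<partial>lborel) = ennreal (real (k + 1) powr - \<rho>)" for k :: nat
  proof -
    have "(\<integral>\<^sup>+t. ennreal (exp (- t) ^ k * g t) \<partial>lborel)
      = (\<integral>\<^sup>+t. ennreal (1 / Gamma \<rho>) * ennreal (indicator {0..} t * t powr (\<rho> - 1) * exp (- (real (k + 1) * t))) \<partial>lborel)"
    proof (rule nn_integral_cong)
      fix t :: real
      have e: "exp (- (real (k + 1) * t)) = exp (- t) ^ k * exp (- t)"
        by (simp add: algebra_simps flip: exp_of_nat_mult exp_add)
      have "exp (- t) ^ k * g t
        = (1 / Gamma \<rho>) * (indicator {0..} t * t powr (\<rho> - 1) * exp (- (real (k + 1) * t)))"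
        by (simp only: e g_def divide_inverse mult_1, simp only: mult_ac)
      then show "ennreal (exp (- t) ^ k * g t)
        = ennreal (1 / Gamma \<rho>) * ennreal (indicator {0..} t * t powr (\<rho> - 1) * exp (- (real (k + 1) * t)))"
        using G by (metis ennreal_mult' less_imp_le zero_le_divide_1_iff)
    qed
    also have "\<dots> = ennreal (1 / Gamma \<rho>) * ennreal (Gamma \<rho> * real (k + 1) powr - \<rho>)"
      using \<rho> by (subst nn_integral_cmult) (auto simp only: nn_integral_powr_exp, auto)
    also have "\<dots> = ennreal (real (k + 1) powr - \<rho>)"
      using G by (subst ennreal_mult[symmetric]) auto
    finally show ?thesis .
  qed
  have P: "prob_space P"
    using mellin[of 0] by (intro prob_spaceI) (simp add: P_def emeasure_density)
  interpret P: prob_space P by fact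
  have [measurable_cong]: "sets P = sets borel" by (simp add: P_def)
  have "real_distribution D"
    unfolding real_distribution_def real_distribution_axioms_def D_def
    by (auto intro!: P.prob_space_distr)
  moreover have "AE x in D. x \<in> {0..1}"
  proof -
    have "AE t in P. 0 \<le> t"
      unfolding P_def by (auto simp: AE_density g_def indicator_def)
    then show ?thesis unfolding D_def by (subst AE_distr_iff) auto
  qed
  moreover have "emeasure D {exp (- 1)} = 0"
  proof -
    have "(\<lambda>t::real. exp (- t)) -` {exp (- 1)} \<inter> space P = {1}" by (auto simp: P_def)
    then have "emeasure D {exp (- 1)} = emeasure P {1}" by (simp add: D_def emeasure_distr)
    also have "\<dots> = 0"
      unfolding P_def using AE_lborel_singleton[of "1::real"]
      by (subst emeasure_density) (auto simp: nn_integral_0_iff_AE elim!: eventually_mono)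
    finally show ?thesis .
  qed
  moreover have "(\<integral>x. x ^ k \<partial>D) = real (k + 1) powr - \<rho>" for k
  proof -
    have "(\<integral>x. x ^ k \<partial>D) = (\<integral>t. g t * exp (- t) ^ k \<partial>lborel)"
      unfolding D_def P_def using g_nonneg
      by (subst integral_distr, simp, simp, subst integral_density) auto
    also have "\<dots> = real (k + 1) powr - \<rho>"
      using g_nonneg mellin[of k] by (subst integral_eq_nn_integral) (auto simp: mult.commute)
    finally show ?thesis .
  qed
  moreover have "(\<integral>x. f x \<partial>D) = 1 / Gamma (1 + \<rho>)"
  proof -
    have "(\<integral>x. f x \<partial>D) = (\<integral>t. g t * f (exp (- t)) \<partial>lborel)"
      unfolding D_def P_def using g_nonneg
      by (subst integral_distr, simp, simp, subst integral_density) auto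
    also have "\<dots> = enn2real (\<integral>\<^sup>+t. ennreal (g t * f (exp (- t))) \<partial>lborel)"
      using g_nonneg by (intro integral_eq_nn_integral) (auto simp: f_def)
    also have "(\<integral>\<^sup>+t. ennreal (g t * f (exp (- t))) \<partial>lborel)
      = (\<integral>\<^sup>+t. ennreal (t powr (\<rho> - 1) / Gamma \<rho>) * indicator {0..1} t \<partial>lborel)"
    \<comment> \<open>The factor exp(-t) of the density cancels against 1/exp(-t) from
      \<open>f\<close>. The strict inequality in \<open>f\<close> excludes t = 1, which is a null
      set.\<close>
    proof (rule nn_integral_cong_AE)
      show "AE t in lborel. ennreal (g t * f (exp (- t))) = ennreal (t powr (\<rho> - 1) / Gamma \<rho>) * indicator {0..1} t"
        using AE_lborel_singleton[of "1::real"]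
        by eventually_elim (auto simp: g_def f_def indicator_def)
    qed
    also have "\<dots> = ennreal ((1 powr (\<rho> - 1 + 1) / (\<rho> - 1 + 1)) / Gamma \<rho>)"
      using \<rho> G by (intro nn_integral_has_integral_lebesgue' has_integral_divide has_integral_powr_from_0) auto
    moreover have "\<rho> \<notin> \<int>\<^sub>\<le>\<^sub>0" using \<rho> by (auto dest: nonpos_Ints_nonpos)
    ultimately show ?thesis using \<rho> G Gamma_plus1[of \<rho>] by (simp add: add.commute)
  qed
  ultimately show ?thesis by blast
qed

text \<open>Weight \<open>\<nu>\<close>, which may be infinite, by exp(-z Y) and normalise; under
  the resulting probability the variable exp(-z Y) takes values in [0,1] and its moments are ratios
  of Laplace transforms, so regular variation gives their limits. Weak convergence to the law of
  \<open>gamma_limit_law\<close> follows. Integrating Karamata's test function \<open>f\<close>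
  undoes the weight and leaves exactly the mass of z Y < 1.\<close>

theorem karamata_tauberian:
  fixes \<nu> :: "'a measure" and Y :: "'a \<Rightarrow> real" and \<rho> :: real
  assumes Y[measurable]: "Y \<in> borel_measurable \<nu>"
    and nonneg: "\<And>x. x \<in> space \<nu> \<Longrightarrow> 0 \<le> Y x"
    and int: "\<And>z. 0 < z \<Longrightarrow> integrable \<nu> (\<lambda>x. exp (- (z * Y x)))"
    and \<rho>: "0 \<le> \<rho>"
    and rv: "\<And>c. 0 < c \<Longrightarrow>
      ((\<lambda>z. (\<integral>x. exp (- (c * z * Y x)) \<partial>\<nu>) / (\<integral>x. exp (- (z * Y x)) \<partial>\<nu>)) \<longlongrightarrow> c powr - \<rho>) (at_right 0)"
  shows "((\<lambda>z. measure \<nu> {x \<in> space \<nu>. z * Y x < 1} / (\<integral>x. exp (- (z * Y x)) \<partial>\<nu>))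
    \<longlongrightarrow> 1 / Gamma (1 + \<rho>)) (at_right 0)"
proof -
  define w where "w z = (\<integral>x. exp (- (z * Y x)) \<partial>\<nu>)" for z
  define f where "f = (\<lambda>x::real. if x > exp (- 1) then 1 / x else 0)"
  have [measurable]: "f \<in> borel_measurable borel" unfolding f_def by measurable
  obtain D where D: "real_distribution D" "AE x in D. x \<in> {0..1}" "emeasure D {exp (- 1)} = 0"
      "\<And>k. (\<integral>x. x ^ k \<partial>D) = real (k + 1) powr - \<rho>" "(\<integral>x. f x \<partial>D) = 1 / Gamma (1 + \<rho>)"
    using gamma_limit_law[OF \<rho>] unfolding f_def by blast
  \<comment> \<open>The case c = 1 is not vacuous: since x / 0 = 0, a ratio tending to 1 forces
    \<open>w z\<close> to be nonzero near 0.\<close>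
  have "((\<lambda>z. w z / w z) \<longlongrightarrow> 1) (at_right 0)"
    using rv[of 1] by (simp add: w_def)
  then have "eventually (\<lambda>z. w z / w z > 0) (at_right 0)"
    by (rule order_tendstoD) simp
  then have "eventually (\<lambda>z. w z \<noteq> 0) (at_right 0)"
    by (rule eventually_mono) auto
  then obtain b where b: "b > 0" "\<And>z. 0 < z \<Longrightarrow> z < b \<Longrightarrow> w z \<noteq> 0"
    unfolding eventually_at_right_field by auto
  have w_pos: "w z > 0" if "0 < z" "z < b" for z
    using b(2)[OF that] unfolding w_def by (simp add: less_le)
  have "((\<lambda>z. measure \<nu> {x \<in> space \<nu>. z * Y x < 1} / w z) \<longlongrightarrow> 1 / Gamma (1 + \<rho>)) (at_right 0)"
  proof (rule tendsto_at_right_sequentially[OF b(1)])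
    fix S :: "nat \<Rightarrow> real" assume S: "\<And>n. 0 < S n" "\<And>n. S n < b" "decseq S" "S \<longlonglongrightarrow> 0"
    have S_lim: "filterlim S (at_right 0) sequentially"
      using S by (intro tendsto_imp_filterlim_at_right) auto
    define Q where "Q n = density \<nu> (\<lambda>x. ennreal (exp (- (S n * Y x)) / w (S n)))" for n
    define L where "L n = distr (Q n) borel (\<lambda>x. exp (- (S n * Y x)))" for n
    have ws: "w (S n) > 0" for n using w_pos S by blast
    have [measurable_cong]: "sets (Q n) = sets \<nu>" for n by (simp add: Q_def)
    have Q: "prob_space (Q n)" for n
    proof (rule prob_spaceI)
      have "emeasure (Q n) (space (Q n)) = (\<integral>\<^sup>+x. ennreal (exp (- (S n * Y x)) / w (S n)) \<partial>\<nu>)"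
        by (auto simp: Q_def emeasure_density intro!: nn_integral_cong)
      also have "\<dots> = ennreal (\<integral>x. exp (- (S n * Y x)) / w (S n) \<partial>\<nu>)"
        using int[OF S(1)[of n]] ws[of n] by (intro nn_integral_eq_integral) auto
      also have "\<dots> = 1" using ws[of n] by (simp add: w_def)
      finally show "emeasure (Q n) (space (Q n)) = 1" .
    qed
    have L: "real_distribution (L n)" for n
      unfolding real_distribution_def real_distribution_axioms_def L_def
      by (auto intro!: prob_space.prob_space_distr[OF Q])
    have L_supp: "AE x in L n. x \<in> {0..1}" for n
      unfolding L_def using S(1)[of n] nonneg
      by (subst AE_distr_iff) (auto simp: Q_def less_imp_le intro!: AE_I2)
    have L_int: "(\<integral>x. h x \<partial>L n) = (\<integral>x. (exp (- (S n * Y x)) / w (S n)) * h (exp (- (S n * Y x))) \<partial>\<nu>)"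
      if [measurable]: "h \<in> borel_measurable borel" for h :: "real \<Rightarrow> real" and n
      unfolding L_def Q_def using ws[of n]
      by (subst integral_distr, simp, simp, subst integral_density) (auto intro!: AE_I2)
    have "weak_conv_m L D"
    proof (rule method_of_moments_unit_interval[OF L D(1) L_supp D(2)])
      fix k
      \<comment> \<open>The weight in \<open>Q n\<close> supplies one factor exp(-(S n * Y x))
        beyond the k-th power, hence k + 1.\<close>
      have "(\<integral>x. x ^ k \<partial>L n) = w (real (k + 1) * S n) / w (S n)" for n
      proof -
        have "(\<integral>x. x ^ k \<partial>L n) = (\<integral>x. exp (- (real (k + 1) * S n * Y x)) / w (S n) \<partial>\<nu>)"
        proof (subst L_int, simp, rule Bochner_Integration.integral_cong[OF refl])
          fix x
          have "exp (- (S n * Y x)) * exp (- (S n * Y x)) ^ k = exp (- (real (k + 1) * S n * Y x))"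
            by (simp add: algebra_simps flip: exp_of_nat_mult exp_add)
          then show "exp (- (S n * Y x)) / w (S n) * exp (- (S n * Y x)) ^ k
            = exp (- (real (k + 1) * S n * Y x)) / w (S n)" by simp
        qed
        then show ?thesis by (simp add: w_def)
      qed
      moreover have "(\<lambda>n. w (real (k + 1) * S n) / w (S n)) \<longlonglongrightarrow> real (k + 1) powr - \<rho>"
        using filterlim_compose[OF rv[of "real (k + 1)"] S_lim] by (simp add: w_def)
      ultimately show "(\<lambda>n. \<integral>x. x ^ k \<partial>L n) \<longlonglongrightarrow> (\<integral>x. x ^ k \<partial>D)"
        by (simp add: D(4))
    qed
    \<comment> \<open>Weak convergence passes to the discontinuous \<open>f\<close> because its only
      jump, at 1/e, carries no mass in the limit.\<close>
    moreover have "emeasure D {x. \<not> isCont f x} = 0"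
    proof -
      have "isCont f x" if "x \<noteq> exp (- 1)" for x
      proof (cases "x > exp (- 1)")
        case True
        then have "x \<noteq> 0" using exp_gt_zero[of "- 1::real"] by linarith
        then have "isCont (\<lambda>x. 1 / x) x" by (intro continuous_intros) auto
        moreover have "eventually (\<lambda>y. y > exp (- 1)) (nhds x)"
          using True by (intro eventually_nhds_in_open[of "{exp (- 1)<..}", simplified]) auto
        then have "eventually (\<lambda>y. f y = 1 / y) (nhds x)"
          by (rule eventually_mono) (simp add: f_def)
        ultimately show ?thesis using isCont_cong by metis
      next
        case False
        with that have "x < exp (- 1)" by simp
        then have "eventually (\<lambda>y. y < exp (- 1)) (nhds x)"
          by (intro eventually_nhds_in_open[of "{..<exp (- 1)}", simplified]) auto
        then have "eventually (\<lambda>y. f y = 0) (nhds x)"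
          by (rule eventually_mono) (simp add: f_def)
        then show ?thesis using isCont_cong[of f "\<lambda>_. 0" x] by simp
      qed
      then have "{x. \<not> isCont f x} \<subseteq> {exp (- 1)}" by auto
      moreover have "{exp (- 1)} \<in> sets D"
        using D(1) by (simp add: real_distribution_def real_distribution_axioms_def)
      ultimately show ?thesis using D(3) emeasure_mono by (metis le_zero_eq)
    qed
    moreover have "norm (f x) \<le> exp 1" for x
    proof -
      have "1 / x \<le> exp 1" if "x > exp (- 1)" for x :: real
      proof -
        have "x > 0" using that exp_gt_zero[of "- 1::real"] by linarith
        with that show ?thesis by (simp add: exp_minus field_simps)
      qed
      then show ?thesis using exp_gt_zero[of "- 1::real"] by (auto simp: f_def)
    qed
    ultimately have "(\<lambda>n. \<integral>x. f x \<partial>L n) \<longlonglongrightarrow> (\<integral>x. f x \<partial>D)"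
      by (intro weak_conv_imp_bdd_ae_continuous_conv[OF L D(1)]) auto
    moreover have "(\<integral>x. f x \<partial>L n) = measure \<nu> {x \<in> space \<nu>. S n * Y x < 1} / w (S n)" for n
    proof -
      have "(\<integral>x. f x \<partial>L n) = (\<integral>x. indicator {x \<in> space \<nu>. S n * Y x < 1} x / w (S n) \<partial>\<nu>)"
        by (subst L_int) (auto simp: f_def indicator_def intro!: Bochner_Integration.integral_cong)
      also have "\<dots> = measure \<nu> {x \<in> space \<nu>. S n * Y x < 1} / w (S n)"
        by (simp add: Int_def conj_commute)
      finally show ?thesis .
    qed
    ultimately show "(\<lambda>n. measure \<nu> {x \<in> space \<nu>. S n * Y x < 1} / w (S n)) \<longlonglongrightarrow> 1 / Gamma (1 + \<rho>)"
      by (simp add: D(5))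
  qed
  then show ?thesis by (simp add: w_def)
qed

section \<open>Truncated inverse moments\<close>

text \<open>Down the dyadic scales \<open>V\<close> may grow, but slow variation limits the growth
  to a factor 1 + e per halving while the scale itself loses a factor 2. The bounds of the blocks
  therefore form a convergent geometric series, and its sum keeps the small factor e.\<close>

lemma (in prob_space) prob_le_of_slowly_varying_truncated_inverse_moment:
  fixes X :: "'a \<Rightarrow> real"
  assumes X[measurable]: "X \<in> borel_measurable M" and pos: "\<And>x. x \<in> space M \<Longrightarrow> 0 < X x"
  defines "V \<equiv> \<lambda>s. \<integral>x. indicator {s<..} (X x) * (1 / X x) \<partial>M"
  assumes slow: "((\<lambda>s. V (s / 2) / V s) \<longlongrightarrow> 1) (at_right 0)"
  shows "((\<lambda>s. prob {x \<in> space M. X x \<le> s} / (s * V s)) \<longlongrightarrow> 0) (at_right 0)"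
proof -
  have V_int: "integrable M (\<lambda>x. indicator {s<..} (X x) * (1 / X x))" if "s > 0" for s
    using that pos by (intro integrable_const_bound[of _ "1 / s"])
      (auto simp: indicator_def frac_le intro!: AE_I2)
  have V_nonneg: "V s \<ge> 0" for s
    unfolding V_def using pos by (intro integral_nonneg_AE) (auto simp: indicator_def less_imp_le intro!: AE_I2)
  define F where "F s = prob {x \<in> space M. X x \<le> s}" for s
  have step: "F s \<le> F (s / 2) + s * (V (s / 2) - V s)" if s: "s > 0" for s
  proof -
    have "F s = F (s / 2) + prob {x \<in> space M. s / 2 < X x \<and> X x \<le> s}"
      unfolding F_def using s by (subst finite_measure_Union[symmetric])
        (auto intro!: arg_cong[where f = prob])
    also have "prob {x \<in> space M. s / 2 < X x \<and> X x \<le> s}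
      = (\<integral>x. indicator {x \<in> space M. s / 2 < X x \<and> X x \<le> s} x \<partial>M)"
      by (simp add: Int_def conj_commute)
    \<comment> \<open>On the block s/2 < X \<le> s one has 1 \<le> s / X, and the two indicators
      differ exactly there.\<close>
    also have "\<dots> \<le> (\<integral>x. s * (indicator {s/2<..} (X x) * (1 / X x) - indicator {s<..} (X x) * (1 / X x)) \<partial>M)"
    proof (rule integral_mono)
      show "integrable M (indicator {x \<in> space M. s / 2 < X x \<and> X x \<le> s} :: 'a \<Rightarrow> real)"
        by (rule integrable_real_indicator) (auto simp: less_top[symmetric])
      show "integrable M (\<lambda>x. s * (indicator {s/2<..} (X x) * (1 / X x) - indicator {s<..} (X x) * (1 / X x)))"
        using V_int[of s] V_int[of "s/2"] s by auto
      show "indicator {x \<in> space M. s / 2 < X x \<and> X x \<le> s} x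
        \<le> s * (indicator {s/2<..} (X x) * (1 / X x) - indicator {s<..} (X x) * (1 / X x))"
        if "x \<in> space M" for x
        using pos[OF that] s that by (auto simp: indicator_def field_simps)
    qed
    also have "\<dots> = s * (V (s / 2) - V s)"
      unfolding V_def using V_int[of s] V_int[of "s/2"] s by (subst integral_mult_right_zero) simp
    finally show ?thesis by simp
  qed
  \<comment> \<open>This disposes of the remainder of the dyadic summation; it holds because
    \<open>X\<close> is strictly positive, so that there is no atom at 0.\<close>
  have F_lim: "(\<lambda>n. F (s / 2 ^ n)) \<longlonglongrightarrow> 0" for s
  proof -
    have "(\<lambda>n. \<integral>x. indicator {x \<in> space M. X x \<le> s / 2 ^ n} x \<partial>M) \<longlonglongrightarrow> (\<integral>x. (0::real) \<partial>M)"
    proof (rule integral_dominated_convergence[where w = "\<lambda>_. 1::real"])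
      show "AE x in M. (\<lambda>n. indicator {x \<in> space M. X x \<le> s / 2 ^ n} x) \<longlonglongrightarrow> (0::real)"
      proof (rule AE_I2)
        fix x assume x: "x \<in> space M"
        have "(\<lambda>n. s / 2 ^ n) \<longlonglongrightarrow> 0" by real_asymp
        then have "eventually (\<lambda>n. s / 2 ^ n < X x) sequentially"
          using pos[OF x] by (rule order_tendstoD)
        then have "eventually (\<lambda>n. indicator {x \<in> space M. X x \<le> s / 2 ^ n} x = (0::real)) sequentially"
          by (rule eventually_mono) auto
        then show "(\<lambda>n. indicator {x \<in> space M. X x \<le> s / 2 ^ n} x) \<longlonglongrightarrow> (0::real)"
          by (rule tendsto_eventually)
      qed
    qed (auto simp: indicator_def)
    then show ?thesis by (simp add: F_def Int_def conj_commute)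
  qed
  \<comment> \<open>With e \<le> 1/2 the ratio (1 + e)/2 of the geometric series is at most 3/4, so
    its sum is at most 4.\<close>
  have key: "eventually (\<lambda>s. F s \<le> 4 * e * (s * V s) \<and> V s > 0) (at_right 0)" if e: "0 < e" "e \<le> 1/2" for e
  proof -
    have "eventually (\<lambda>s. V (s / 2) / V s < 1 + e \<and> V (s / 2) / V s > 0) (at_right 0)"
      using order_tendstoD[OF slow] e by (intro eventually_conj) auto
    then obtain s0 where s0: "s0 > 0"
      "\<And>s. 0 < s \<Longrightarrow> s < s0 \<Longrightarrow> V (s / 2) / V s < 1 + e \<and> V (s / 2) / V s > 0"
      unfolding eventually_at_right_field by auto
    \<comment> \<open>Since x / 0 = 0, a positive ratio excludes \<open>V s = 0\<close>.\<close>
    have Vpos: "V s > 0" if "0 < s" "s < s0" for s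
      using s0(2)[OF that] V_nonneg[of s] by (metis div_by_0 less_eq_real_def less_irrefl)
    have Vle: "V (s / 2) \<le> (1 + e) * V s" if "0 < s" "s < s0" for s
      using s0(2)[OF that] Vpos[OF that] by (simp add: divide_less_eq less_imp_le)
    have "F s \<le> 4 * e * (s * V s)" if s: "0 < s" "s < s0" for s
    proof -
      have small: "s / 2 ^ n < s0" for n
        using s by (smt (verit) divide_le_eq_1 divide_left_mono div_by_1 mult_pos_pos one_le_power zero_less_power)
      have V_iter: "V (s / 2 ^ n) \<le> (1 + e) ^ n * V s" for n
      proof (induction n)
        case (Suc n)
        have "V (s / 2 ^ Suc n) \<le> (1 + e) * V (s / 2 ^ n)"
          using Vle[of "s / 2 ^ n"] small[of n] s by (simp add: field_simps)
        also have "\<dots> \<le> (1 + e) * ((1 + e) ^ n * V s)"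
          using Suc e by (intro mult_left_mono) auto
        finally show ?case by (simp add: mult.assoc)
      qed simp
      have F_iter: "F s \<le> F (s / 2 ^ n) + (\<Sum>k<n. e * (s * V s) * ((1 + e) / 2) ^ k)" for n
      proof (induction n)
        case (Suc n)
        have "V (s / 2 ^ n / 2) - V (s / 2 ^ n) \<le> e * V (s / 2 ^ n)"
          using Vle[of "s / 2 ^ n"] small[of n] s by (simp add: algebra_simps)
        also have "\<dots> \<le> e * ((1 + e) ^ n * V s)"
          using e V_iter by (intro mult_left_mono) auto
        finally have "s / 2 ^ n * (V (s / 2 ^ n / 2) - V (s / 2 ^ n)) \<le> s / 2 ^ n * (e * ((1 + e) ^ n * V s))"
          using s by (intro mult_left_mono) auto
        moreover have "s / 2 ^ n * (e * ((1 + e) ^ n * V s)) = e * (s * V s) * ((1 + e) / 2) ^ n"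
          by (simp add: power_divide)
        moreover have "F (s / 2 ^ n) \<le> F (s / 2 ^ Suc n) + s / 2 ^ n * (V (s / 2 ^ n / 2) - V (s / 2 ^ n))"
          using step[of "s / 2 ^ n"] s by (simp add: field_simps)
        ultimately have "F (s / 2 ^ n) \<le> F (s / 2 ^ Suc n) + e * (s * V s) * ((1 + e) / 2) ^ n" by linarith
        with Suc show ?case by simp
      qed simp
      have "(\<Sum>k<n. e * (s * V s) * ((1 + e) / 2) ^ k) \<le> 4 * e * (s * V s)" for n
      proof -
        have "(\<Sum>k<n. e * (s * V s) * ((1 + e) / 2) ^ k) = e * (s * V s) * (\<Sum>k<n. ((1 + e) / 2) ^ k)"
          by (simp add: sum_distrib_left)
        also have "\<dots> \<le> e * (s * V s) * 4"
        proof (rule mult_left_mono)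
          have "(\<Sum>k<n. ((1 + e) / 2) ^ k) \<le> (\<Sum>k<n. (3 / 4 :: real) ^ k)"
            using e by (intro sum_mono power_mono) auto
          also have "\<dots> = (1 - (3/4) ^ n) / (1 - 3 / 4)" by (subst sum_gp_strict) auto
          also have "\<dots> \<le> 4" by simp
          finally show "(\<Sum>k<n. ((1 + e) / 2) ^ k) \<le> 4" .
        qed (use e s V_nonneg in auto)
        finally show ?thesis by simp
      qed
      then have "F s \<le> F (s / 2 ^ n) + 4 * e * (s * V s)" for n
        using F_iter[of n] by (meson add_left_mono order_trans)
      moreover have "(\<lambda>n. F (s / 2 ^ n) + 4 * e * (s * V s)) \<longlonglongrightarrow> 0 + 4 * e * (s * V s)"
        by (intro tendsto_intros F_lim)
      ultimately show ?thesis
        by (metis (no_types, lifting) LIMSEQ_le_const add_0)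
    qed
    with Vpos s0(1) show ?thesis unfolding eventually_at_right_field by blast
  qed
  have "((\<lambda>s. F s / (s * V s)) \<longlongrightarrow> 0) (at_right 0)"
  proof (rule tendstoI)
    fix d :: real assume d: "d > 0"
    \<comment> \<open>The choice makes the bound \<open>4 * e\<close> at most d/2, which is strictly
      below d.\<close>
    define e where "e = min (1/2) (d / 8)"
    have e: "0 < e" "e \<le> 1/2" "8 * e \<le> d" using d by (auto simp: e_def)
    show "eventually (\<lambda>s. dist (F s / (s * V s)) 0 < d) (at_right 0)"
      using key[OF e(1,2)] eventually_at_right_less[of "0::real"]
    proof eventually_elim
      case (elim s)
      have p: "s * V s > 0" using elim by simp
      then have "F s / (s * V s) \<le> 4 * e" using elim by (simp add: divide_le_eq)
      moreover have "F s / (s * V s) \<ge> 0" using p by (simp add: F_def)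
      ultimately show ?case using e d by simp
    qed
  qed
  then show ?thesis by (simp add: F_def)
qed

text \<open>Karamata's theorem is applied to Y = - log (min X 1) under the measure with density 1/X.
  Clipping changes the transform by at most z, negligible against a quantity bounded away from 0.
  For the second claim, regular variation of \<open>V\<close> in log(1/s) is turned into slow
  variation in s.\<close>

lemma (in prob_space) tauberian_inverse_moment_pos:
  fixes X :: "'a \<Rightarrow> real" and \<psi> :: "real \<Rightarrow> real" and \<rho> :: real
  assumes X[measurable]: "X \<in> borel_measurable M" and pos: "\<And>x. x \<in> space M \<Longrightarrow> 0 < X x"
    and int: "\<And>z. 0 < z \<Longrightarrow> z \<le> 1 \<Longrightarrow> integrable M (\<lambda>x. X x powr (z - 1))"
    and asymp: "((\<lambda>z. (\<integral>x. X x powr (z - 1) \<partial>M) / \<psi> z) \<longlongrightarrow> 1) (at_right 0)"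
    and \<rho>: "0 \<le> \<rho>"
    and rv: "\<And>c. 0 < c \<Longrightarrow> ((\<lambda>z. \<psi> (c * z) / \<psi> z) \<longlongrightarrow> c powr - \<rho>) (at_right 0)"
  shows "((\<lambda>s. (\<integral>x. indicator {s<..} (X x) * (1 / X x) \<partial>M) / \<psi> (1 / ln (1 / s)))
      \<longlongrightarrow> 1 / Gamma (1 + \<rho>)) (at_right 0)" (is ?A)
    and "((\<lambda>s. prob {x \<in> space M. X x < s} / (s * \<psi> (1 / ln (1 / s)))) \<longlongrightarrow> 0) (at_right 0)" (is ?B)
proof -
  define m where "m x = min (X x) 1" for x
  have m[measurable]: "m \<in> borel_measurable M" unfolding m_def by measurable
  have m_pos: "0 < m x" "m x \<le> 1" if "x \<in> space M" for x using pos[OF that] by (auto simp: m_def)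
  define Y where "Y x = - ln (m x)" for x
  have Y[measurable]: "Y \<in> borel_measurable M" unfolding Y_def by measurable
  define \<nu> where "\<nu> = density M (\<lambda>x. ennreal (1 / X x))"
  define w where "w z = (\<integral>x. m x powr z / X x \<partial>M)" for z
  define h where "h z = (\<integral>x. X x powr (z - 1) \<partial>M)" for z
  define V where "V s = (\<integral>x. indicator {s<..} (X x) * (1 / X x) \<partial>M)" for s
  have sp: "space \<nu> = space M" by (simp add: \<nu>_def)
  have w_int: "integrable M (\<lambda>x. m x powr z / X x)" if z: "z > 0" for z
  proof (rule Bochner_Integration.integrable_bound)
    \<comment> \<open>Karamata's theorem asks for all z > 0, whereas \<open>int\<close> covers z
      \<le> 1. Exponents above 1 reduce to 1: where X \<le> 1 powers decrease in the exponent, and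
      where X > 1 the clipped value is 1.\<close>
    show "integrable M (\<lambda>x. X x powr (min z 1 - 1))" using z by (intro int) auto
    show "AE x in M. norm (m x powr z / X x) \<le> norm (X x powr (min z 1 - 1))"
    proof (rule AE_I2)
      fix x assume x: "x \<in> space M"
      have X0: "X x > 0" using pos[OF x] .
      have "m x powr z \<le> X x powr min z 1"
      proof (cases "X x \<le> 1")
        case True
        then show ?thesis using X0 by (simp add: m_def powr_mono')
      next
        case False
        then show ?thesis using z by (simp add: m_def ge_one_powr_ge_zero)
      qed
      then show "norm (m x powr z / X x) \<le> norm (X x powr (min z 1 - 1))"
        using X0 by (simp add: powr_diff divide_right_mono)
    qed
  qed measurable
  have exp_Y: "exp (- (z * Y x)) = m x powr z" if "x \<in> space M" for x z
    using m_pos[OF that] by (simp add: Y_def powr_def)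
  have nu_w: "(\<integral>x. exp (- (z * Y x)) \<partial>\<nu>) = w z" for z
    unfolding \<nu>_def w_def using pos
    by (subst integral_density) (auto simp: exp_Y less_imp_le intro!: AE_I2 Bochner_Integration.integral_cong)
  have nu_int: "integrable \<nu> (\<lambda>x. exp (- (z * Y x)))" if "z > 0" for z
  proof -
    have "integrable M (\<lambda>x. (1 / X x) *\<^sub>R exp (- (z * Y x)))"
      using w_int[OF that] by (rule Bochner_Integration.integrable_cong[THEN iffD1, rotated 2]) (auto simp: exp_Y)
    then show ?thesis
      unfolding \<nu>_def using pos by (subst integrable_density) (auto simp: less_imp_le intro!: AE_I2)
  qed
  \<comment> \<open>As \<open>m\<close> is at most 1, \<open>w\<close> is nonincreasing, so
    \<open>w 1\<close> bounds it from below on (0,1] and can divide the clipping error.\<close>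
  have w1: "w 1 > 0"
  proof -
    have "w 1 \<noteq> 0"
    proof
      assume "w 1 = 0"
      then have "AE x in M. m x powr 1 / X x = 0"
        unfolding w_def using m_pos pos w_int[of 1]
        by (subst (asm) integral_nonneg_eq_0_iff_AE) (auto simp: less_imp_le intro!: AE_I2)
      moreover have "AE x in M. m x powr 1 / X x \<noteq> 0"
        using m_pos pos by (auto simp: less_le intro!: AE_I2)
      ultimately have "AE x in M. False" by eventually_elim simp
      then show False by simp
    qed
    moreover have "w 1 \<ge> 0" unfolding w_def using m_pos pos
      by (intro integral_nonneg_AE) (auto simp: less_imp_le intro!: AE_I2)
    ultimately show ?thesis by simp
  qed
  have w_ge: "w 1 \<le> w z" if "0 < z" "z \<le> 1" for z
    unfolding w_def
  proof (rule integral_mono)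
    fix x assume x: "x \<in> space M"
    then show "m x powr 1 / X x \<le> m x powr z / X x"
      using that m_pos[OF x] pos[OF x] by (intro divide_right_mono powr_mono') auto
  qed (rule w_int; use that in simp)+
  have hw: "0 \<le> h z - w z \<and> h z - w z \<le> z" if z: "0 < z" "z < 1" for z
  proof -
    have eq: "h z - w z = (\<integral>x. X x powr (z - 1) - m x powr z / X x \<partial>M)"
      unfolding h_def w_def using z int w_int by simp
    have bd: "0 \<le> X x powr (z - 1) - m x powr z / X x \<and> X x powr (z - 1) - m x powr z / X x \<le> z"
      if x: "x \<in> space M" for x
    proof (cases "X x \<le> 1")
      case True
      then show ?thesis using pos[OF x] z by (simp add: m_def powr_diff)
    next
      case False
      \<comment> \<open>Weighted arithmetic-geometric mean with weights z and 1 - z; divided by X it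
        bounds the clipping error by z where X > 1.\<close>
      have "X x powr z * 1 powr (1 - z) \<le> z * X x + (1 - z) * 1"
        using z False by (intro Youngs_inequality_0) auto
      then have "X x powr z - 1 \<le> z * X x" using z by (simp add: algebra_simps)
      moreover have "X x powr z \<ge> 1" using False z by (intro ge_one_powr_ge_zero) auto
      ultimately show ?thesis using False
        by (simp add: m_def powr_diff diff_divide_distrib[symmetric] divide_le_eq)
    qed
    have i: "integrable M (\<lambda>x. X x powr (z - 1) - m x powr z / X x)" using z int w_int by simp
    have "h z - w z \<le> (\<integral>x. z \<partial>M)" unfolding eq using i bd by (intro integral_mono) auto
    moreover have "0 \<le> h z - w z" unfolding eq using bd by (intro integral_nonneg_AE) (auto intro!: AE_I2)
    ultimately show ?thesis by (simp add: prob_space)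
  qed
  have ev1: "eventually (\<lambda>z::real. 0 < z \<and> z < 1) (at_right 0)"
    by (auto simp: eventually_at_right_field intro!: exI[of _ 1])
  have "((\<lambda>z. h z / w z - 1) \<longlongrightarrow> 0) (at_right 0)"
  proof (rule tendsto_sandwich[of "\<lambda>_. 0" _ _ "\<lambda>z. z / w 1"])
    have w_pos': "w z > 0" if "0 < z" "z < 1" for z using w_ge[of z] w1 that by simp
    have *: "h z / w z - 1 = (h z - w z) / w z" if "0 < z" "z < 1" for z
      using w_pos'[OF that] by (simp add: field_simps)
    show "eventually (\<lambda>z. 0 \<le> h z / w z - 1) (at_right 0)"
      using ev1 by eventually_elim (use * hw w_pos' in \<open>simp add: less_imp_le\<close>)
    show "eventually (\<lambda>z. h z / w z - 1 \<le> z / w 1) (at_right 0)"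
      using ev1 by eventually_elim (use * hw w_ge w1 in \<open>simp add: frac_le\<close>)
    show "((\<lambda>z. z / w 1) \<longlongrightarrow> 0) (at_right 0)" using w1 by real_asymp
  qed auto
  then have hw1: "((\<lambda>z. h z / w z) \<longlongrightarrow> 1) (at_right 0)"
    using tendsto_add[OF _ tendsto_const[of "1::real"]] by fastforce
  have w_psi: "((\<lambda>z. w z / \<psi> z) \<longlongrightarrow> 1) (at_right 0)"
  proof -
    have "((\<lambda>z. (h z / \<psi> z) / (h z / w z)) \<longlongrightarrow> 1 / 1) (at_right 0)"
      using asymp hw1 unfolding h_def[symmetric] by (intro tendsto_divide) auto
    moreover have "eventually (\<lambda>z. (h z / \<psi> z) / (h z / w z) = w z / \<psi> z) (at_right 0)"
      using order_tendstoD(1)[OF hw1, of 0] by (auto elim!: eventually_mono)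
    ultimately show ?thesis by (rule Lim_transform_eventually[THEN tendsto_eq_rhs]) simp
  qed
  have psi_w: "((\<lambda>z. \<psi> z / w z) \<longlongrightarrow> 1) (at_right 0)"
    using tendsto_inverse[OF w_psi] by (simp add: inverse_eq_divide)
  have psi_nz: "eventually (\<lambda>z. \<psi> z \<noteq> 0) (at_right 0)"
    using order_tendstoD(1)[OF w_psi, of 0] by (auto elim!: eventually_mono)
  have scale: "filterlim (\<lambda>z. c * z) (at_right 0) (at_right 0)" if "c > 0" for c :: real
    using that by real_asymp
  have w_rv: "((\<lambda>z. w (c * z) / w z) \<longlongrightarrow> c powr - \<rho>) (at_right 0)" if c: "c > 0" for c
  proof -
    have "((\<lambda>z. w (c * z) / \<psi> (c * z) * (\<psi> (c * z) / \<psi> z) * (\<psi> z / w z)) \<longlongrightarrow> 1 * c powr - \<rho> * 1) (at_right 0)"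
      by (intro tendsto_mult rv[OF c] psi_w filterlim_compose[OF w_psi scale[OF c]])
    moreover have "eventually (\<lambda>z. w (c * z) / \<psi> (c * z) * (\<psi> (c * z) / \<psi> z) * (\<psi> z / w z) = w (c * z) / w z) (at_right 0)"
      using psi_nz eventually_compose_filterlim[OF psi_nz scale[OF c]] by eventually_elim simp
    ultimately show ?thesis by (rule Lim_transform_eventually[THEN tendsto_eq_rhs]) simp
  qed
  have "((\<lambda>z. measure \<nu> {x \<in> space \<nu>. z * Y x < 1} / (\<integral>x. exp (- (z * Y x)) \<partial>\<nu>)) \<longlongrightarrow> 1 / Gamma (1 + \<rho>)) (at_right 0)"
  proof (rule karamata_tauberian)
    show "Y \<in> borel_measurable \<nu>" by (simp add: \<nu>_def)
    show "0 \<le> Y x" if "x \<in> space \<nu>" for x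
      using m_pos[of x] that by (simp add: sp Y_def ln_le_zero_iff)
  qed (use nu_int \<rho> w_rv in \<open>simp_all add: nu_w\<close>)
  then have kar: "((\<lambda>z. measure \<nu> {x \<in> space \<nu>. z * Y x < 1} / w z) \<longlongrightarrow> 1 / Gamma (1 + \<rho>)) (at_right 0)"
    by (simp add: nu_w)
  have log_lim: "filterlim (\<lambda>s::real. 1 / ln (1 / s)) (at_right 0) (at_right 0)" by real_asymp
  \<comment> \<open>For s < 1 the clipping at 1 does not affect the event X > s, and with z =
    1/log(1/s) this event is z Y < 1.\<close>
  have meas_V: "measure \<nu> {x \<in> space \<nu>. 1 / ln (1 / s) * Y x < 1} = V s" if s: "0 < s" "s < 1" for s
  proof -
    have set_eq: "{x \<in> space \<nu>. 1 / ln (1 / s) * Y x < 1} = {x \<in> space M. s < X x}"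
    proof -
      have "1 / ln (1 / s) * Y x < 1 \<longleftrightarrow> s < X x" if x: "x \<in> space M" for x
      proof -
        have "ln (1 / s) > 0" using s by simp
        then have "1 / ln (1 / s) * Y x < 1 \<longleftrightarrow> Y x < ln (1 / s)" by (simp add: divide_less_eq)
        also have "\<dots> \<longleftrightarrow> ln s < ln (m x)" using s by (simp add: Y_def ln_div)
        also have "\<dots> \<longleftrightarrow> s < X x" using s m_pos[OF x] by (auto simp: m_def)
        finally show ?thesis .
      qed
      then show ?thesis by (auto simp: sp)
    qed
    have "measure \<nu> {x \<in> space M. s < X x} = (\<integral>x. indicator {x \<in> space M. s < X x} x \<partial>\<nu>)"
      by (simp add: sp Collect_conj_eq Int_ac)
    also have "\<dots> = V s"
      unfolding \<nu>_def V_def using pos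
      by (subst integral_density)
        (auto simp: less_imp_le indicator_def intro!: AE_I2 Bochner_Integration.integral_cong)
    finally show ?thesis by (simp only: set_eq)
  qed
  have V_w: "((\<lambda>s. V s / w (1 / ln (1 / s))) \<longlongrightarrow> 1 / Gamma (1 + \<rho>)) (at_right 0)"
  proof -
    have "eventually (\<lambda>s. measure \<nu> {x \<in> space \<nu>. 1 / ln (1 / s) * Y x < 1} / w (1 / ln (1 / s)) = V s / w (1 / ln (1 / s))) (at_right 0)"
      using ev1 by eventually_elim (use meas_V in simp)
    with filterlim_compose[OF kar log_lim] show ?thesis by (rule Lim_transform_eventually)
  qed
  have w_nz: "eventually (\<lambda>z. w z \<noteq> 0) (at_right 0)"
    using ev1 by eventually_elim (use w_ge w1 in force)
  show V_psi: ?A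
  proof -
    have "((\<lambda>s. V s / w (1 / ln (1 / s)) * (w (1 / ln (1 / s)) / \<psi> (1 / ln (1 / s)))) \<longlongrightarrow> 1 / Gamma (1 + \<rho>) * 1) (at_right 0)"
      by (intro tendsto_mult V_w filterlim_compose[OF w_psi log_lim])
    moreover have "eventually (\<lambda>s. V s / w (1 / ln (1 / s)) * (w (1 / ln (1 / s)) / \<psi> (1 / ln (1 / s))) = V s / \<psi> (1 / ln (1 / s))) (at_right 0)"
      using eventually_compose_filterlim[OF w_nz log_lim] by eventually_elim simp
    ultimately show ?thesis unfolding V_def[symmetric] by (rule Lim_transform_eventually[THEN tendsto_eq_rhs]) simp
  qed
  have Gam: "Gamma (1 + \<rho>) > 0" using \<rho> by (intro Gamma_real_pos) auto
  have w_V: "((\<lambda>s. w (1 / ln (1 / s)) / V s) \<longlongrightarrow> Gamma (1 + \<rho>)) (at_right 0)"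
    using tendsto_inverse[OF V_w] Gam by (simp add: inverse_eq_divide)
  have V_mono: "V s \<le> V t" if "0 < t" "t \<le> s" for s t
    unfolding V_def
  proof (rule integral_mono)
    have V_int: "integrable M (\<lambda>x. indicator {s<..} (X x) * (1 / X x))" if "s > 0" for s
      using that pos by (intro integrable_const_bound[of _ "1 / s"])
        (auto simp: indicator_def frac_le intro!: AE_I2)
    show "integrable M (\<lambda>x. indicator {s<..} (X x) * (1 / X x))"
      "integrable M (\<lambda>x. indicator {t<..} (X x) * (1 / X x))" using V_int that by auto
    show "indicator {s<..} (X x) * (1 / X x) \<le> indicator {t<..} (X x) * (1 / X x)"
      if "x \<in> space M" for x using pos[OF that] \<open>t \<le> s\<close> by (auto simp: indicator_def)
  qed
  have V_pos: "eventually (\<lambda>s. V s > 0) (at_right 0)"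
  proof -
    have "eventually (\<lambda>s. V s / w (1 / ln (1 / s)) > 0) (at_right 0)"
      using Gam by (intro order_tendstoD(1)[OF V_w]) auto
    moreover have "eventually (\<lambda>s. w (1 / ln (1 / s)) > 0) (at_right 0)"
      by (rule eventually_compose_filterlim[OF _ log_lim], use ev1 in eventually_elim) (use w_ge w1 in force)
    ultimately show ?thesis by eventually_elim (simp add: zero_less_divide_iff)
  qed
  \<comment> \<open>Passing from s to s^c multiplies log(1/s) by c, hence divides the argument of
    \<open>w\<close> by c.\<close>
  have V_rv: "((\<lambda>s. V (s powr c) / V s) \<longlongrightarrow> c powr \<rho>) (at_right 0)" if c: "c > 0" for c
  proof -
    have pl: "filterlim (\<lambda>s::real. s powr c) (at_right 0) (at_right 0)" using c by real_asymp
    have l1: "((\<lambda>s. V (s powr c) / w (1 / ln (1 / s powr c))) \<longlongrightarrow> 1 / Gamma (1 + \<rho>)) (at_right 0)"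
      by (rule filterlim_compose[OF V_w pl])
    have l2: "((\<lambda>s. w (1 / c * (1 / ln (1 / s))) / w (1 / ln (1 / s))) \<longlongrightarrow> (1 / c) powr - \<rho>) (at_right 0)"
      using c by (intro filterlim_compose[OF w_rv log_lim]) auto
    have "((\<lambda>s. V (s powr c) / w (1 / ln (1 / s powr c)) * (w (1 / c * (1 / ln (1 / s))) / w (1 / ln (1 / s)))
        * (w (1 / ln (1 / s)) / V s)) \<longlongrightarrow> 1 / Gamma (1 + \<rho>) * (1 / c) powr - \<rho> * Gamma (1 + \<rho>)) (at_right 0)"
      by (intro tendsto_mult l1 l2 w_V)
    also have "1 / Gamma (1 + \<rho>) * (1 / c) powr - \<rho> * Gamma (1 + \<rho>) = c powr \<rho>"
      using Gam c by (simp add: powr_divide powr_minus field_simps)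
    finally have l3: "((\<lambda>s. V (s powr c) / w (1 / ln (1 / s powr c)) * (w (1 / c * (1 / ln (1 / s))) / w (1 / ln (1 / s)))
        * (w (1 / ln (1 / s)) / V s)) \<longlongrightarrow> c powr \<rho>) (at_right 0)" .
    have "eventually (\<lambda>s. V (s powr c) / w (1 / ln (1 / s powr c)) * (w (1 / c * (1 / ln (1 / s))) / w (1 / ln (1 / s)))
        * (w (1 / ln (1 / s)) / V s) = V (s powr c) / V s) (at_right 0)"
      using ev1 eventually_compose_filterlim[OF w_nz log_lim]
        eventually_compose_filterlim[OF eventually_compose_filterlim[OF w_nz log_lim] pl]
    proof eventually_elim
      case (elim s)
      have "1 / ln (1 / s powr c) = 1 / c * (1 / ln (1 / s))"
        using elim(1) c by (simp add: ln_div ln_powr)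
      with elim show ?case by simp
    qed
    with l3 show ?thesis by (rule Lim_transform_eventually)
  qed
  have slow: "((\<lambda>s. V (s / 2) / V s) \<longlongrightarrow> 1) (at_right 0)"
  proof (rule order_tendstoI)
    fix a :: real assume "a < 1"
    show "eventually (\<lambda>s. a < V (s / 2) / V s) (at_right 0)"
      using ev1 V_pos
    proof eventually_elim
      case (elim s)
      then have "1 \<le> V (s / 2) / V s" using V_mono[of "s/2" s] by simp
      with \<open>a < 1\<close> show ?case by simp
    qed
  next
    fix a :: real assume a: "1 < a"
    \<comment> \<open>For every c > 1 and small s one has s^c \<le> s/2, so V(s/2) lies between V(s)
      and V(s^c). Taking c so close to 1 that c^\<rho> < a closes the gap.\<close>
    have "((\<lambda>c. c powr \<rho>) \<longlongrightarrow> 1 powr \<rho>) (at_right (1::real))" by (intro tendsto_intros) auto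
    then have "eventually (\<lambda>c. c powr \<rho> < a) (at_right (1::real))"
      using a by (intro order_tendstoD(2)) auto
    then obtain c where c: "c > 1" "c powr \<rho> < a"
      unfolding eventually_at_right_field by (metis dense)
    have "eventually (\<lambda>s::real. s powr c \<le> s / 2) (at_right 0)" using c(1) by real_asymp
    moreover have "eventually (\<lambda>s. V (s powr c) / V s < a) (at_right 0)"
      using order_tendstoD(2)[OF V_rv c(2)] c(1) by simp
    ultimately show "eventually (\<lambda>s. V (s / 2) / V s < a) (at_right 0)"
      using ev1 V_pos
    proof eventually_elim
      case (elim s)
      have "V (s / 2) / V s \<le> V (s powr c) / V s"
        using V_mono[of "s powr c" "s / 2"] elim by (intro divide_right_mono) auto
      with elim show ?case by simp
    qed
  qed
  have small: "((\<lambda>s. prob {x \<in> space M. X x \<le> s} / (s * V s)) \<longlongrightarrow> 0) (at_right 0)"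
    using prob_le_of_slowly_varying_truncated_inverse_moment[OF X pos] slow unfolding V_def by blast
  have le_lim: "((\<lambda>s. prob {x \<in> space M. X x \<le> s} / (s * \<psi> (1 / ln (1 / s)))) \<longlongrightarrow> 0) (at_right 0)"
  proof -
    have "((\<lambda>s. prob {x \<in> space M. X x \<le> s} / (s * V s) * (V s / \<psi> (1 / ln (1 / s)))) \<longlongrightarrow> 0 * (1 / Gamma (1 + \<rho>))) (at_right 0)"
      using small V_psi unfolding V_def[symmetric] by (rule tendsto_mult)
    moreover have "eventually (\<lambda>s. prob {x \<in> space M. X x \<le> s} / (s * V s) * (V s / \<psi> (1 / ln (1 / s)))
        = prob {x \<in> space M. X x \<le> s} / (s * \<psi> (1 / ln (1 / s)))) (at_right 0)"
      using V_pos by eventually_elim simp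
    ultimately show ?thesis by (rule Lim_transform_eventually[THEN tendsto_eq_rhs]) simp
  qed
  show ?B
  proof (rule Lim_null_comparison[OF _ tendsto_rabs_zero[OF le_lim]])
    show "eventually (\<lambda>s. norm (prob {x \<in> space M. X x < s} / (s * \<psi> (1 / ln (1 / s))))
      \<le> \<bar>prob {x \<in> space M. X x \<le> s} / (s * \<psi> (1 / ln (1 / s)))\<bar>) (at_right 0)"
      by (rule always_eventually)
        (auto simp: abs_divide intro!: divide_right_mono finite_measure_mono)
  qed
qed

lemma (in prob_space) tauberian_inverse_moment:
  fixes X :: "'a \<Rightarrow> real" and \<psi> :: "real \<Rightarrow> real" and \<rho> :: real
  assumes X[measurable]: "X \<in> borel_measurable M" and pos: "AE x in M. 0 < X x"
    and int: "\<And>z. 0 < z \<Longrightarrow> z \<le> 1 \<Longrightarrow> integrable M (\<lambda>x. X x powr (z - 1))"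
    and asymp: "((\<lambda>z. (\<integral>x. X x powr (z - 1) \<partial>M) / \<psi> z) \<longlongrightarrow> 1) (at_right 0)"
    and \<rho>: "0 \<le> \<rho>"
    and rv: "\<And>c. 0 < c \<Longrightarrow> ((\<lambda>z. \<psi> (c * z) / \<psi> z) \<longlongrightarrow> c powr - \<rho>) (at_right 0)"
  shows "((\<lambda>s. (\<integral>x. indicator {s<..} (X x) * (1 / X x) \<partial>M) / \<psi> (1 / ln (1 / s)))
      \<longlongrightarrow> 1 / Gamma (1 + \<rho>)) (at_right 0)"
    and "((\<lambda>s. prob {x \<in> space M. X x < s} / (s * \<psi> (1 / ln (1 / s)))) \<longlongrightarrow> 0) (at_right 0)"
proof -
  define X' where "X' x = (if 0 < X x then X x else 1)" for x
  have X'[measurable]: "X' \<in> borel_measurable M" unfolding X'_def by measurable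
  have eq: "AE x in M. X' x = X x" using pos by eventually_elim (simp add: X'_def)
  have c1: "(\<integral>x. X' x powr (z - 1) \<partial>M) = (\<integral>x. X x powr (z - 1) \<partial>M)" for z
    using eq by (intro integral_cong_AE) (auto elim!: eventually_mono)
  have c2: "integrable M (\<lambda>x. X' x powr (z - 1)) = integrable M (\<lambda>x. X x powr (z - 1))" for z
    using eq by (intro integrable_cong_AE) (auto elim!: eventually_mono)
  have c3: "(\<integral>x. indicator {s<..} (X' x) * (1 / X' x) \<partial>M) = (\<integral>x. indicator {s<..} (X x) * (1 / X x) \<partial>M)" for s
    using eq by (intro integral_cong_AE) (auto elim!: eventually_mono)
  have c4: "prob {x \<in> space M. X' x < s} = prob {x \<in> space M. X x < s}" for s
    using eq by (intro finite_measure_eq_AE) (auto elim!: eventually_mono)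
  note core = tauberian_inverse_moment_pos[of X' \<psi> \<rho>, unfolded c1 c2 c3 c4]
  show "((\<lambda>s. (\<integral>x. indicator {s<..} (X x) * (1 / X x) \<partial>M) / \<psi> (1 / ln (1 / s)))
      \<longlongrightarrow> 1 / Gamma (1 + \<rho>)) (at_right 0)"
    by (rule core(1)) (use int asymp \<rho> rv in \<open>auto simp: X'_def\<close>)
  show "((\<lambda>s. prob {x \<in> space M. X x < s} / (s * \<psi> (1 / ln (1 / s)))) \<longlongrightarrow> 0) (at_right 0)"
    by (rule core(2)) (use int asymp \<rho> rv in \<open>auto simp: X'_def\<close>)
qed

section \<open>Moments of the exponential law\<close>

lemma nn_integral_exp_half_line:
  assumes "0 < b"
  shows "(\<integral>\<^sup>+t. (if 0 \<le> t then ennreal (exp (- (t * b))) else 0) \<partial>lborel) = ennreal (1 / b)"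
proof -
  have "(\<integral>\<^sup>+t. (if 0 \<le> t then ennreal (exp (- (t * b))) else 0) \<partial>lborel)
    = (\<integral>\<^sup>+t. ennreal (indicator {0..} t * t powr (1 - 1) * exp (- (b * t))) \<partial>lborel)"
  proof (intro nn_integral_cong_AE)
    show "AE t in lborel. (if 0 \<le> t then ennreal (exp (- (t * b))) else 0)
      = ennreal (indicator {0..} t * t powr (1 - 1) * exp (- (b * t)))"
      using AE_lborel_singleton[of "0::real"]
      by eventually_elim (auto simp: indicator_def mult.commute)
  qed
  also have "\<dots> = ennreal (Gamma 1 * b powr - 1)" using assms by (intro nn_integral_powr_exp) auto
  finally show ?thesis using assms by (simp add: powr_minus divide_inverse)
qed

text \<open>Newton's binomial series with exponent -(n+1). It is the Taylor expansion about q of the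
  n-th moment of an exponential variable tilted by exp(-q x), that is of n!/(1+q)^(n+1). The radius
  of convergence is 1 + q, and the bound 1 serves for all q \<ge> 0 simultaneously.\<close>

lemma negative_binomial_sums:
  fixes x q :: real
  assumes q: "0 \<le> q" and x: "\<bar>x\<bar> < 1"
  shows "(\<lambda>j. x ^ j / fact j * (fact (n + j) / (1 + q) ^ Suc (n + j))) sums (fact n / (1 + q - x) ^ Suc n)"
proof -
  define y where "y = - (x / (1 + q))"
  have y: "\<bar>y\<bar> < 1" using q x by (simp add: y_def abs_divide divide_less_eq)
  have t: "x ^ j / fact j * (fact (n + j) / (1 + q) ^ Suc (n + j))
    = fact n / (1 + q) ^ Suc n * (((- real (Suc n)) gchoose j) * y ^ j)" for j
  proof -
    have "(- real (Suc n)) gchoose j = (- 1) ^ j * ((real (Suc n) + real j - 1) gchoose j)"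
      by (rule gbinomial_minus)
    also have "(real (Suc n) + real j - 1) gchoose j = real ((n + j) choose j)"
      by (simp add: binomial_gbinomial)
    also have "real ((n + j) choose j) = fact (n + j) / (fact j * fact n)"
      by (simp add: binomial_fact)
    finally have g: "(- real (Suc n)) gchoose j = (- 1) ^ j * (fact (n + j) / (fact j * fact n))" .
    have "(- 1) ^ j * y ^ j = x ^ j / (1 + q) ^ j"
      unfolding y_def by (simp flip: power_mult_distrib power_divide)
    then have "((- real (Suc n)) gchoose j) * y ^ j = x ^ j / (1 + q) ^ j * (fact (n + j) / (fact j * fact n))"
      unfolding g by (metis mult.assoc mult.commute)
    then show ?thesis using q by (simp add: power_add)
  qed
  have "(\<lambda>j. fact n / (1 + q) ^ Suc n * (((- real (Suc n)) gchoose j) * y ^ j))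
    sums (fact n / (1 + q) ^ Suc n * (1 + y) powr (- real (Suc n)))"
    by (intro sums_mult gen_binomial_real y)
  also have "fact n / (1 + q) ^ Suc n * (1 + y) powr (- real (Suc n)) = fact n / (1 + q - x) ^ Suc n"
  proof -
    have p: "1 + q - x > 0" using q x by simp
    have 1: "1 + y = (1 + q - x) / (1 + q)" using q by (simp add: y_def field_simps)
    have "(1 + y) powr (- real (Suc n)) = inverse (((1 + q - x) / (1 + q)) ^ Suc n)"
      unfolding 1 using p q by (subst powr_minus, subst powr_realpow) auto
    then show ?thesis using p q by (simp add: power_divide)
  qed
  finally show ?thesis unfolding t .
qed

text \<open>Exponential moments of the law with moments \<open>n!\<close> are only available on a bounded interval, so the
  Laplace transform is continued to the half-line in steps shorter than the radius of convergence.\<close>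

lemma (in prob_space) laplace_of_factorial_moments:
  fixes X :: "'a \<Rightarrow> real"
  assumes X[measurable]: "X \<in> borel_measurable M" and nonneg: "\<And>x. x \<in> space M \<Longrightarrow> 0 \<le> X x"
    and moments: "\<And>n. has_bochner_integral M (\<lambda>x. X x ^ n) (fact n)"
    and q: "0 \<le> q"
  shows "expectation (\<lambda>x. exp (- (q * X x))) = 1 / (1 + q)"
proof -
  have int: "integrable M (\<lambda>x. X x ^ n * exp (- (q * X x)))" if "0 \<le> q" for q n
  proof (rule Bochner_Integration.integrable_bound)
    show "integrable M (\<lambda>x. X x ^ n)" using moments[of n] by (simp add: has_bochner_integral_iff)
    show "AE x in M. norm (X x ^ n * exp (- (q * X x))) \<le> norm (X x ^ n)"
    proof (rule AE_I2)
      fix x assume "x \<in> space M"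
      then have "exp (- (q * X x)) \<le> 1" using that nonneg by simp
      then show "norm (X x ^ n * exp (- (q * X x))) \<le> norm (X x ^ n)"
        by (simp add: abs_mult mult_left_le)
    qed
  qed measurable
  define m where "m q n = (\<integral>x. X x ^ n * exp (- (q * X x)) \<partial>M)" for q n
  \<comment> \<open>All n are carried along, since expanding exp(-h X) expresses the n-th tilted
    moment at q + h through the moments of order n + j at q. Sum and integral may be exchanged
    because the series of absolute values is the same series at +h, convergent for h < 1.\<close>
  have step: "m (q + h) n = fact n / (1 + (q + h)) ^ Suc n"
    if q: "0 \<le> q" and h: "0 \<le> h" "h < 1" and IH: "\<And>n. m q n = fact n / (1 + q) ^ Suc n" for q h n
  proof -
    define f where "f j x = (- h) ^ j / fact j * (X x ^ (n + j) * exp (- (q * X x)))" for j x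
    have fint: "integrable M (f j)" for j unfolding f_def using int[OF q] by simp
    have nf: "norm (f j x) = h ^ j / fact j * (X x ^ (n + j) * exp (- (q * X x)))" if "x \<in> space M" for j x
      using h nonneg[OF that] by (simp add: f_def abs_mult power_abs)
    have exp_sums: "(\<lambda>j. c ^ j / fact j * (X x ^ (n + j) * exp (- (q * X x)))) sums (X x ^ n * exp (- ((q - c) * X x)))" for c x
    proof -
      have "(\<lambda>j. X x ^ n * exp (- (q * X x)) * ((c * X x) ^ j /\<^sub>R fact j)) sums (X x ^ n * exp (- (q * X x)) * exp (c * X x))"
        by (intro sums_mult exp_converges)
      moreover have "X x ^ n * exp (- (q * X x)) * ((c * X x) ^ j /\<^sub>R fact j) = c ^ j / fact j * (X x ^ (n + j) * exp (- (q * X x)))" for j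
        by (simp add: power_add power_mult_distrib field_simps)
      moreover have "exp (- (q * X x)) * exp (c * X x) = exp (- ((q - c) * X x))"
        by (simp add: algebra_simps flip: exp_add)
      ultimately show ?thesis by (simp add: mult.assoc)
    qed
    have mf: "integral\<^sup>L M (f j) = (- h) ^ j / fact j * (fact (n + j) / (1 + q) ^ Suc (n + j))" for j
      unfolding f_def using IH[of "n + j"] by (simp add: m_def)
    have "(\<lambda>j. integral\<^sup>L M (f j)) sums (\<integral>x. (\<Sum>j. f j x) \<partial>M)"
    proof (rule sums_integral[OF fint])
      show "AE x in M. summable (\<lambda>j. norm (f j x))"
      proof (rule AE_I2)
        fix x assume "x \<in> space M"
        then show "summable (\<lambda>j. norm (f j x))"
          using exp_sums[of h x] nf by (simp add: sums_iff)
      qed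
      have "(\<integral>x. norm (f j x) \<partial>M) = h ^ j / fact j * (fact (n + j) / (1 + q) ^ Suc (n + j))" for j
      proof -
        have "(\<integral>x. norm (f j x) \<partial>M) = (\<integral>x. h ^ j / fact j * (X x ^ (n + j) * exp (- (q * X x))) \<partial>M)"
          using nf by (intro Bochner_Integration.integral_cong) auto
        then show ?thesis using IH[of "n + j"] by (simp add: m_def)
      qed
      then show "summable (\<lambda>j. \<integral>x. norm (f j x) \<partial>M)"
        using negative_binomial_sums[OF q, of h n] h by (simp add: sums_iff)
    qed
    also have "(\<lambda>x. \<Sum>j. f j x) = (\<lambda>x. X x ^ n * exp (- ((q + h) * X x)))"
      using exp_sums[of "- h"] by (auto simp: f_def sums_iff)
    finally have "(\<lambda>j. integral\<^sup>L M (f j)) sums m (q + h) n" by (simp add: m_def)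
    moreover have "(\<lambda>j. integral\<^sup>L M (f j)) sums (fact n / (1 + q - - h) ^ Suc n)"
      unfolding mf using h by (intro negative_binomial_sums q) auto
    ultimately show ?thesis using sums_unique2 by (metis add.assoc diff_minus_eq_add)
  qed
  have grid: "m (real k * h) n = fact n / (1 + real k * h) ^ Suc n" if h: "0 \<le> h" "h < 1" for k h n
  proof (induction k arbitrary: n)
    case 0
    show ?case using moments[of n] by (simp add: m_def has_bochner_integral_iff)
  next
    case (Suc k)
    have "real (Suc k) * h = real k * h + h" by (simp add: algebra_simps)
    then show ?case using step[of "real k * h" h n] Suc h by simp
  qed
  \<comment> \<open>More than q steps are taken, so each step q/k is shorter than 1.\<close>
  define k where "k = nat \<lceil>q\<rceil> + 1"
  have k: "real k > q" "real k > 0" by (auto simp: k_def) linarith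
  have "m (real k * (q / real k)) 0 = fact 0 / (1 + real k * (q / real k)) ^ Suc 0"
    using q k by (intro grid) auto
  then show ?thesis using k by (simp add: m_def)
qed

text \<open>For y > 0 the integral of q^(a-1) exp(-q y) over q \<ge> 0 is Gamma(a) y^(-a); Tonelli
  does the rest. Negative moments are thus functions of the Laplace transform alone.\<close>

lemma nn_integral_laplace_mellin:
  fixes N :: "'a measure" and Y :: "'a \<Rightarrow> real"
  assumes N: "sigma_finite_measure N" and Y[measurable]: "Y \<in> borel_measurable N"
    and pos: "AE y in N. 0 < Y y" and a: "0 < a"
  shows "(\<integral>\<^sup>+q. ennreal (indicator {0..} q * q powr (a - 1)) * (\<integral>\<^sup>+y. ennreal (exp (- (Y y * q))) \<partial>N) \<partial>lborel)
    = ennreal (Gamma a) * (\<integral>\<^sup>+y. ennreal (Y y powr - a) \<partial>N)"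
proof -
  interpret N: sigma_finite_measure N by fact
  interpret pair_sigma_finite N lborel ..
  have "(\<integral>\<^sup>+q. ennreal (indicator {0..} q * q powr (a - 1)) * (\<integral>\<^sup>+y. ennreal (exp (- (Y y * q))) \<partial>N) \<partial>lborel)
    = (\<integral>\<^sup>+q. (\<integral>\<^sup>+y. ennreal (indicator {0..} q * q powr (a - 1) * exp (- (Y y * q))) \<partial>N) \<partial>lborel)"
    by (subst nn_integral_cmult[symmetric]) (auto intro!: nn_integral_cong simp: ennreal_mult indicator_def)
  also have "\<dots> = (\<integral>\<^sup>+y. (\<integral>\<^sup>+q. ennreal (indicator {0..} q * q powr (a - 1) * exp (- (Y y * q))) \<partial>lborel) \<partial>N)"
    by (rule Fubini') measurable
  also have "\<dots> = (\<integral>\<^sup>+y. ennreal (Gamma a) * ennreal (Y y powr - a) \<partial>N)"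
  proof (rule nn_integral_cong_AE)
    show "AE y in N. (\<integral>\<^sup>+q. ennreal (indicator {0..} q * q powr (a - 1) * exp (- (Y y * q))) \<partial>lborel)
      = ennreal (Gamma a) * ennreal (Y y powr - a)"
      using pos by eventually_elim
        (use a nn_integral_powr_exp[OF a] Gamma_real_pos[OF a] in \<open>simp add: ennreal_mult'\<close>)
  qed
  finally show ?thesis by (simp add: nn_integral_cmult)
qed

text \<open>The Laplace transform is compared with that of the standard exponential law
  \<open>E\<close>: equal transforms give equal Mellin integrals, and Gamma(a) cancels. For
  \<open>E\<close> the negative moment is Euler's integral for Gamma(1-a). Negative moments are thus
  transferred directly, with no detour through equality of laws.\<close>

lemma nn_integral_inverse_power_exponential:
  fixes X :: "'a \<Rightarrow> real"
  assumes M: "prob_space M" and X[measurable]: "X \<in> borel_measurable M"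
    and pos: "AE x in M. 0 < X x"
    and laplace: "\<And>q. 0 \<le> q \<Longrightarrow> (\<integral>\<^sup>+x. ennreal (exp (- (X x * q))) \<partial>M) = ennreal (1 / (1 + q))"
    and a: "0 < a" "a < 1"
  shows "(\<integral>\<^sup>+x. ennreal (X x powr - a) \<partial>M) = ennreal (Gamma (1 - a))"
proof -
  define E where "E = density lborel (\<lambda>t::real. if 0 \<le> t then ennreal (exp (- t)) else 0)"
  have [measurable_cong]: "sets E = sets borel" by (simp add: E_def)
  have E_laplace: "(\<integral>\<^sup>+t. ennreal (exp (- (t * q))) \<partial>E) = ennreal (1 / (1 + q))" if "0 \<le> q" for q
  proof -
    have "(\<integral>\<^sup>+t. ennreal (exp (- (t * q))) \<partial>E)
      = (\<integral>\<^sup>+t. (if 0 \<le> t then ennreal (exp (- t)) else 0) * ennreal (exp (- (t * q))) \<partial>lborel)"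
      unfolding E_def by (subst nn_integral_density) auto
    also have "\<dots> = (\<integral>\<^sup>+t. (if 0 \<le> t then ennreal (exp (- (t * (1 + q)))) else 0) \<partial>lborel)"
      by (intro nn_integral_cong) (auto simp: algebra_simps simp flip: ennreal_mult exp_add)
    finally show ?thesis using that by (simp add: nn_integral_exp_half_line)
  qed
  interpret E: prob_space E
    using E_laplace[of 0] by (intro prob_spaceI) (simp add: nn_integral_const)
  interpret M: prob_space M by fact
  have E_pos: "AE t in E. 0 < t"
    unfolding E_def using AE_lborel_singleton[of "0::real"]
    by (subst AE_density) (auto elim!: eventually_mono simp: indicator_def)
  have "ennreal (Gamma a) * (\<integral>\<^sup>+x. ennreal (X x powr - a) \<partial>M)
    = (\<integral>\<^sup>+q. ennreal (indicator {0..} q * q powr (a - 1)) * (\<integral>\<^sup>+x. ennreal (exp (- (X x * q))) \<partial>M) \<partial>lborel)"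
    using nn_integral_laplace_mellin[OF M.sigma_finite_measure_axioms X pos a(1)] ..
  also have "\<dots> = (\<integral>\<^sup>+q. ennreal (indicator {0..} q * q powr (a - 1)) * (\<integral>\<^sup>+t. ennreal (exp (- (t * q))) \<partial>E) \<partial>lborel)"
    by (intro nn_integral_cong) (auto simp: indicator_def laplace E_laplace)
  also have "\<dots> = ennreal (Gamma a) * (\<integral>\<^sup>+t. ennreal (t powr - a) \<partial>E)"
    by (rule nn_integral_laplace_mellin[OF E.sigma_finite_measure_axioms _ E_pos a(1)]) measurable
  also have "(\<integral>\<^sup>+t. ennreal (t powr - a) \<partial>E) = (\<integral>\<^sup>+t. ennreal (indicator {0..} t * t powr ((1 - a) - 1) * exp (- (1 * t))) \<partial>lborel)"
    unfolding E_def by (subst nn_integral_density)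
      (auto intro!: nn_integral_cong simp: indicator_def mult.commute simp flip: ennreal_mult)
  also have "\<dots> = ennreal (Gamma (1 - a) * 1 powr - (1 - a))"
    using a by (intro nn_integral_powr_exp) auto
  finally have "ennreal (Gamma a) * (\<integral>\<^sup>+x. ennreal (X x powr - a) \<partial>M) = ennreal (Gamma a) * ennreal (Gamma (1 - a))"
    by simp
  then show ?thesis
    using Gamma_real_pos[OF a(1)] by (subst (asm) ennreal_mult_cancel_left) auto
qed

text \<open>On the product space the two variables become independent, so that moments of every real
  order factorise. The product \<open>X\<close> has the moments n!, hence the Laplace transform and
  the negative moments of the exponential law.\<close>

lemma inverse_moments_of_exponential_product:
  fixes N :: "'b measure" and M :: "'a measure" and R :: "'b \<Rightarrow> real" and J :: "'a \<Rightarrow> real"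
  assumes N: "prob_space N" and M: "prob_space M"
    and R[measurable]: "R \<in> borel_measurable N" and J[measurable]: "J \<in> borel_measurable M"
    and R0: "\<And>x. x \<in> space N \<Longrightarrow> 0 \<le> R x" and J0: "\<And>y. y \<in> space M \<Longrightarrow> 0 \<le> J y"
    and moments: "\<And>n. (\<integral>\<^sup>+x. ennreal (R x ^ n) \<partial>N) * (\<integral>\<^sup>+y. ennreal (J y ^ n) \<partial>M) = ennreal (fact n)"
  shows "AE x in N. 0 < R x"
    and "0 < a \<Longrightarrow> a < 1 \<Longrightarrow>
      (\<integral>\<^sup>+x. ennreal (R x powr - a) \<partial>N) * (\<integral>\<^sup>+y. ennreal (J y powr - a) \<partial>M) = ennreal (Gamma (1 - a))"
proof -
  interpret N: prob_space N by fact
  interpret M: prob_space M by fact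
  interpret P: pair_prob_space N M ..
  define X where "X = (\<lambda>(x, y). R x * J y)"
  have X[measurable]: "X \<in> borel_measurable (N \<Otimes>\<^sub>M M)" unfolding X_def by measurable
  have X0: "0 \<le> X p" if "p \<in> space (N \<Otimes>\<^sub>M M)" for p
    using that R0 J0 by (auto simp: X_def space_pair_measure)
  have prod: "(\<integral>\<^sup>+p. f (fst p) * g (snd p) \<partial>(N \<Otimes>\<^sub>M M)) = (\<integral>\<^sup>+x. f x \<partial>N) * (\<integral>\<^sup>+y. g y \<partial>M)"
    if [measurable]: "f \<in> borel_measurable N" "g \<in> borel_measurable M"
    for f :: "'b \<Rightarrow> ennreal" and g :: "'a \<Rightarrow> ennreal"
    by (subst M.nn_integral_fst[symmetric]) (auto simp: nn_integral_cmult nn_integral_multc)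
  have X_moments: "has_bochner_integral (N \<Otimes>\<^sub>M M) (\<lambda>p. X p ^ n) (fact n)" for n
  proof (rule has_bochner_integral_nn_integral)
    have "(\<integral>\<^sup>+p. ennreal (X p ^ n) \<partial>(N \<Otimes>\<^sub>M M)) = (\<integral>\<^sup>+p. ennreal (R (fst p) ^ n) * ennreal (J (snd p) ^ n) \<partial>(N \<Otimes>\<^sub>M M))"
      using R0 J0 by (intro nn_integral_cong)
        (auto simp: X_def space_pair_measure power_mult_distrib ennreal_mult)
    also have "\<dots> = ennreal (fact n)" by (subst prod) (auto simp: moments)
    finally show "(\<integral>\<^sup>+p. ennreal (X p ^ n) \<partial>(N \<Otimes>\<^sub>M M)) = ennreal (fact n)" .
  qed (use X0 in \<open>auto intro!: AE_I2\<close>)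
  have lap: "P.expectation (\<lambda>p. exp (- (q * X p))) = 1 / (1 + q)" if "0 \<le> q" for q
    using P.laplace_of_factorial_moments[OF X X0 X_moments that] .
  have e_int: "integrable (N \<Otimes>\<^sub>M M) (\<lambda>p. exp (- (q * X p)))" if "0 \<le> q" for q
    using that X0 by (intro P.integrable_const_bound[of _ 1]) (auto intro!: AE_I2)
  \<comment> \<open>P(X = 0) \<le> E exp(-n X) = 1/(1+n) for all n. Positivity has to be known
    separately because \<open>0 powr (- a)\<close> is 0 rather than infinite.\<close>
  have X_pos: "AE p in N \<Otimes>\<^sub>M M. 0 < X p"
  proof -
    have "P.prob {p \<in> space (N \<Otimes>\<^sub>M M). X p = 0} \<le> 1 / (1 + real n)" for n
    proof -
      have "P.prob {p \<in> space (N \<Otimes>\<^sub>M M). X p = 0} = P.expectation (indicator {p \<in> space (N \<Otimes>\<^sub>M M). X p = 0})"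
        by (simp add: Collect_conj_eq Int_ac)
      also have "\<dots> \<le> P.expectation (\<lambda>p. exp (- (real n * X p)))"
        using e_int[of "real n"] by (intro integral_mono) (auto simp: indicator_def less_top[symmetric])
      finally show ?thesis using lap[of "real n"] by simp
    qed
    moreover have "(\<lambda>n. 1 / (1 + real n)) \<longlonglongrightarrow> 0" by real_asymp
    ultimately have "P.prob {p \<in> space (N \<Otimes>\<^sub>M M). X p = 0} \<le> 0" by (meson LIMSEQ_le_const)
    then have "P.prob {p \<in> space (N \<Otimes>\<^sub>M M). X p = 0} = 0" by (simp add: measure_le_0_iff)
    then have "AE p in N \<Otimes>\<^sub>M M. X p \<noteq> 0"
      by (subst (asm) P.prob_eq_0) auto
    then show ?thesis using AE_space by eventually_elim (use X0 in \<open>auto simp: less_le\<close>)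
  qed
  have "AE x in N. AE y in M. 0 < X (x, y)" using P.AE_pair[OF X_pos] .
  then show "AE x in N. 0 < R x"
    using AE_space
  proof eventually_elim
    case (elim x)
    from elim(1) have "AE y in M. 0 < R x"
      by eventually_elim (use R0[OF elim(2)] in \<open>auto simp: X_def zero_less_mult_iff\<close>)
    then show ?case by simp
  qed
  show "(\<integral>\<^sup>+x. ennreal (R x powr - a) \<partial>N) * (\<integral>\<^sup>+y. ennreal (J y powr - a) \<partial>M) = ennreal (Gamma (1 - a))"
    if a: "0 < a" "a < 1"
  proof -
    have "(\<integral>\<^sup>+x. ennreal (R x powr - a) \<partial>N) * (\<integral>\<^sup>+y. ennreal (J y powr - a) \<partial>M)
      = (\<integral>\<^sup>+p. ennreal (R (fst p) powr - a) * ennreal (J (snd p) powr - a) \<partial>(N \<Otimes>\<^sub>M M))"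
      by (subst prod) auto
    also have "\<dots> = (\<integral>\<^sup>+p. ennreal (X p powr - a) \<partial>(N \<Otimes>\<^sub>M M))"
      using R0 J0 by (intro nn_integral_cong)
        (auto simp: X_def space_pair_measure powr_mult simp flip: ennreal_mult)
    also have "\<dots> = ennreal (Gamma (1 - a))"
    proof (rule nn_integral_inverse_power_exponential[OF P.prob_space_axioms X X_pos _ a])
      show "(\<integral>\<^sup>+p. ennreal (exp (- (X p * q))) \<partial>(N \<Otimes>\<^sub>M M)) = ennreal (1 / (1 + q))" if "0 \<le> q" for q
        using e_int[OF that] lap[OF that] by (subst nn_integral_eq_integral) (auto simp: mult.commute)
    qed
    finally show ?thesis .
  qed
qed

section \<open>Riemann sums and tail integrals of monotone functions\<close>

text \<open>Sums over right endpoints are integrals of step functions below the decreasing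
  \<open>h\<close>, so \<open>h\<close> itself dominates; right continuity gives pointwise
  convergence because the right end of the cell of v decreases to v. The purpose is to express an
  integral over a path through finitely many of its values, to which independence of increments
  applies.\<close>

lemma dyadic_riemann_sum_tendsto:
  fixes h :: "real \<Rightarrow> real"
  assumes h[measurable]: "h \<in> borel_measurable borel"
    and nonneg: "\<And>v. 0 \<le> v \<Longrightarrow> 0 \<le> h v"
    and antimono: "\<And>u v. 0 \<le> u \<Longrightarrow> u \<le> v \<Longrightarrow> h v \<le> h u"
    and right_cont: "\<And>v. 0 \<le> v \<Longrightarrow> (h \<longlongrightarrow> h v) (at_right v)"
    and fin: "(\<integral>\<^sup>+v. ennreal (h v) * indicator {0..} v \<partial>lborel) < \<infinity>"
  shows "(\<lambda>n. ennreal (\<Sum>i\<in>{1..n * 2 ^ n}. h (real i * (1 / 2 ^ n)) * (1 / 2 ^ n)))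
    \<longlonglongrightarrow> (\<integral>\<^sup>+v. ennreal (h v) * indicator {0..} v \<partial>lborel)"
proof -
  \<comment> \<open>The cells are [(i-1)/2^n, i/2^n), closed on the left, and \<open>K n v\<close>
    is the index i of the cell containing v; hence the \<open>Suc\<close>.\<close>
  define K where "K n v = Suc (nat \<lfloor>v * 2 ^ n\<rfloor>)" for n :: nat and v :: real
  define g where "g n v = (\<Sum>i\<in>{1..n * 2 ^ n}. ennreal (h (real i * (1 / 2 ^ n)))
    * indicator {real (i - 1) * (1 / 2 ^ n)..<real i * (1 / 2 ^ n)} v)" for n :: nat and v :: real
  have K_bounds: "v < real (K n v) * (1 / 2 ^ n)" "real (K n v) * (1 / 2 ^ n) \<le> v + 1 / 2 ^ n"
    if "0 \<le> v" for n v
  proof -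
    have 1: "real (nat \<lfloor>v * 2 ^ n\<rfloor>) = of_int \<lfloor>v * 2 ^ n\<rfloor>" using that by simp
    have 2: "of_int \<lfloor>v * 2 ^ n\<rfloor> \<le> v * 2 ^ n" "v * 2 ^ n < of_int \<lfloor>v * 2 ^ n\<rfloor> + 1" by linarith+
    show "v < real (K n v) * (1 / 2 ^ n)" "real (K n v) * (1 / 2 ^ n) \<le> v + 1 / 2 ^ n"
      using 1 2 by (simp_all add: K_def field_simps)
  qed
  have cell: "v \<in> {real (i - 1) * (1 / 2 ^ n)..<real i * (1 / 2 ^ n)} \<longleftrightarrow> i = K n v"
    if "0 \<le> v" "1 \<le> i" for v i n
  proof -
    have "v \<in> {real (i - 1) * (1 / 2 ^ n)..<real i * (1 / 2 ^ n)}
        \<longleftrightarrow> real (i - 1) \<le> v * 2 ^ n \<and> v * 2 ^ n < real (i - 1) + 1"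
      using that by (simp add: field_simps of_nat_diff)
    also have "\<dots> \<longleftrightarrow> \<lfloor>v * 2 ^ n\<rfloor> = int (i - 1)"
      by (simp add: floor_eq_iff)
    also have "\<dots> \<longleftrightarrow> i = K n v"
      using that unfolding K_def by auto
    finally show ?thesis .
  qed
  have g_eq: "g n v = (if K n v \<le> n * 2 ^ n then ennreal (h (real (K n v) * (1 / 2 ^ n))) else 0)"
    if "0 \<le> v" for n v
  proof -
    have "g n v = (\<Sum>i\<in>{1..n * 2 ^ n}. if i = K n v then ennreal (h (real (K n v) * (1 / 2 ^ n))) else 0)"
      unfolding g_def using cell[OF that]
      by (intro sum.cong) (auto simp: indicator_def split: if_splits)
    then show ?thesis by (simp add: K_def)
  qed
  have g_neg: "g n v = 0" if "v < 0" for n v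
  proof -
    have "indicator {real (i - 1) * (1 / 2 ^ n)..<real i * (1 / 2 ^ n)} v = (0::ennreal)" for i
    proof -
      have "0 \<le> real (i - 1) * (1 / 2 ^ n)" by simp
      with that have "\<not> real (i - 1) * (1 / 2 ^ n) \<le> v" by linarith
      then show ?thesis by simp
    qed
    then show ?thesis unfolding g_def by (simp only: mult_zero_right sum.neutral_const)
  qed
  have cell_int: "(\<integral>\<^sup>+v. ennreal c * indicator {p..<r} v \<partial>lborel) = ennreal (c * (r - p))"
    if "0 \<le> c" "p \<le> r" for c p r :: real
    using that by (subst nn_integral_cmult_indicator) (auto simp: ennreal_mult)
  have g_int: "(\<integral>\<^sup>+v. g n v \<partial>lborel) = ennreal (\<Sum>i\<in>{1..n * 2 ^ n}. h (real i * (1 / 2 ^ n)) * (1 / 2 ^ n))" for n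
  proof -
    have "(\<integral>\<^sup>+v. g n v \<partial>lborel)
      = (\<Sum>i\<in>{1..n * 2 ^ n}. (\<integral>\<^sup>+v. ennreal (h (real i * (1 / 2 ^ n)))
          * indicator {real (i - 1) * (1 / 2 ^ n)..<real i * (1 / 2 ^ n)} v \<partial>lborel))"
      unfolding g_def by (rule nn_integral_sum) measurable
    also have "\<dots> = (\<Sum>i\<in>{1..n * 2 ^ n}. ennreal (h (real i * (1 / 2 ^ n)) * (1 / 2 ^ n)))"
    proof (rule sum.cong[OF refl])
      fix i assume i: "i \<in> {1..n * 2 ^ n}"
      have "real i * (1 / 2 ^ n) - real (i - 1) * (1 / 2 ^ n) = 1 / 2 ^ n"
        using i by (simp add: of_nat_diff field_simps)
      moreover have "real (i - 1) * (1 / 2 ^ n) \<le> real i * (1 / 2 ^ n)"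
        by (intro mult_right_mono) auto
      ultimately show "(\<integral>\<^sup>+v. ennreal (h (real i * (1 / 2 ^ n)))
          * indicator {real (i - 1) * (1 / 2 ^ n)..<real i * (1 / 2 ^ n)} v \<partial>lborel)
        = ennreal (h (real i * (1 / 2 ^ n)) * (1 / 2 ^ n))"
        using cell_int nonneg[of "real i * (1 / 2 ^ n)"] by (metis of_nat_0_le_iff zero_le_divide_1_iff zero_le_mult_iff zero_le_numeral zero_le_power)
    qed
    also have "\<dots> = ennreal (\<Sum>i\<in>{1..n * 2 ^ n}. h (real i * (1 / 2 ^ n)) * (1 / 2 ^ n))"
      using nonneg by (intro sum_ennreal) auto
    finally show ?thesis .
  qed
  have "(\<lambda>n. \<integral>\<^sup>+v. g n v \<partial>lborel) \<longlonglongrightarrow> (\<integral>\<^sup>+v. ennreal (h v) * indicator {0..} v \<partial>lborel)"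
  proof (rule nn_integral_dominated_convergence[where w = "\<lambda>v. ennreal (h v) * indicator {0..} v"])
    show "g n \<in> borel_measurable lborel" for n unfolding g_def by measurable
    show "AE v in lborel. g n v \<le> ennreal (h v) * indicator {0..} v" for n
    proof (rule AE_I2)
      fix v :: real
      show "g n v \<le> ennreal (h v) * indicator {0..} v"
        using g_neg[of v n] g_eq[of v n] antimono[of v "real (K n v) * (1 / 2 ^ n)"] K_bounds(1)[of v n]
        by (cases "0 \<le> v") (auto simp: ennreal_leI)
    qed
    show "AE v in lborel. (\<lambda>n. g n v) \<longlonglongrightarrow> ennreal (h v) * indicator {0..} v"
    proof (rule AE_I2)
      fix v :: real
      show "(\<lambda>n. g n v) \<longlonglongrightarrow> ennreal (h v) * indicator {0..} v"
      proof (cases "0 \<le> v")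
        case False
        then show ?thesis by (simp add: g_neg)
      next
        case True
        have "filterlim (\<lambda>n. real (K n v) * (1 / 2 ^ n)) (at_right v) sequentially"
        proof (rule tendsto_imp_filterlim_at_right)
          have "(\<lambda>n. v + 1 / 2 ^ n) \<longlonglongrightarrow> v" by real_asymp
          then show "(\<lambda>n. real (K n v) * (1 / 2 ^ n)) \<longlonglongrightarrow> v"
            by (rule tendsto_sandwich[OF _ _ tendsto_const, rotated 2])
              (use K_bounds[OF True] in \<open>auto intro!: always_eventually less_imp_le\<close>)
        qed (use K_bounds[OF True] in auto)
        from filterlim_compose[OF right_cont[OF True] this]
        have "(\<lambda>n. ennreal (h (real (K n v) * (1 / 2 ^ n)))) \<longlonglongrightarrow> ennreal (h v)"
          by (intro tendsto_ennrealI)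
        moreover have "eventually (\<lambda>n. ennreal (h (real (K n v) * (1 / 2 ^ n))) = g n v) sequentially"
          \<comment> \<open>From n \<ge> v + 1 on, the right end of the cell of v is at most v +
            1/2^n \<le> n, so the cut-off of the sum at time n no longer matters.\<close>
          using eventually_ge_at_top[of "nat \<lceil>v + 1\<rceil>"]
        proof eventually_elim
          case (elim n)
          then have "v + 1 \<le> real n" by linarith
          moreover have "1 / 2 ^ n \<le> (1::real)" by simp
          ultimately have "real (K n v) * (1 / 2 ^ n) \<le> real n"
            using K_bounds(2)[OF True, of n] by linarith
          then have "real (K n v) \<le> real (n * 2 ^ n)" by (simp add: divide_le_eq)
          then have "K n v \<le> n * 2 ^ n" by (simp only: of_nat_le_iff)
          then show ?case by (simp add: g_eq[OF True])
        qed
        ultimately show ?thesis using True by (simp add: Lim_transform_eventually)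
      qed
    qed
  qed (use fin in measurable)
  then show ?thesis by (simp only: g_int)
qed

text \<open>The substitution \<open>y = \<integral>\<^sub>s\<^sup>\<infinity> h\<close>, for integrands \<open>h\<close> that may be discontinuous: the tail integral
  transports the measure \<open>h(s) ds\<close> to Lebesgue measure.\<close>

lemma nn_integral_powr_tail_integral:
  fixes h :: "real \<Rightarrow> real" and z :: real
  assumes h[measurable]: "h \<in> borel_measurable borel"
    and pos: "\<And>u. 0 \<le> u \<Longrightarrow> 0 < h u" and le_1: "\<And>u. 0 \<le> u \<Longrightarrow> h u \<le> 1"
  defines "A \<equiv> \<lambda>s. \<integral>\<^sup>+u. (if s \<le> u then ennreal (h u) else 0) \<partial>lborel"
  assumes fin: "A 0 < \<infinity>" and z: "0 < z"
  shows "(\<integral>\<^sup>+s. (if 0 \<le> s then ennreal (h s) else 0) * ennreal (enn2real (A s) powr (z - 1)) \<partial>lborel)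
    = ennreal (enn2real (A 0) powr z / z)"
proof -
  define a where "a s = enn2real (A s)" for s
  have A_meas[measurable]: "A \<in> borel_measurable borel" unfolding A_def by measurable
  have a_meas[measurable]: "a \<in> borel_measurable borel" unfolding a_def by measurable
  have A_le: "A t \<le> A s" if "s \<le> t" for s t
    unfolding A_def using that by (intro nn_integral_mono) auto
  have A_fin: "A s < \<infinity>" if "0 \<le> s" for s using A_le[OF that] fin by (auto simp: less_top[symmetric] top_unique)
  have A_a: "A s = ennreal (a s)" if "0 \<le> s" for s using A_fin[OF that] by (simp add: a_def)
  have a_nonneg: "0 \<le> a s" for s by (simp add: a_def)
  have split: "A s = (\<integral>\<^sup>+u. ennreal (h u) * indicator {s..<t} u \<partial>lborel) + A t" if "s \<le> t" for s t
    unfolding A_def using that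
    by (subst nn_integral_add[symmetric]) (auto intro!: nn_integral_cong simp: indicator_def)
  have diff: "(\<integral>\<^sup>+u. ennreal (h u) * indicator {s..<t} u \<partial>lborel) = ennreal (a s - a t) \<and> a t \<le> a s"
    if "0 \<le> s" "s \<le> t" for s t
  proof -
    have "a t \<le> a s" using A_le[OF that(2)] A_fin[OF that(1)] by (simp add: a_def enn2real_mono)
    moreover have "(\<integral>\<^sup>+u. ennreal (h u) * indicator {s..<t} u \<partial>lborel) = A s - A t"
      using split[OF that(2)] A_fin[of t] that by simp
    ultimately show ?thesis using that A_a a_nonneg by (simp add: ennreal_minus)
  qed
  \<comment> \<open>The bound h \<le> 1 makes the tail integral Lipschitz, hence continuous even
    where \<open>h\<close> jumps; continuity is needed for the intermediate value theorem
    below.\<close>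
  have lip: "a s - a t \<le> t - s" if "0 \<le> s" "s \<le> t" for s t
  proof -
    have "ennreal (a s - a t) \<le> (\<integral>\<^sup>+u. indicator {s..<t} u \<partial>lborel)"
      unfolding conjunct1[OF diff[OF that], symmetric]
      using that le_1 by (intro nn_integral_mono) (auto simp: indicator_def)
    also have "\<dots> = ennreal (t - s)" using that by simp
    finally show ?thesis using that by (simp add: ennreal_le_iff)
  qed
  have strict: "a t < a s" if "0 \<le> s" "s < t" for s t
  proof (rule ccontr)
    assume "\<not> a t < a s"
    then have "(\<integral>\<^sup>+u. ennreal (h u) * indicator {s..<t} u \<partial>lborel) = 0"
      using diff[of s t] that by (simp add: ennreal_neg)
    then have "AE u in lborel. ennreal (h u) * indicator {s..<t} u = 0"
      by (subst (asm) nn_integral_0_iff_AE) auto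
    then have "AE u in lborel. u \<notin> {s..<t}"
    proof eventually_elim
      case (elim u)
      then show ?case using pos[of u] that by (auto simp: indicator_def ennreal_eq_0_iff split: if_splits)
    qed
    then have "emeasure lborel {s..<t} = 0" by (subst (asm) AE_iff_measurable[of "{s..<t}"]) auto
    then show False using that by simp
  qed
  have a_pos: "0 < a s" if "0 \<le> s" for s using strict[OF that, of "s + 1"] a_nonneg[of "s + 1"] by simp
  have cont: "continuous_on {0..T} a" for T
  proof (rule lipschitz_on_continuous_on, rule lipschitz_onI)
    show "dist (a s) (a t) \<le> 1 * dist s t" if "s \<in> {0..T}" "t \<in> {0..T}" for s t
      using lip[of s t] lip[of t s] diff[of s t] diff[of t s] that
      by (cases "s \<le> t") (auto simp: dist_real_def)
  qed simp
  have lim: "(\<lambda>n. a (real n)) \<longlonglongrightarrow> 0"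
  proof -
    have "(\<lambda>n. A (real n)) \<longlonglongrightarrow> (\<integral>\<^sup>+u. 0 \<partial>(lborel :: real measure))"
      unfolding A_def
    proof (rule nn_integral_dominated_convergence[where w = "\<lambda>u. if 0 \<le> u then ennreal (h u) else 0"])
      show "(\<integral>\<^sup>+u. (if 0 \<le> u then ennreal (h u) else 0) \<partial>lborel) < \<infinity>" using fin by (simp add: A_def)
      show "AE u in lborel. (\<lambda>n. if real n \<le> u then ennreal (h u) else 0) \<longlonglongrightarrow> 0"
      proof (rule AE_I2)
        fix u :: real
        have "eventually (\<lambda>n. (if real n \<le> u then ennreal (h u) else 0) = 0) sequentially"
          using eventually_gt_at_top[of "nat \<lceil>u\<rceil>"] by eventually_elim (auto split: if_splits, linarith)
        then show "(\<lambda>n. if real n \<le> u then ennreal (h u) else 0) \<longlonglongrightarrow> 0" by (rule tendsto_eventually)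
      qed
    qed auto
    then have "(\<lambda>n. ennreal (a (real n))) \<longlonglongrightarrow> ennreal 0" by (simp add: A_a)
    then show ?thesis using a_nonneg by (subst (asm) tendsto_ennreal_iff) auto
  qed
  define \<mu> where "\<mu> = density lborel (\<lambda>s. if 0 \<le> s then ennreal (h s) else 0)"
  have [measurable_cong]: "sets \<mu> = sets borel" by (simp add: \<mu>_def)
  \<comment> \<open>It suffices to compare half-lines. For 0 < x < a 0 some c has a c = x, because
    \<open>a\<close> is continuous and tends to 0; strict decrease makes {a > x} the interval [0,c),
    whose mass is a 0 - a c = a 0 - x.\<close>
  have "distr \<mu> borel a = density lborel (indicator {0<..<a 0})"
  proof (rule measure_eqI_lessThan)
    fix x :: real
    have e1: "emeasure (distr \<mu> borel a) {x<..}
      = (\<integral>\<^sup>+s. (if 0 \<le> s then ennreal (h s) else 0) * indicator {s. x < a s} s \<partial>lborel)"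
      unfolding \<mu>_def by (subst emeasure_distr) (auto simp: emeasure_density vimage_def)
    have tot: "(\<integral>\<^sup>+s. (if 0 \<le> s then ennreal (h s) else 0) * indicator {s. x < a s} s \<partial>lborel) \<le> A 0"
      unfolding A_def by (intro nn_integral_mono) (auto simp: indicator_def)
    then show "emeasure (distr \<mu> borel a) {x<..} < \<infinity>"
      unfolding e1 using fin by (auto simp: less_top[symmetric] top_unique)
    have e2: "emeasure (density lborel (indicator {0<..<a 0})) {x<..}
      = emeasure lborel ({0<..<a 0} \<inter> {x<..})"
      by (subst emeasure_density) (auto simp flip: indicator_inter_arith)
    consider "x \<le> 0" | "0 < x" "x < a 0" | "a 0 \<le> x" by linarith
    then show "emeasure (distr \<mu> borel a) {x<..} = emeasure (density lborel (indicator {0<..<a 0})) {x<..}"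
    proof cases
      case 1
      have "(\<integral>\<^sup>+s. (if 0 \<le> s then ennreal (h s) else 0) * indicator {s. x < a s} s \<partial>lborel) = A 0"
        unfolding A_def
      proof (rule nn_integral_cong)
        fix s :: real
        show "(if 0 \<le> s then ennreal (h s) else 0) * indicator {s. x < a s} s = (if 0 \<le> s then ennreal (h s) else 0)"
          using 1 a_pos[of s] by (auto simp: indicator_def)
      qed
      moreover have "{0<..<a 0} \<inter> {x<..} = {0<..<a 0}" using 1 by auto
      ultimately show ?thesis using a_nonneg by (simp add: e1 e2 A_a)
    next
      case 2
      have "eventually (\<lambda>n. a (real n) < x) sequentially" using lim 2(1) by (rule order_tendstoD)
      then obtain n where n: "a (real n) < x" by (auto simp: eventually_sequentially)
      obtain c where c: "0 \<le> c" "a c = x"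
        using IVT2'[of a "real n" x 0] n 2 cont by auto
      have "(\<integral>\<^sup>+s. (if 0 \<le> s then ennreal (h s) else 0) * indicator {s. x < a s} s \<partial>lborel)
        = (\<integral>\<^sup>+u. ennreal (h u) * indicator {0..<c} u \<partial>lborel)"
      proof (rule nn_integral_cong)
        fix s :: real
        have "x < a s \<longleftrightarrow> s < c" if "0 \<le> s"
          using strict[of c s] strict[of s c] c that by (cases s c rule: linorder_cases) auto
        then show "(if 0 \<le> s then ennreal (h s) else 0) * indicator {s. x < a s} s = ennreal (h s) * indicator {0..<c} s"
          by (auto simp: indicator_def)
      qed
      also have "\<dots> = ennreal (a 0 - x)" using diff[of 0 c] c by simp
      finally have "(\<integral>\<^sup>+s. (if 0 \<le> s then ennreal (h s) else 0) * indicator {s. x < a s} s \<partial>lborel) = ennreal (a 0 - x)" .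
      moreover have "{0<..<a 0} \<inter> {x<..} = {x<..<a 0}" using 2 by auto
      ultimately show ?thesis using 2 by (simp add: e1 e2)
    next
      case 3
      have "(\<integral>\<^sup>+s. (if 0 \<le> s then ennreal (h s) else 0) * indicator {s. x < a s} s \<partial>lborel) = (\<integral>\<^sup>+s. 0 \<partial>(lborel :: real measure))"
      proof (rule nn_integral_cong)
        fix s :: real
        have "\<not> x < a s" if "0 \<le> s" using diff[of 0 s] that 3 by simp
        then show "(if 0 \<le> s then ennreal (h s) else 0) * indicator {s. x < a s} s = 0"
          by (auto simp: indicator_def)
      qed
      moreover have "{0<..<a 0} \<inter> {x<..} = {}" using 3 by auto
      ultimately show ?thesis by (simp add: e1 e2)
    qed
  qed auto
  then have "(\<integral>\<^sup>+y. ennreal (y powr (z - 1)) \<partial>distr \<mu> borel a)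
    = (\<integral>\<^sup>+y. ennreal (y powr (z - 1)) \<partial>density lborel (indicator {0<..<a 0}))" by simp
  also have "\<dots> = (\<integral>\<^sup>+y. indicator {0<..<a 0} y * ennreal (y powr (z - 1)) \<partial>lborel)"
    by (rule nn_integral_density) auto
  also have "\<dots> = (\<integral>\<^sup>+y. ennreal (y powr (z - 1)) * indicator {0..a 0} y \<partial>lborel)"
  proof (rule nn_integral_cong_AE)
    show "AE y in lborel. indicator {0<..<a 0} y * ennreal (y powr (z - 1)) = ennreal (y powr (z - 1)) * indicator {0..a 0} y"
      using AE_lborel_singleton[of "0::real"] AE_lborel_singleton[of "a 0"]
      by eventually_elim (auto simp: indicator_def)
  qed
  also have "\<dots> = ennreal (a 0 powr (z - 1 + 1) / (z - 1 + 1))"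
    using z a_nonneg by (intro nn_integral_has_integral_lebesgue' has_integral_powr_from_0) auto
  finally have "(\<integral>\<^sup>+y. ennreal (y powr (z - 1)) \<partial>distr \<mu> borel a) = ennreal (a 0 powr z / z)" by simp
  also have "(\<integral>\<^sup>+y. ennreal (y powr (z - 1)) \<partial>distr \<mu> borel a) = (\<integral>\<^sup>+s. ennreal (a s powr (z - 1)) \<partial>\<mu>)"
    by (rule nn_integral_distr) auto
  also have "\<dots> = (\<integral>\<^sup>+s. (if 0 \<le> s then ennreal (h s) else 0) * ennreal (a s powr (z - 1)) \<partial>lborel)"
    unfolding \<mu>_def by (rule nn_integral_density) auto
  finally show ?thesis by (simp add: a_def)
qed

section \<open>Exponential functionals of subordinators\<close>

context subordinator
begin

lemma process_nonneg: "\<omega> \<in> space M \<Longrightarrow> 0 \<le> t \<Longrightarrow> 0 \<le> \<xi> t \<omega>"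
  using monotone_onD[OF nondecreasing_paths, of \<omega> 0 t] starts_at_zero[of \<omega>] by simp

lemma process_mono: "\<omega> \<in> space M \<Longrightarrow> 0 \<le> s \<Longrightarrow> s \<le> t \<Longrightarrow> \<xi> s \<omega> \<le> \<xi> t \<omega>"
  using monotone_onD[OF nondecreasing_paths, of \<omega> s t] by simp

text \<open>Joint measurability comes from right continuity: time is approximated strictly from the
  right by dyadics, which take countably many values. Clipping by \<open>max 0\<close> is due to the
  absence of any assumption at negative times.\<close>

lemma measurable_process_pair [measurable]:
  "(\<lambda>(t, \<omega>). \<xi> (max 0 t) \<omega>) \<in> borel_measurable (borel \<Otimes>\<^sub>M M)"
proof -
  define r :: "nat \<Rightarrow> real \<Rightarrow> real" where "r n t = (of_int \<lfloor>max 0 t * 2 ^ n\<rfloor> + 1) / 2 ^ n" for n t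
  have r: "max 0 t < r n t" "r n t \<le> max 0 t + 1 / 2 ^ n" for n t
  proof -
    define x where "x = max 0 t"
    have "of_int \<lfloor>x * 2 ^ n\<rfloor> \<le> x * 2 ^ n" "x * 2 ^ n < of_int \<lfloor>x * 2 ^ n\<rfloor> + 1" by linarith+
    then show "max 0 t < r n t" "r n t \<le> max 0 t + 1 / 2 ^ n"
      unfolding r_def x_def[symmetric] by (simp_all add: field_simps)
  qed
  have "(\<lambda>p :: real \<times> 'a. \<xi> (max 0 (fst p)) (snd p)) \<in> borel_measurable (borel \<Otimes>\<^sub>M M)"
  proof (rule borel_measurable_LIMSEQ_real)
    fix n
    have [measurable]: "(\<lambda>p :: real \<times> 'a. \<xi> (max 0 ((of_int k + 1) / 2 ^ n)) (snd p)) \<in> borel_measurable (borel \<Otimes>\<^sub>M M)" for k :: int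
      using measurable_process[of "max 0 ((of_int k + 1) / 2 ^ n)"] by measurable
    have "(\<lambda>p :: real \<times> 'a. \<xi> (max 0 ((of_int \<lfloor>max 0 (fst p) * 2 ^ n\<rfloor> + 1) / 2 ^ n)) (snd p)) \<in> borel_measurable (borel \<Otimes>\<^sub>M M)"
      by (rule measurable_compose_countable[where g = "\<lambda>p :: real \<times> 'a. \<lfloor>max 0 (fst p) * 2 ^ n\<rfloor>"]) measurable
    then show "(\<lambda>p :: real \<times> 'a. \<xi> (max 0 (r n (fst p))) (snd p)) \<in> borel_measurable (borel \<Otimes>\<^sub>M M)"
      by (simp only: r_def)
  next
    fix p assume "p \<in> space ((borel :: real measure) \<Otimes>\<^sub>M M)"
    then have p: "snd p \<in> space M" by (auto simp: space_pair_measure)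
    have "((\<lambda>u. \<xi> u (snd p)) \<longlongrightarrow> \<xi> (max 0 (fst p)) (snd p)) (at_right (max 0 (fst p)))"
      using right_continuous_paths[OF p, of "max 0 (fst p)"] by (simp add: continuous_within)
    moreover have "filterlim (\<lambda>n. r n (fst p)) (at_right (max 0 (fst p))) sequentially"
    proof (rule tendsto_imp_filterlim_at_right)
      have "(\<lambda>n. max 0 (fst p) + 1 / 2 ^ n) \<longlonglongrightarrow> max 0 (fst p)" by real_asymp
      then show "(\<lambda>n. r n (fst p)) \<longlonglongrightarrow> max 0 (fst p)"
        by (rule tendsto_sandwich[OF _ _ tendsto_const, rotated 2]) (use r in \<open>auto intro!: always_eventually less_imp_le\<close>)
    qed (use r in auto)
    ultimately have "(\<lambda>n. \<xi> (r n (fst p)) (snd p)) \<longlonglongrightarrow> \<xi> (max 0 (fst p)) (snd p)"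
      by (rule filterlim_compose)
    moreover have "max 0 (r n (fst p)) = r n (fst p)" for n using r(1)[of "fst p" n] by simp
    ultimately show "(\<lambda>n. \<xi> (max 0 (r n (fst p))) (snd p)) \<longlonglongrightarrow> \<xi> (max 0 (fst p)) (snd p)" by simp
  qed
  then show ?thesis by (simp add: case_prod_beta')
qed

lemma measurable_path [measurable]:
  assumes "\<omega> \<in> space M"
  shows "(\<lambda>t. \<xi> (max 0 t) \<omega>) \<in> borel_measurable borel"
proof -
  have "(\<lambda>t. (t, \<omega>)) \<in> borel \<rightarrow>\<^sub>M borel \<Otimes>\<^sub>M M" using assms by measurable
  from measurable_compose[OF this measurable_process_pair] show ?thesis by simp
qed

text \<open>The Markov property at time s for a finite equidistant grid: what follows s is
  independent of the value at s and distributed like the process started afresh. The later values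
  are partial sums of consecutive increments, which are independent and all have the law of the
  increment over [0,d].\<close>

lemma grid_increments_independent:
  fixes F :: "real \<Rightarrow> ennreal" and H :: "(nat \<Rightarrow> real) \<Rightarrow> ennreal"
  assumes s: "0 \<le> s" and d: "0 \<le> d"
    and F[measurable]: "F \<in> borel_measurable borel"
    and H[measurable]: "H \<in> borel_measurable (PiM {1..m} (\<lambda>_. borel))"
  shows "(\<integral>\<^sup>+\<omega>. F (\<xi> s \<omega>) * H (\<lambda>i\<in>{1..m}. \<xi> (s + real i * d) \<omega> - \<xi> s \<omega>) \<partial>M)
    = (\<integral>\<^sup>+\<omega>. F (\<xi> s \<omega>) \<partial>M) * (\<integral>\<^sup>+\<omega>. H (\<lambda>i\<in>{1..m}. \<xi> (real i * d) \<omega>) \<partial>M)"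
proof -
  \<comment> \<open>\<open>H'\<close> is \<open>H\<close> rewritten in terms of the increments; the
    values on the grid are their partial sums.\<close>
  define H' where "H' x = H (\<lambda>i\<in>{1..m}. \<Sum>j\<in>{1..i}. x j)" for x :: "nat \<Rightarrow> real"
  have H'[measurable]: "H' \<in> borel_measurable (PiM {1..m} (\<lambda>_. borel))"
  proof -
    have "(\<lambda>x. \<lambda>i\<in>{1..m}. \<Sum>j\<in>{1..i}. x j) \<in> PiM {1..m} (\<lambda>_. borel) \<rightarrow>\<^sub>M PiM {1..m} (\<lambda>_. borel :: real measure)"
    proof (rule measurable_restrict)
      fix i assume i: "i \<in> {1..m}"
      show "(\<lambda>x. \<Sum>j\<in>{1..i}. x j) \<in> borel_measurable (PiM {1..m} (\<lambda>_. borel :: real measure))"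
        using i by (intro borel_measurable_sum measurable_component_singleton) auto
    qed
    from measurable_compose[OF this H] show ?thesis unfolding H'_def .
  qed
  define L where "L = (PiM {1..m} (\<lambda>_::nat. distr M borel (\<lambda>\<omega>. \<xi> d \<omega> - \<xi> 0 \<omega>)))"
  have core: "(\<integral>\<^sup>+\<omega>. F (\<xi> s \<omega>) * H (\<lambda>i\<in>{1..m}. \<xi> (s + real i * d) \<omega> - \<xi> s \<omega>) \<partial>M)
    = (\<integral>\<^sup>+\<omega>. F (\<xi> s \<omega>) \<partial>M) * (\<integral>\<^sup>+x. H' x \<partial>L)"
    if s: "0 \<le> s" and F[measurable]: "F \<in> borel_measurable borel" for s and F :: "real \<Rightarrow> ennreal"
  proof -
    \<comment> \<open>The grid is 0, s, s+d, s+2d, and so on. Its increment number 0 is the value at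
      s, and the increments 1 to m are those of length d after s.\<close>
    define t where "t i = (if i = 0 then 0 else s + real (i - 1) * d)" for i
    define \<Delta> where "\<Delta> i \<omega> = \<xi> (t (Suc i)) \<omega> - \<xi> (t i) \<omega>" for i \<omega>
    have t_nonneg: "0 \<le> t i" for i using s d by (simp add: t_def)
    have t_mono: "mono t"
    proof (rule incseq_SucI)
      fix i show "t i \<le> t (Suc i)"
        using s d by (cases i) (auto simp: t_def algebra_simps)
    qed
    have indep: "indep_vars (\<lambda>_. borel) \<Delta> (insert 0 {1..m})"
    proof -
      have "indep_vars (\<lambda>_. borel) \<Delta> {..<Suc m}"
        unfolding \<Delta>_def using t_nonneg t_mono
        by (intro independent_increments) (auto intro: mono_on_subset)
      moreover have "{..<Suc m} = insert 0 {1..m}" by auto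
      ultimately show ?thesis by simp
    qed
    have \<Delta>[measurable]: "\<Delta> i \<in> borel_measurable M" for i
      unfolding \<Delta>_def using measurable_process[OF t_nonneg] by measurable
    define Q where "Q i = distr M borel (\<Delta> i)" for i
    interpret Q: product_sigma_finite Q
      unfolding product_sigma_finite_def Q_def
      by (auto intro!: prob_space_imp_sigma_finite prob_space_distr)
    have law: "distr M (PiM (insert 0 {1..m}) (\<lambda>_. borel)) (\<lambda>\<omega>. \<lambda>i\<in>insert 0 {1..m}. \<Delta> i \<omega>) = PiM (insert 0 {1..m}) Q"
      unfolding Q_def using indep by (subst (asm) indep_vars_iff_distr_eq_PiM) auto
    have L_Q: "PiM {1..m} Q = L"
      unfolding L_def
    proof (rule PiM_cong[OF refl])
      fix i assume i: "i \<in> {1..m}"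
      have "Q i = distr M borel (\<lambda>\<omega>. \<xi> ((s + real (i - 1) * d) + d) \<omega> - \<xi> (s + real (i - 1) * d) \<omega>)"
        using i unfolding Q_def \<Delta>_def t_def by (simp add: algebra_simps of_nat_diff)
      also have "\<dots> = distr M borel (\<lambda>\<omega>. \<xi> d \<omega> - \<xi> 0 \<omega>)"
        using s d by (intro stationary_increments) auto
      finally show "Q i = distr M borel (\<lambda>\<omega>. \<xi> d \<omega> - \<xi> 0 \<omega>)" .
    qed
    have sets_Q[measurable_cong]: "sets (PiM J Q) = sets (PiM J (\<lambda>_. borel))" for J
      by (intro sets_PiM_cong) (auto simp: Q_def)
    have meas[measurable]: "(\<lambda>x. F (x 0) * H' (restrict x {1..m})) \<in> borel_measurable (PiM (insert 0 {1..m}) (\<lambda>_. borel))"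
    proof -
      have "(\<lambda>x. restrict x {1..m}) \<in> PiM (insert 0 {1..m}) (\<lambda>_. borel) \<rightarrow>\<^sub>M PiM {1..m} (\<lambda>_. borel :: real measure)"
        by (rule measurable_restrict_subset) auto
      from measurable_compose[OF this H'] show ?thesis by measurable
    qed
    have tel: "(\<Sum>j\<in>{1..i}. \<Delta> j \<omega>) = \<xi> (s + real i * d) \<omega> - \<xi> s \<omega>" for i \<omega>
    proof (induction i)
      case (Suc i)
      then show ?case by (simp add: \<Delta>_def t_def)
    qed simp
    have "(\<integral>\<^sup>+\<omega>. F (\<xi> s \<omega>) * H (\<lambda>i\<in>{1..m}. \<xi> (s + real i * d) \<omega> - \<xi> s \<omega>) \<partial>M)
      = (\<integral>\<^sup>+\<omega>. F (\<Delta> 0 \<omega>) * H' (restrict (\<lambda>i\<in>insert 0 {1..m}. \<Delta> i \<omega>) {1..m}) \<partial>M)"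
    proof (rule nn_integral_cong)
      fix \<omega> assume "\<omega> \<in> space M"
      then have "\<Delta> 0 \<omega> = \<xi> s \<omega>" by (simp add: \<Delta>_def t_def starts_at_zero)
      moreover have "H' (restrict (\<lambda>i\<in>insert 0 {1..m}. \<Delta> i \<omega>) {1..m}) = H (\<lambda>i\<in>{1..m}. \<xi> (s + real i * d) \<omega> - \<xi> s \<omega>)"
        unfolding H'_def
      proof (rule arg_cong[where f = H], rule restrict_ext)
        fix i assume i: "i \<in> {1..m}"
        have "(\<Sum>j\<in>{1..i}. restrict (\<lambda>i\<in>insert 0 {1..m}. \<Delta> i \<omega>) {1..m} j) = (\<Sum>j\<in>{1..i}. \<Delta> j \<omega>)"
          using i by (intro sum.cong) auto
        then show "(\<Sum>j\<in>{1..i}. restrict (\<lambda>i\<in>insert 0 {1..m}. \<Delta> i \<omega>) {1..m} j) = \<xi> (s + real i * d) \<omega> - \<xi> s \<omega>"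
          by (simp only: tel)
      qed
      ultimately show "F (\<xi> s \<omega>) * H (\<lambda>i\<in>{1..m}. \<xi> (s + real i * d) \<omega> - \<xi> s \<omega>)
        = F (\<Delta> 0 \<omega>) * H' (restrict (\<lambda>i\<in>insert 0 {1..m}. \<Delta> i \<omega>) {1..m})" by simp
    qed
    also have "\<dots> = (\<integral>\<^sup>+\<omega>. (\<lambda>x. F (x 0) * H' (restrict x {1..m})) (\<lambda>i\<in>insert 0 {1..m}. \<Delta> i \<omega>) \<partial>M)" by simp
    also have "\<dots> = (\<integral>\<^sup>+x. F (x 0) * H' (restrict x {1..m}) \<partial>PiM (insert 0 {1..m}) Q)"
      unfolding law[symmetric] by (rule nn_integral_distr[symmetric]) (use meas in measurable)
    also have "\<dots> = (\<integral>\<^sup>+x. (\<integral>\<^sup>+y. F y * H' x \<partial>Q 0) \<partial>PiM {1..m} Q)"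
    proof (subst Q.product_nn_integral_insert)
      show "(\<integral>\<^sup>+x. (\<integral>\<^sup>+y. F ((x(0 := y)) 0) * H' (restrict (x(0 := y)) {1..m}) \<partial>Q 0) \<partial>PiM {1..m} Q)
        = (\<integral>\<^sup>+x. (\<integral>\<^sup>+y. F y * H' x \<partial>Q 0) \<partial>PiM {1..m} Q)"
      proof (intro nn_integral_cong)
        fix x y assume "x \<in> space (PiM {1..m} Q)"
        then have "restrict (x(0 := y)) {1..m} = x"
          by (auto simp: space_PiM PiE_def extensional_def restrict_def fun_eq_iff)
        then show "F ((x(0 := y)) 0) * H' (restrict (x(0 := y)) {1..m}) = F y * H' x" by simp
      qed
    qed (use meas in \<open>auto simp: measurable_cong_sets[OF sets_Q refl]\<close>)
    also have "\<dots> = (\<integral>\<^sup>+x. (\<integral>\<^sup>+y. F y \<partial>Q 0) * H' x \<partial>PiM {1..m} Q)"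
      by (intro nn_integral_cong nn_integral_multc) (simp add: Q_def)
    also have "\<dots> = (\<integral>\<^sup>+y. F y \<partial>Q 0) * (\<integral>\<^sup>+x. H' x \<partial>PiM {1..m} Q)"
      by (rule nn_integral_cmult) (use H' in \<open>simp add: measurable_cong_sets[OF sets_Q refl] del: One_nat_def\<close>)
    also have "(\<integral>\<^sup>+y. F y \<partial>Q 0) = (\<integral>\<^sup>+\<omega>. F (\<Delta> 0 \<omega>) \<partial>M)"
      unfolding Q_def by (rule nn_integral_distr) auto
    also have "\<dots> = (\<integral>\<^sup>+\<omega>. F (\<xi> s \<omega>) \<partial>M)"
      by (rule nn_integral_cong) (simp add: \<Delta>_def t_def starts_at_zero)
    finally show ?thesis by (simp only: L_Q)
  qed
  have "(\<integral>\<^sup>+\<omega>. H (\<lambda>i\<in>{1..m}. \<xi> (real i * d) \<omega>) \<partial>M) = (\<integral>\<^sup>+\<omega>. H (\<lambda>i\<in>{1..m}. \<xi> (0 + real i * d) \<omega> - \<xi> 0 \<omega>) \<partial>M)"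
    by (rule nn_integral_cong) (simp add: starts_at_zero cong: restrict_cong)
  also have "\<dots> = (\<integral>\<^sup>+x. H' x \<partial>L)"
    using core[of 0 "\<lambda>_. 1"] by (simp add: emeasure_space_1)
  finally have base: "(\<integral>\<^sup>+\<omega>. H (\<lambda>i\<in>{1..m}. \<xi> (real i * d) \<omega>) \<partial>M) = (\<integral>\<^sup>+x. H' x \<partial>L)" .
  show ?thesis unfolding base by (rule core[OF s F])
qed

text \<open>Independence and stationarity make the Laplace transform multiplicative in time, so -
  log of it is additive and, by monotone paths, nondecreasing. A monotone solution of Cauchy's
  equation is linear, hence determined by its value at time 1, which is the Laplace
  exponent.\<close>

lemma nn_integral_exp_process:
  assumes q: "0 \<le> q" and t: "0 \<le> t"
  shows "(\<integral>\<^sup>+\<omega>. ennreal (exp (- (q * \<xi> t \<omega>))) \<partial>M) = ennreal (exp (- (t * laplace_exponent M \<xi> q)))"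
proof -
  define g where "g t = (\<integral>\<omega>. exp (- (q * \<xi> t \<omega>)) \<partial>M)" for t
  have int: "integrable M (\<lambda>\<omega>. exp (- (q * \<xi> t \<omega>)))" if "0 \<le> t" for t
    using measurable_process[OF that] q process_nonneg[OF _ that]
    by (intro integrable_const_bound[of _ 1]) (auto intro!: AE_I2)
  have nn: "(\<integral>\<^sup>+\<omega>. ennreal (exp (- (q * \<xi> t \<omega>))) \<partial>M) = ennreal (g t)" if "0 \<le> t" for t
    unfolding g_def using int[OF that] by (intro nn_integral_eq_integral) auto
  have g_pos: "0 < g t" if "0 \<le> t" for t
  proof -
    have "g t \<noteq> 0"
    proof
      assume "g t = 0"
      then have "AE \<omega> in M. exp (- (q * \<xi> t \<omega>)) = 0"
        unfolding g_def using int[OF that] by (subst (asm) integral_nonneg_eq_0_iff_AE) auto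
      then show False by simp
    qed
    moreover have "0 \<le> g t" unfolding g_def by simp
    ultimately show ?thesis by simp
  qed
  have g_add: "g (s + t) = g s * g t" if st: "0 \<le> s" "0 \<le> t" for s t
  proof -
    have [measurable]: "(\<lambda>x. ennreal (exp (- (q * x (1::nat))))) \<in> borel_measurable (PiM {1..1} (\<lambda>_. borel))"
      by measurable
    have "ennreal (g (s + t)) = (\<integral>\<^sup>+\<omega>. ennreal (exp (- (q * \<xi> s \<omega>)))
        * ennreal (exp (- (q * (\<lambda>i\<in>{1..1::nat}. \<xi> (s + real i * t) \<omega> - \<xi> s \<omega>) 1))) \<partial>M)"
      unfolding nn[OF add_nonneg_nonneg[OF st], symmetric]
      by (intro nn_integral_cong) (simp add: algebra_simps flip: ennreal_mult exp_add)
    also have "\<dots> = (\<integral>\<^sup>+\<omega>. ennreal (exp (- (q * \<xi> s \<omega>))) \<partial>M)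
        * (\<integral>\<^sup>+\<omega>. ennreal (exp (- (q * (\<lambda>i\<in>{1..1::nat}. \<xi> (real i * t) \<omega>) 1))) \<partial>M)"
      using st by (intro grid_increments_independent) auto
    also have "\<dots> = ennreal (g s * g t)"
      using nn[OF st(1)] nn[OF st(2)] g_pos[OF st(1)] by (simp add: ennreal_mult' less_imp_le)
    finally show ?thesis using g_pos st by (simp add: less_imp_le)
  qed
  define f where "f t = - ln (g t)" for t
  have f_add: "f (s + t) = f s + f t" if "0 \<le> s" "0 \<le> t" for s t
    using g_add[OF that] g_pos[OF that(1)] g_pos[OF that(2)] by (simp add: f_def ln_mult)
  have f_mono: "f s \<le> f t" if st: "0 \<le> s" "s \<le> t" for s t
  proof -
    have "g t \<le> g s"
      unfolding g_def using int st q process_mono[OF _ st] by (intro integral_mono) (auto intro!: mult_left_mono)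
    then show ?thesis using g_pos[of s] g_pos[of t] st by (simp add: f_def)
  qed
  have f_0: "f 0 = 0" using f_add[of 0 0] by simp
  have f_nat: "f (real n * t) = real n * f t" if "0 \<le> t" for n t
    using that by (induction n) (simp_all add: f_0 f_add distrib_right)
  have f_lin: "f t = t * f 1" if t: "0 \<le> t" for t
  proof -
    have f1: "0 \<le> f 1" using f_mono[of 0 1] f_0 by simp
    \<comment> \<open>With k \<le> n t \<le> k + 1, both n f(t) and n t f(1) lie between k f(1) and
      (k+1) f(1). Their distance is at most f(1) for every n, which forces f(t) = t f(1).\<close>
    have bd: "\<bar>f t - t * f 1\<bar> * real n \<le> f 1" for n
    proof -
      define k where "k = nat \<lfloor>real n * t\<rfloor>"
      have k: "real k \<le> real n * t" "real n * t \<le> real (Suc k)"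
        using t by (auto simp: k_def of_nat_nat) linarith
      have "real k * f 1 \<le> real n * f t" "real n * f t \<le> real (Suc k) * f 1"
        using f_mono[of "real k * 1" "real n * t"] f_mono[of "real n * t" "real (Suc k) * 1"] k
          f_nat[of 1 k] f_nat[of 1 "Suc k"] f_nat[OF t, of n] t by simp_all
      moreover have "real k * f 1 \<le> real n * t * f 1" "real n * t * f 1 \<le> real (Suc k) * f 1"
        using k f1 by (auto intro: mult_right_mono)
      ultimately have "\<bar>real n * f t - real n * t * f 1\<bar> \<le> f 1" by (simp add: algebra_simps)
      moreover have "\<bar>f t - t * f 1\<bar> * real n = \<bar>real n * f t - real n * t * f 1\<bar>"
        by (simp add: abs_mult_pos' algebra_simps flip: abs_mult_pos)
      ultimately show ?thesis by simp
    qed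
    have "\<bar>f t - t * f 1\<bar> = 0"
    proof (rule ccontr)
      assume "\<bar>f t - t * f 1\<bar> \<noteq> 0"
      then obtain n where "f 1 < real n * \<bar>f t - t * f 1\<bar>"
        using reals_Archimedean3[of "\<bar>f t - t * f 1\<bar>"] by auto
      then show False using bd[of n] by (simp add: mult.commute)
    qed
    then show ?thesis by simp
  qed
  have "laplace_exponent M \<xi> q = f 1"
    by (simp add: laplace_exponent_def f_def g_def)
  moreover have "g t = exp (- f t)" using g_pos[OF t] by (simp add: f_def)
  ultimately show ?thesis using nn[OF t] f_lin[OF t] by simp
qed


text \<open>The clipping \<open>max 0 u\<close> only matters for \<open>s < 0\<close>; it makes the integrand jointly measurable on the whole line.\<close>

definition tail_functional :: "real \<Rightarrow> real \<Rightarrow> 'a \<Rightarrow> ennreal" where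
  "tail_functional \<alpha> s \<omega> = (\<integral>\<^sup>+u. (if s \<le> u then ennreal (exp (- \<alpha> * \<xi> (max 0 u) \<omega>)) else 0) \<partial>lborel)"

lemma exponential_functional_eq_tail: "exponential_functional \<alpha> \<xi> \<omega> = tail_functional \<alpha> 0 \<omega>"
  unfolding exponential_functional_def tail_functional_def
  by (intro nn_integral_cong) (auto simp: indicator_def)

lemma measurable_tail_functional [measurable]:
  "(\<lambda>(s, \<omega>). tail_functional \<alpha> s \<omega>) \<in> borel_measurable (borel \<Otimes>\<^sub>M M)"
proof -
  have [measurable]: "(\<lambda>x. \<xi> (max 0 (snd x)) (snd (fst x))) \<in> borel_measurable ((borel \<Otimes>\<^sub>M M) \<Otimes>\<^sub>M lborel)"
  proof -
    have "(\<lambda>x. (snd x, snd (fst x))) \<in> ((borel \<Otimes>\<^sub>M M) \<Otimes>\<^sub>M lborel) \<rightarrow>\<^sub>M (borel \<Otimes>\<^sub>M M)" by measurable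
    from measurable_compose[OF this measurable_process_pair] show ?thesis by simp
  qed
  have "(\<lambda>x. (\<integral>\<^sup>+u. (if fst x \<le> u then ennreal (exp (- \<alpha> * \<xi> (max 0 u) (snd x))) else 0) \<partial>lborel))
    \<in> borel_measurable (borel \<Otimes>\<^sub>M M)"
    by measurable
  then show ?thesis by (simp add: tail_functional_def case_prod_beta')
qed

lemma measurable_tail_functional_at [measurable]: "tail_functional \<alpha> s \<in> borel_measurable M"
proof -
  have "(\<lambda>\<omega>. (s, \<omega>)) \<in> M \<rightarrow>\<^sub>M borel \<Otimes>\<^sub>M M" by measurable
  from measurable_compose[OF this measurable_tail_functional] show ?thesis by simp
qed

lemma tail_functional_le: "s \<le> t \<Longrightarrow> tail_functional \<alpha> t \<omega> \<le> tail_functional \<alpha> s \<omega>"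
  unfolding tail_functional_def by (intro nn_integral_mono) auto

lemma tail_functional_pos:
  assumes "\<omega> \<in> space M" shows "0 < tail_functional \<alpha> s \<omega>"
proof -
  have "tail_functional \<alpha> s \<omega> \<noteq> 0"
  proof
    assume "tail_functional \<alpha> s \<omega> = 0"
    then have "AE u in lborel. (if s \<le> u then ennreal (exp (- \<alpha> * \<xi> (max 0 u) \<omega>)) else 0) = 0"
      unfolding tail_functional_def using measurable_path[OF assms]
      by (subst (asm) nn_integral_0_iff_AE) auto
    then have "AE u in lborel. u \<notin> {s..<s + 1}"
      by eventually_elim (auto simp: ennreal_eq_0_iff not_le split: if_splits)
    then have "emeasure lborel {s..<s + 1} = 0" by (subst (asm) AE_iff_measurable[of "{s..<s + 1}"]) auto
    then show False by simp
  qed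
  then show ?thesis by (simp add: zero_less_iff_neq_zero)
qed

lemma nn_integral_exp_process_time:
  assumes q: "0 \<le> q" and pos: "0 < laplace_exponent M \<xi> q"
  shows "(\<integral>\<^sup>+s. (if 0 \<le> s then (\<integral>\<^sup>+\<omega>. ennreal (exp (- (q * \<xi> s \<omega>))) \<partial>M) else 0) \<partial>lborel)
    = ennreal (1 / laplace_exponent M \<xi> q)"
  unfolding nn_integral_exp_half_line[OF pos, symmetric]
  by (intro nn_integral_cong) (simp add: nn_integral_exp_process[OF q])

text \<open>This first moment, computed directly by Tonelli, shows that the functional is almost
  surely finite before the recursion for its moments is available.\<close>

lemma nn_integral_exponential_functional:
  assumes \<alpha>: "0 \<le> \<alpha>" and pos: "0 < laplace_exponent M \<xi> \<alpha>"
  shows "(\<integral>\<^sup>+\<omega>. tail_functional \<alpha> 0 \<omega> \<partial>M) = ennreal (1 / laplace_exponent M \<xi> \<alpha>)"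
proof -
  interpret pair_sigma_finite lborel M ..
  have "(\<integral>\<^sup>+\<omega>. tail_functional \<alpha> 0 \<omega> \<partial>M)
    = (\<integral>\<^sup>+u. (\<integral>\<^sup>+\<omega>. (if 0 \<le> u then ennreal (exp (- \<alpha> * \<xi> (max 0 u) \<omega>)) else 0) \<partial>M) \<partial>lborel)"
    unfolding tail_functional_def
  proof (rule Fubini')
    have [measurable]: "(\<lambda>x. \<xi> (max 0 (fst x)) (snd x)) \<in> borel_measurable (lborel \<Otimes>\<^sub>M M)"
      using measurable_process_pair by (simp add: case_prod_beta' measurable_cong_sets[OF sets_pair_measure_cong[OF sets_lborel refl] refl])
    show "(\<lambda>(u, \<omega>). if 0 \<le> u then ennreal (exp (- \<alpha> * \<xi> (max 0 u) \<omega>)) else 0) \<in> borel_measurable (lborel \<Otimes>\<^sub>M M)"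
      by measurable
  qed
  also have "\<dots> = (\<integral>\<^sup>+s. (if 0 \<le> s then (\<integral>\<^sup>+\<omega>. ennreal (exp (- (\<alpha> * \<xi> s \<omega>))) \<partial>M) else 0) \<partial>lborel)"
    by (intro nn_integral_cong) auto
  finally show ?thesis using nn_integral_exp_process_time[OF assms] by simp
qed

lemma tail_functional_finite:
  assumes "0 \<le> \<alpha>" and "0 < laplace_exponent M \<xi> \<alpha>"
  shows "AE \<omega> in M. tail_functional \<alpha> 0 \<omega> < \<infinity>"
proof -
  have "AE \<omega> in M. tail_functional \<alpha> 0 \<omega> \<noteq> \<infinity>"
    by (rule nn_integral_noteq_infinite) (simp_all add: nn_integral_exponential_functional[OF assms])
  then show ?thesis by (simp add: less_top[symmetric])
qed

text \<open>\<open>exp (\<alpha> * \<xi> s \<omega>) * tail_functional \<alpha> s \<omega>\<close> is the exponential functional of the process restarted at time \<open>s\<close>.\<close>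

lemma restarted_functional_riemann:
  assumes \<omega>: "\<omega> \<in> space M" and s: "0 \<le> s" and \<alpha>: "0 \<le> \<alpha>" and fin: "tail_functional \<alpha> 0 \<omega> < \<infinity>"
  shows "(\<lambda>n. \<Sum>i\<in>{1..n * 2 ^ n}. exp (- \<alpha> * (\<xi> (s + real i * (1 / 2 ^ n)) \<omega> - \<xi> s \<omega>)) * (1 / 2 ^ n))
    \<longlonglongrightarrow> exp (\<alpha> * \<xi> s \<omega>) * enn2real (tail_functional \<alpha> s \<omega>)"
proof -
  note [measurable] = measurable_path[OF \<omega>]
  define h where "h v = exp (- \<alpha> * (\<xi> (max 0 (s + max 0 v)) \<omega> - \<xi> s \<omega>))" for v
  have h[measurable]: "h \<in> borel_measurable borel" unfolding h_def by measurable
  have fin_s: "tail_functional \<alpha> s \<omega> < \<infinity>" using tail_functional_le[OF s] fin by (rule le_less_trans)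
  have "tail_functional \<alpha> s \<omega>
    = ennreal \<bar>1\<bar> * (\<integral>\<^sup>+v. (if s \<le> s + 1 * v then ennreal (exp (- \<alpha> * \<xi> (max 0 (s + 1 * v)) \<omega>)) else 0) \<partial>lborel)"
    unfolding tail_functional_def by (rule nn_integral_real_affine) auto
  also have "\<dots> = (\<integral>\<^sup>+v. ennreal (exp (- \<alpha> * \<xi> s \<omega>)) * (ennreal (h v) * indicator {0..} v) \<partial>lborel)"
    by (auto intro!: nn_integral_cong simp: h_def algebra_simps simp flip: ennreal_mult exp_add)
  also have "\<dots> = ennreal (exp (- \<alpha> * \<xi> s \<omega>)) * (\<integral>\<^sup>+v. ennreal (h v) * indicator {0..} v \<partial>lborel)"
    by (rule nn_integral_cmult) auto
  finally have tail: "tail_functional \<alpha> s \<omega> = ennreal (exp (- \<alpha> * \<xi> s \<omega>)) * (\<integral>\<^sup>+v. ennreal (h v) * indicator {0..} v \<partial>lborel)" .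
  have int_h: "(\<integral>\<^sup>+v. ennreal (h v) * indicator {0..} v \<partial>lborel) = ennreal (exp (\<alpha> * \<xi> s \<omega>) * enn2real (tail_functional \<alpha> s \<omega>))"
  proof -
    have "ennreal (exp (\<alpha> * \<xi> s \<omega>)) * tail_functional \<alpha> s \<omega>
      = ennreal (exp (\<alpha> * \<xi> s \<omega>)) * ennreal (exp (- \<alpha> * \<xi> s \<omega>)) * (\<integral>\<^sup>+v. ennreal (h v) * indicator {0..} v \<partial>lborel)"
      by (simp only: tail mult.assoc)
    also have "ennreal (exp (\<alpha> * \<xi> s \<omega>)) * ennreal (exp (- \<alpha> * \<xi> s \<omega>)) = 1"
      by (simp flip: ennreal_mult exp_add)
    finally show ?thesis using fin_s by (simp add: ennreal_mult ennreal_enn2real)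
  qed
  have "(\<lambda>n. ennreal (\<Sum>i\<in>{1..n * 2 ^ n}. h (real i * (1 / 2 ^ n)) * (1 / 2 ^ n)))
    \<longlonglongrightarrow> (\<integral>\<^sup>+v. ennreal (h v) * indicator {0..} v \<partial>lborel)"
  proof (rule dyadic_riemann_sum_tendsto)
    show "h v \<le> h u" if "0 \<le> u" "u \<le> v" for u v
      using that s \<alpha> process_mono[OF \<omega>, of "s + u" "s + v"] by (simp add: h_def mult_left_mono)
    show "(h \<longlongrightarrow> h v) (at_right v)" if v: "0 \<le> v" for v
    proof -
      have "((\<lambda>u. \<xi> u \<omega>) \<longlongrightarrow> \<xi> (s + v) \<omega>) (at_right (s + v))"
        using right_continuous_paths[OF \<omega>, of "s + v"] s v by (simp add: continuous_within)
      moreover have "filterlim (\<lambda>u. s + u) (at_right (s + v)) (at_right v)"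
        by (auto simp: filterlim_at eventually_at_filter intro!: tendsto_eq_intros)
      ultimately have "((\<lambda>u. \<xi> (s + u) \<omega>) \<longlongrightarrow> \<xi> (s + v) \<omega>) (at_right v)"
        by (rule filterlim_compose)
      then have "((\<lambda>u. exp (- \<alpha> * (\<xi> (s + u) \<omega> - \<xi> s \<omega>))) \<longlongrightarrow> exp (- \<alpha> * (\<xi> (s + v) \<omega> - \<xi> s \<omega>))) (at_right v)"
        by (intro tendsto_intros)
      moreover have "eventually (\<lambda>u. exp (- \<alpha> * (\<xi> (s + u) \<omega> - \<xi> s \<omega>)) = h u) (at_right v)"
        using eventually_at_right_less[of v] by eventually_elim (use v s in \<open>simp add: h_def\<close>)
      ultimately show ?thesis using v s by (simp add: h_def Lim_transform_eventually)
    qed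
    show "(\<integral>\<^sup>+v. ennreal (h v) * indicator {0..} v \<partial>lborel) < \<infinity>" unfolding int_h by simp
  qed (auto simp: h_def)
  then have "(\<lambda>n. \<Sum>i\<in>{1..n * 2 ^ n}. h (real i * (1 / 2 ^ n)) * (1 / 2 ^ n))
    \<longlonglongrightarrow> exp (\<alpha> * \<xi> s \<omega>) * enn2real (tail_functional \<alpha> s \<omega>)"
    unfolding int_h by (subst (asm) tendsto_ennreal_iff) (auto intro!: always_eventually sum_nonneg simp: h_def)
  moreover have "h (real i * (1 / 2 ^ n)) = exp (- \<alpha> * (\<xi> (s + real i * (1 / 2 ^ n)) \<omega> - \<xi> s \<omega>))" for i and n :: nat
    using s by (simp add: h_def)
  ultimately show ?thesis by simp
qed

text \<open>The Markov property at s for a functional of the whole future. The dyadic sums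
  \<open>J n s\<close> depend on finitely many increments after s, so for them the factorisation is
  \<open>grid_increments_independent\<close>; it survives the limit n to infinity by dominated
  convergence after truncation, and the truncation is removed monotonically.\<close>

lemma nn_integral_restarted_functional_powr:
  assumes s: "0 \<le> s" and \<alpha>: "0 \<le> \<alpha>" and p: "0 \<le> p"
    and fin: "AE \<omega> in M. tail_functional \<alpha> 0 \<omega> < \<infinity>"
  shows "(\<integral>\<^sup>+\<omega>. ennreal (exp (- (p * \<xi> s \<omega>))) * ennreal ((exp (\<alpha> * \<xi> s \<omega>) * enn2real (tail_functional \<alpha> s \<omega>)) powr a) \<partial>M)
    = (\<integral>\<^sup>+\<omega>. ennreal (exp (- (p * \<xi> s \<omega>))) \<partial>M) * (\<integral>\<^sup>+\<omega>. ennreal (enn2real (tail_functional \<alpha> 0 \<omega>) powr a) \<partial>M)"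
    (is "?L = ?E * ?R")
proof -
  define S where "S s \<omega> = exp (\<alpha> * \<xi> s \<omega>) * enn2real (tail_functional \<alpha> s \<omega>)" for s \<omega>
  define J where "J n s \<omega> = (\<Sum>i\<in>{1..n * 2 ^ n}. exp (- \<alpha> * (\<xi> (s + real i * (1 / 2 ^ n)) \<omega> - \<xi> s \<omega>)) * (1 / 2 ^ n))" for n :: nat and s \<omega>
  have \<xi>_meas: "\<xi> t \<in> borel_measurable M" if "0 \<le> t" for t using measurable_process[OF that] .
  have S_meas: "S t \<in> borel_measurable M" if "0 \<le> t" for t
  proof -
    note [measurable] = \<xi>_meas[OF that]
    show ?thesis unfolding S_def by measurable
  qed
  have J_meas: "J n t \<in> borel_measurable M" if "0 \<le> t" for n t
  proof -
    have [measurable]: "\<xi> t \<in> borel_measurable M" "\<xi> (t + real i * (1 / 2 ^ n)) \<in> borel_measurable M" for i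
      using that by (auto intro!: \<xi>_meas)
    show ?thesis unfolding J_def by measurable
  qed
  have J_nonneg: "0 \<le> J n t \<omega>" for n t \<omega> unfolding J_def by (intro sum_nonneg) auto
  have E_le: "?E \<le> 1"
  proof -
    have "?E \<le> (\<integral>\<^sup>+\<omega>. 1 \<partial>M)"
      using p process_nonneg[OF _ s] by (intro nn_integral_mono) auto
    then show ?thesis by (simp add: emeasure_space_1)
  qed
  \<comment> \<open>The power is capped at c, since neither positive nor negative powers of the sums
    come with an integrable bound at this stage.\<close>
  define G where "G c x = ennreal (min c (x powr a))" for c x :: real
  have G_meas[measurable]: "G c \<in> borel_measurable borel" for c unfolding G_def by measurable
  have trunc_limit: "(\<lambda>n. \<integral>\<^sup>+\<omega>. ennreal (exp (- (p * \<xi> t \<omega>))) * G c (J n t \<omega>) \<partial>M)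
      \<longlonglongrightarrow> (\<integral>\<^sup>+\<omega>. ennreal (exp (- (p * \<xi> t \<omega>))) * G c (S t \<omega>) \<partial>M)"
    if t: "0 \<le> t" and p: "0 \<le> p" for t c p
  proof (rule nn_integral_dominated_convergence[where w = "\<lambda>_. ennreal c"])
    note [measurable] = \<xi>_meas[OF t] S_meas[OF t] J_meas[OF t]
    show "(\<lambda>\<omega>. ennreal (exp (- (p * \<xi> t \<omega>))) * G c (J n t \<omega>)) \<in> borel_measurable M" for n by measurable
    show "(\<lambda>\<omega>. ennreal (exp (- (p * \<xi> t \<omega>))) * G c (S t \<omega>)) \<in> borel_measurable M" by measurable
    show "AE \<omega> in M. ennreal (exp (- (p * \<xi> t \<omega>))) * G c (J n t \<omega>) \<le> ennreal c" for n
    proof (rule AE_I2)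
      fix \<omega> assume "\<omega> \<in> space M"
      then have "ennreal (exp (- (p * \<xi> t \<omega>))) \<le> 1" using p process_nonneg[OF _ t] by simp
      moreover have "G c (J n t \<omega>) \<le> ennreal c" by (simp add: G_def ennreal_leI)
      ultimately show "ennreal (exp (- (p * \<xi> t \<omega>))) * G c (J n t \<omega>) \<le> ennreal c"
        using mult_mono[of "ennreal (exp (- (p * \<xi> t \<omega>)))" 1] by (metis mult_1 zero_le)
    qed
    show "AE \<omega> in M. (\<lambda>n. ennreal (exp (- (p * \<xi> t \<omega>))) * G c (J n t \<omega>))
        \<longlonglongrightarrow> ennreal (exp (- (p * \<xi> t \<omega>))) * G c (S t \<omega>)"
      using fin AE_space
    proof eventually_elim
      case (elim \<omega>)
      have "tail_functional \<alpha> t \<omega> < \<infinity>" using tail_functional_le[OF t] elim(1) by (rule le_less_trans)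
      \<comment> \<open>A positive limit makes the power function continuous there even when
        \<open>a\<close> is negative.\<close>
      then have pos: "0 < S t \<omega>"
        using tail_functional_pos[OF elim(2), of \<alpha> t] by (simp add: S_def enn2real_positive_iff)
      have "(\<lambda>n. J n t \<omega>) \<longlonglongrightarrow> S t \<omega>"
        unfolding J_def S_def by (rule restarted_functional_riemann[OF elim(2) t \<alpha> elim(1)])
      then have "(\<lambda>n. ennreal (exp (- (p * \<xi> t \<omega>)) * max 0 (min c (J n t \<omega> powr a))))
        \<longlonglongrightarrow> ennreal (exp (- (p * \<xi> t \<omega>)) * max 0 (min c (S t \<omega> powr a)))"
        using pos by (intro tendsto_intros) auto
      moreover have "ennreal (exp (- (p * \<xi> t \<omega>)) * max 0 (min c (x powr a))) = ennreal (exp (- (p * \<xi> t \<omega>))) * G c x" for x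
        by (simp add: G_def ennreal_mult' max_def ennreal_neg)
      ultimately show ?case by simp
    qed
  qed (auto simp: emeasure_space_1)
  have fdd: "(\<integral>\<^sup>+\<omega>. ennreal (exp (- (p * \<xi> s \<omega>))) * G c (J n s \<omega>) \<partial>M) = ?E * (\<integral>\<^sup>+\<omega>. G c (J n 0 \<omega>) \<partial>M)" for n c
  proof -
    define H where "H x = G c (\<Sum>i\<in>{1..n * 2 ^ n}. exp (- \<alpha> * x i) * (1 / 2 ^ n))" for x :: "nat \<Rightarrow> real"
    have H_meas: "H \<in> borel_measurable (PiM {1..n * 2 ^ n} (\<lambda>_. borel))"
      unfolding H_def by measurable
    have HJ: "H (\<lambda>i\<in>{1..n * 2 ^ n}. y i) = G c (\<Sum>i\<in>{1..n * 2 ^ n}. exp (- \<alpha> * y i) * (1 / 2 ^ n))" for y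
      unfolding H_def by (intro arg_cong[where f = "G c"] sum.cong) auto
    have "(\<integral>\<^sup>+\<omega>. ennreal (exp (- (p * \<xi> s \<omega>))) * H (\<lambda>i\<in>{1..n * 2 ^ n}. \<xi> (s + real i * (1 / 2 ^ n)) \<omega> - \<xi> s \<omega>) \<partial>M)
      = ?E * (\<integral>\<^sup>+\<omega>. H (\<lambda>i\<in>{1..n * 2 ^ n}. \<xi> (real i * (1 / 2 ^ n)) \<omega>) \<partial>M)"
      using s H_meas by (intro grid_increments_independent) auto
    moreover have "(\<integral>\<^sup>+\<omega>. H (\<lambda>i\<in>{1..n * 2 ^ n}. \<xi> (real i * (1 / 2 ^ n)) \<omega>) \<partial>M) = (\<integral>\<^sup>+\<omega>. G c (J n 0 \<omega>) \<partial>M)"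
      unfolding HJ J_def by (rule nn_integral_cong) (simp add: starts_at_zero)
    ultimately show ?thesis by (simp only: HJ J_def)
  qed
  have S0: "(\<integral>\<^sup>+\<omega>. f (S 0 \<omega>) \<partial>M) = (\<integral>\<^sup>+\<omega>. f (enn2real (tail_functional \<alpha> 0 \<omega>)) \<partial>M)" for f
    by (rule nn_integral_cong) (simp add: S_def starts_at_zero)
  have trunc: "(\<integral>\<^sup>+\<omega>. ennreal (exp (- (p * \<xi> s \<omega>))) * G c (S s \<omega>) \<partial>M)
    = ?E * (\<integral>\<^sup>+\<omega>. G c (enn2real (tail_functional \<alpha> 0 \<omega>)) \<partial>M)" for c
  proof -
    have "(\<lambda>n. \<integral>\<^sup>+\<omega>. G c (J n 0 \<omega>) \<partial>M) \<longlonglongrightarrow> (\<integral>\<^sup>+\<omega>. G c (S 0 \<omega>) \<partial>M)"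
      using trunc_limit[of 0 0 c] by simp
    then have "(\<lambda>n. ?E * (\<integral>\<^sup>+\<omega>. G c (J n 0 \<omega>) \<partial>M)) \<longlonglongrightarrow> ?E * (\<integral>\<^sup>+\<omega>. G c (S 0 \<omega>) \<partial>M)"
      using E_le by (intro ennreal_tendsto_cmult) (auto simp: less_top[symmetric] top_unique)
    with trunc_limit[OF s p, of c] show ?thesis
      unfolding fdd S0 by (rule LIMSEQ_unique)
  qed
  have G_lim: "(\<lambda>n. G (real n) x) \<longlonglongrightarrow> ennreal (x powr a)" for x
  proof (rule tendsto_eventually)
    show "eventually (\<lambda>n. G (real n) x = ennreal (x powr a)) sequentially"
      using eventually_ge_at_top[of "nat \<lceil>x powr a\<rceil>"]
    proof eventually_elim
      case (elim n)
      then have "x powr a \<le> real n" by linarith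
      then show ?case by (simp add: G_def)
    qed
  qed
  have G_mono: "G (real m) x \<le> G (real n) x" if "m \<le> n" for m n x
    using that by (auto simp: G_def intro!: ennreal_leI)
  note [measurable] = \<xi>_meas[OF s] S_meas[OF s]
  have "(\<lambda>n. \<integral>\<^sup>+\<omega>. ennreal (exp (- (p * \<xi> s \<omega>))) * G (real n) (S s \<omega>) \<partial>M)
    \<longlonglongrightarrow> (\<integral>\<^sup>+\<omega>. ennreal (exp (- (p * \<xi> s \<omega>))) * ennreal (S s \<omega> powr a) \<partial>M)"
  proof (rule nn_integral_LIMSEQ)
    show "incseq (\<lambda>n \<omega>. ennreal (exp (- (p * \<xi> s \<omega>))) * G (real n) (S s \<omega>))"
      by (auto simp: incseq_def le_fun_def intro!: mult_left_mono G_mono)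
    show "(\<lambda>n. ennreal (exp (- (p * \<xi> s \<omega>))) * G (real n) (S s \<omega>)) \<longlonglongrightarrow> ennreal (exp (- (p * \<xi> s \<omega>))) * ennreal (S s \<omega> powr a)" for \<omega>
      by (intro ennreal_tendsto_cmult G_lim) auto
  qed measurable
  moreover have "(\<lambda>n. ?E * (\<integral>\<^sup>+\<omega>. G (real n) (enn2real (tail_functional \<alpha> 0 \<omega>)) \<partial>M)) \<longlonglongrightarrow> ?E * ?R"
  proof (rule ennreal_tendsto_cmult)
    show "?E < top" using E_le by (auto simp: less_top[symmetric] top_unique)
    show "(\<lambda>n. \<integral>\<^sup>+\<omega>. G (real n) (enn2real (tail_functional \<alpha> 0 \<omega>)) \<partial>M) \<longlonglongrightarrow> ?R"
      by (rule nn_integral_LIMSEQ) (auto simp: incseq_def le_fun_def intro!: G_mono G_lim)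
  qed
  ultimately have "(\<integral>\<^sup>+\<omega>. ennreal (exp (- (p * \<xi> s \<omega>))) * ennreal (S s \<omega> powr a) \<partial>M) = ?E * ?R"
    unfolding trunc by (rule LIMSEQ_unique)
  then show ?thesis by (simp only: S_def)
qed

text \<open>Let A_s be the part of I after time s. Integrating the derivative of A_s^z gives I^z / z
  as the integral of exp(-\<alpha> \<xi>_s) A_s^(z-1) ds. Since A_s = exp(-\<alpha> \<xi>_s) I' with
  I' an independent copy of I, the expectation of the integrand is E exp(-\<alpha> z \<xi>_s) E
  I^(z-1), and integrating exp(-s \<phi>(\<alpha> z)) over s yields 1/\<phi>(\<alpha> z). The
  identity holds in [0, infinity], so a finite moment of order z also yields a finite moment of
  order z - 1, negative if z < 1.\<close>

theorem exponential_functional_moment_recursion: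
  assumes \<alpha>: "0 < \<alpha>" and z: "0 < z"
    and pos: "\<And>q. 0 < q \<Longrightarrow> 0 < laplace_exponent M \<xi> q"
  shows "(\<integral>\<^sup>+\<omega>. ennreal (enn2real (tail_functional \<alpha> 0 \<omega>) powr z) \<partial>M)
    = ennreal (z / laplace_exponent M \<xi> (\<alpha> * z)) * (\<integral>\<^sup>+\<omega>. ennreal (enn2real (tail_functional \<alpha> 0 \<omega>) powr (z - 1)) \<partial>M)"
    (is "?L = _ * ?R")
proof -
  interpret pair_sigma_finite lborel M ..
  have fin: "AE \<omega> in M. tail_functional \<alpha> 0 \<omega> < \<infinity>"
    using \<alpha> pos[OF \<alpha>] by (intro tail_functional_finite) auto
  define f where "f s \<omega> = (if 0 \<le> s then ennreal (exp (- \<alpha> * \<xi> (max 0 s) \<omega>)) else 0)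
    * ennreal (enn2real (tail_functional \<alpha> s \<omega>) powr (z - 1))" for s \<omega>
  have "ennreal (1 / z) * ?L = (\<integral>\<^sup>+\<omega>. ennreal (enn2real (tail_functional \<alpha> 0 \<omega>) powr z / z) \<partial>M)"
    using z by (subst nn_integral_cmult[symmetric]) (auto simp flip: ennreal_mult)
  also have "\<dots> = (\<integral>\<^sup>+\<omega>. (\<integral>\<^sup>+s. f s \<omega> \<partial>lborel) \<partial>M)"
  proof (rule nn_integral_cong_AE)
    show "AE \<omega> in M. ennreal (enn2real (tail_functional \<alpha> 0 \<omega>) powr z / z) = (\<integral>\<^sup>+s. f s \<omega> \<partial>lborel)"
      using fin AE_space
    proof eventually_elim
      case (elim \<omega>)
      note [measurable] = measurable_path[OF elim(2)]
      show ?case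
        using nn_integral_powr_tail_integral[of "\<lambda>u. exp (- \<alpha> * \<xi> (max 0 u) \<omega>)" z] elim z \<alpha> process_nonneg[OF elim(2)]
        unfolding f_def tail_functional_def by simp
    qed
  qed
  also have "\<dots> = (\<integral>\<^sup>+s. (\<integral>\<^sup>+\<omega>. f s \<omega> \<partial>M) \<partial>lborel)"
  proof (rule Fubini')
    have [measurable]: "(\<lambda>x. \<xi> (max 0 (fst x)) (snd x)) \<in> borel_measurable (lborel \<Otimes>\<^sub>M M)"
      "(\<lambda>x. tail_functional \<alpha> (fst x) (snd x)) \<in> borel_measurable (lborel \<Otimes>\<^sub>M M)"
      using measurable_process_pair measurable_tail_functional
      by (simp_all add: case_prod_beta' measurable_cong_sets[OF sets_pair_measure_cong[OF sets_lborel refl] refl])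
    show "(\<lambda>(s, \<omega>). f s \<omega>) \<in> borel_measurable (lborel \<Otimes>\<^sub>M M)" unfolding f_def by measurable
  qed
  also have "\<dots> = (\<integral>\<^sup>+s. (if 0 \<le> s then (\<integral>\<^sup>+\<omega>. ennreal (exp (- (\<alpha> * z * \<xi> s \<omega>))) \<partial>M) else 0) * ?R \<partial>lborel)"
  proof (rule nn_integral_cong)
    fix s :: real
    show "(\<integral>\<^sup>+\<omega>. f s \<omega> \<partial>M) = (if 0 \<le> s then (\<integral>\<^sup>+\<omega>. ennreal (exp (- (\<alpha> * z * \<xi> s \<omega>))) \<partial>M) else 0) * ?R"
    proof (cases "0 \<le> s")
      case True
      have "(\<integral>\<^sup>+\<omega>. f s \<omega> \<partial>M) = (\<integral>\<^sup>+\<omega>. ennreal (exp (- (\<alpha> * z * \<xi> s \<omega>)))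
        * ennreal ((exp (\<alpha> * \<xi> s \<omega>) * enn2real (tail_functional \<alpha> s \<omega>)) powr (z - 1)) \<partial>M)"
      proof (rule nn_integral_cong)
        fix \<omega>
        \<comment> \<open>The restarted functional carries exp(\<alpha> \<xi>_s) to the power z - 1;
          the exponents combine as \<alpha> z - \<alpha> (z-1) = \<alpha>.\<close>
        have "exp (- (\<alpha> * z * \<xi> s \<omega>)) * exp (\<alpha> * \<xi> s \<omega>) powr (z - 1) = exp (- \<alpha> * \<xi> s \<omega>)"
          by (simp add: exp_powr_real algebra_simps flip: exp_add)
        then have "exp (- (\<alpha> * z * \<xi> s \<omega>)) * (exp (\<alpha> * \<xi> s \<omega>) * enn2real (tail_functional \<alpha> s \<omega>)) powr (z - 1)
          = exp (- \<alpha> * \<xi> s \<omega>) * enn2real (tail_functional \<alpha> s \<omega>) powr (z - 1)"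
          by (simp add: powr_mult flip: mult.assoc)
        then show "f s \<omega> = ennreal (exp (- (\<alpha> * z * \<xi> s \<omega>)))
          * ennreal ((exp (\<alpha> * \<xi> s \<omega>) * enn2real (tail_functional \<alpha> s \<omega>)) powr (z - 1))"
          using True by (simp add: f_def flip: ennreal_mult)
      qed
      also have "\<dots> = (\<integral>\<^sup>+\<omega>. ennreal (exp (- (\<alpha> * z * \<xi> s \<omega>))) \<partial>M) * ?R"
        using True \<alpha> z fin by (intro nn_integral_restarted_functional_powr) auto
      finally show ?thesis using True by simp
    qed (simp add: f_def)
  qed
  also have "\<dots> = (\<integral>\<^sup>+s. (if 0 \<le> s then (\<integral>\<^sup>+\<omega>. ennreal (exp (- (\<alpha> * z * \<xi> s \<omega>))) \<partial>M) else 0) \<partial>lborel) * ?R"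
  proof (rule nn_integral_multc)
    have "(\<lambda>s. if 0 \<le> s then (\<integral>\<^sup>+\<omega>. ennreal (exp (- (\<alpha> * z * \<xi> s \<omega>))) \<partial>M) else 0)
      = (\<lambda>s. if 0 \<le> s then ennreal (exp (- (s * laplace_exponent M \<xi> (\<alpha> * z)))) else 0)"
      using nn_integral_exp_process[of "\<alpha> * z"] \<alpha> z by auto
    then show "(\<lambda>s. if 0 \<le> s then (\<integral>\<^sup>+\<omega>. ennreal (exp (- (\<alpha> * z * \<xi> s \<omega>))) \<partial>M) else 0) \<in> borel_measurable lborel"
      by simp
  qed
  also have "\<dots> = ennreal (1 / laplace_exponent M \<xi> (\<alpha> * z)) * ?R"
    using \<alpha> z pos by (subst nn_integral_exp_process_time) auto
  finally have *: "ennreal (1 / z) * ?L = ennreal (1 / laplace_exponent M \<xi> (\<alpha> * z)) * ?R" .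
  have "?L = ennreal z * (ennreal (1 / z) * ?L)"
    using z by (simp flip: mult.assoc ennreal_mult)
  also have "\<dots> = ennreal (z / laplace_exponent M \<xi> (\<alpha> * z)) * ?R"
    unfolding * using z \<alpha> pos[of "\<alpha> * z"] by (simp add: less_imp_le flip: mult.assoc ennreal_mult)
  finally show ?thesis .
qed


lemma laplace_exponent_mono:
  assumes "0 \<le> q" "q \<le> r"
  shows "laplace_exponent M \<xi> q \<le> laplace_exponent M \<xi> r"
proof -
  have "(\<integral>\<^sup>+\<omega>. ennreal (exp (- (r * \<xi> 1 \<omega>))) \<partial>M) \<le> (\<integral>\<^sup>+\<omega>. ennreal (exp (- (q * \<xi> 1 \<omega>))) \<partial>M)"
    using assms process_nonneg[of _ 1] by (intro nn_integral_mono ennreal_leI) (auto intro!: mult_right_mono)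
  then have "ennreal (exp (- (1 * laplace_exponent M \<xi> r))) \<le> ennreal (exp (- (1 * laplace_exponent M \<xi> q)))"
    using assms by (simp only: nn_integral_exp_process order_trans[OF assms] zero_le_one)
  then show ?thesis by simp
qed

text \<open>Regular variation with c = 1 already excludes zeros of the exponent near 0, because x /
  0 = 0 cannot tend to 1; monotonicity carries positivity to all q > 0. In particular the
  identically zero process is ruled out.\<close>

lemma laplace_exponent_pos_of_regularly_varying:
  assumes "regularly_varying_at_0 (laplace_exponent M \<xi>) \<beta>" and q: "0 < q"
  shows "0 < laplace_exponent M \<xi> q"
proof -
  let ?\<phi> = "laplace_exponent M \<xi>"
  have "((\<lambda>x. ?\<phi> (1 * x) / ?\<phi> x) \<longlongrightarrow> 1 powr \<beta>) (at_right 0)"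
    using assms by (simp only: regularly_varying_at_0_def zero_less_one)
  then have "eventually (\<lambda>x. 0 < ?\<phi> (1 * x) / ?\<phi> x) (at_right 0)"
    by (rule order_tendstoD) simp
  then obtain b where b: "0 < b" "\<And>x. 0 < x \<Longrightarrow> x < b \<Longrightarrow> ?\<phi> x \<noteq> 0"
    unfolding eventually_at_right_field by fastforce
  define x where "x = min q (b / 2)"
  have x: "0 < x" "x < b" "x \<le> q" using b q by (auto simp: x_def)
  have "?\<phi> 0 = 0" by (simp add: laplace_exponent_def prob_space)
  then have "0 < ?\<phi> x" using laplace_exponent_mono[of 0 x] b(2)[of x] x by simp
  also have "\<dots> \<le> ?\<phi> q" using x by (intro laplace_exponent_mono) auto
  finally show ?thesis .
qed

lemma exponential_functional_power_moments:
  assumes \<alpha>: "0 < \<alpha>" and pos: "\<And>q. 0 < q \<Longrightarrow> 0 < laplace_exponent M \<xi> q"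
  shows "(\<integral>\<^sup>+\<omega>. ennreal (enn2real (tail_functional \<alpha> 0 \<omega>) ^ n) \<partial>M)
    = ennreal (fact n / (\<Prod>k=1..n. laplace_exponent M \<xi> (\<alpha> * real k)))"
proof (induction n)
  case 0
  show ?case by (simp add: emeasure_space_1)
next
  case (Suc n)
  have J_pos: "AE \<omega> in M. 0 < enn2real (tail_functional \<alpha> 0 \<omega>)"
    using tail_functional_finite[OF less_imp_le[OF \<alpha>] pos[OF \<alpha>]] AE_space
    by eventually_elim (simp add: enn2real_positive_iff tail_functional_pos)
  \<comment> \<open>Almost sure positivity is needed at m = 0, where \<open>0 powr 0\<close> is 0
    but \<open>0 ^ 0\<close> is 1.\<close>
  have conv: "(\<integral>\<^sup>+\<omega>. ennreal (enn2real (tail_functional \<alpha> 0 \<omega>) powr real m) \<partial>M)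
    = (\<integral>\<^sup>+\<omega>. ennreal (enn2real (tail_functional \<alpha> 0 \<omega>) ^ m) \<partial>M)" for m
    by (rule nn_integral_cong_AE) (use J_pos in eventually_elim, simp add: powr_realpow)
  have "(\<integral>\<^sup>+\<omega>. ennreal (enn2real (tail_functional \<alpha> 0 \<omega>) ^ Suc n) \<partial>M)
    = ennreal (real (Suc n) / laplace_exponent M \<xi> (\<alpha> * real (Suc n)))
      * (\<integral>\<^sup>+\<omega>. ennreal (enn2real (tail_functional \<alpha> 0 \<omega>) powr (real (Suc n) - 1)) \<partial>M)"
    unfolding conv[symmetric] by (rule exponential_functional_moment_recursion[OF \<alpha> _ pos]) simp
  also have "real (Suc n) - 1 = real n" by simp
  also have "(\<integral>\<^sup>+\<omega>. ennreal (enn2real (tail_functional \<alpha> 0 \<omega>) powr real n) \<partial>M)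
    = ennreal (fact n / (\<Prod>k=1..n. laplace_exponent M \<xi> (\<alpha> * real k)))"
    unfolding conv by (rule Suc)
  also have "ennreal (real (Suc n) / laplace_exponent M \<xi> (\<alpha> * real (Suc n)))
      * ennreal (fact n / (\<Prod>k=1..n. laplace_exponent M \<xi> (\<alpha> * real k)))
    = ennreal (fact (Suc n) / (\<Prod>k=1..Suc n. laplace_exponent M \<xi> (\<alpha> * real k)))"
  proof -
    have "0 < laplace_exponent M \<xi> (\<alpha> * real (Suc n))" using \<alpha> by (intro pos) simp
    then show ?thesis
      by (subst ennreal_mult'[symmetric]) (simp_all add: mult_ac)
  qed
  finally show ?case .
qed

end

lemma ennreal_eq_divideI:
  fixes x :: ennreal
  assumes "x * ennreal c = ennreal g" "0 < c" "0 \<le> g"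
  shows "x = ennreal (g / c)"
proof -
  have "x = x * ennreal c * ennreal (1 / c)"
    using assms(2) by (simp add: mult.assoc flip: ennreal_mult)
  then show ?thesis using assms by (simp flip: ennreal_mult)
qed

text \<open>\<open>R\<close> has a probability space of its own, since the claims concern only its
  law; it is coupled with \<open>I\<close> as an independent pair on the product space inside the
  proof.\<close>

theorem corollary1:
  fixes M :: "'a measure" and N :: "'b measure" and M' :: "'c measure"
    and \<xi> :: "real \<Rightarrow> 'a \<Rightarrow> real" and \<eta> :: "real \<Rightarrow> 'c \<Rightarrow> real"
    and R :: "'b \<Rightarrow> real" and I :: "'a \<Rightarrow> ennreal"
    and \<phi> :: "real \<Rightarrow> real" and \<alpha> \<beta> :: real
  assumes alpha: "0 < \<alpha>"
    and xi: "subordinator M \<xi>"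
    and phi: "\<phi> = laplace_exponent M \<xi>"
    and I: "I = exponential_functional \<alpha> \<xi>"
    and N: "prob_space N"
    and R_measurable: "R \<in> borel_measurable N"
    and R_nonneg: "\<And>\<omega>. \<omega> \<in> space N \<Longrightarrow> 0 \<le> R \<omega>"
    and R_moments: "\<And>n. 1 \<le> n \<Longrightarrow>
      has_bochner_integral N (\<lambda>\<omega>. R \<omega> ^ n) (\<Prod>k=1..n. \<phi> (\<alpha> * real k))"
    and beta: "0 \<le> \<beta>" "\<beta> \<le> 1"
    and regular: "regularly_varying_at_0 \<phi> \<beta>"
  shows "(\<lambda>s. \<integral>\<omega>. indicator {s<..} (R \<omega>) * (1 / R \<omega>) \<partial>N)
           \<sim>[at_right 0] (\<lambda>s. 1 / (\<alpha> powr \<beta> * Gamma (1 + \<beta>) * \<phi> (1 / ln (1 / s))))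
       \<and> (\<lambda>s. measure N {\<omega> \<in> space N. R \<omega> < s})
           \<in> o[at_right 0](\<lambda>s. s / (\<alpha> powr \<beta> * Gamma (1 + \<beta>) * \<phi> (1 / ln (1 / s))))
       \<and> (subordinator M' \<eta> \<and> (\<forall>q>0. q / \<phi> q = laplace_exponent M' \<eta> q) \<longrightarrow>
            (\<lambda>s. \<integral>\<omega>. indicator {ennreal s<..} (I \<omega>) * (1 / enn2real (I \<omega>)) \<partial>M)
              \<sim>[at_right 0] (\<lambda>s. \<alpha> powr \<beta> * ln (1 / s) * \<phi> (1 / ln (1 / s)) / Gamma (2 - \<beta>))
          \<and> (\<lambda>s. measure M {\<omega> \<in> space M. I \<omega> < ennreal s})
              \<in> o[at_right 0](\<lambda>s. \<alpha> powr \<beta> * s * ln (1 / s) * \<phi> (1 / ln (1 / s)) / Gamma (2 - \<beta>)))"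
proof -
  interpret subordinator M \<xi> by (rule xi)
  interpret N: prob_space N by (rule N)

  \<comment> \<open>Integer moments of both variables and positivity\<close>
  have \<phi>_pos: "0 < \<phi> q" if "0 < q" for q
    using laplace_exponent_pos_of_regularly_varying[OF _ that] regular unfolding phi by blast
  note \<phi>_pos' = \<phi>_pos[unfolded phi]
  have rv: "((\<lambda>z. \<phi> (c * z) / \<phi> z) \<longlongrightarrow> c powr \<beta>) (at_right 0)" if "0 < c" for c
    using regular that by (simp add: regularly_varying_at_0_def)
  \<comment> \<open>\<open>enn2real\<close> sends an infinite value to 0; this changes
    \<open>I\<close> only on a null set.\<close>
  define J where "J \<omega> = enn2real (I \<omega>)" for \<omega>
  have I_tail: "I = tail_functional \<alpha> 0"
    by (rule ext) (simp add: I exponential_functional_eq_tail)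
  have I_meas[measurable]: "I \<in> borel_measurable M" unfolding I_tail by measurable
  have J_meas[measurable]: "J \<in> borel_measurable M" unfolding J_def by measurable
  have J_nonneg: "0 \<le> J \<omega>" for \<omega> by (simp add: J_def)
  have I_fin: "AE \<omega> in M. I \<omega> < \<infinity>"
    unfolding I_tail using alpha \<phi>_pos' by (intro tail_functional_finite) auto
  have I_J: "AE \<omega> in M. I \<omega> = ennreal (J \<omega>)"
    using I_fin by eventually_elim (simp add: J_def)
  have J_pos: "AE \<omega> in M. 0 < J \<omega>"
    using I_fin AE_space
    by eventually_elim (simp add: J_def I_tail enn2real_positive_iff tail_functional_pos)
  have J_moments: "(\<integral>\<^sup>+\<omega>. ennreal (J \<omega> ^ n) \<partial>M) = ennreal (fact n / (\<Prod>k=1..n. \<phi> (\<alpha> * real k)))" for n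
    unfolding J_def I_tail phi by (rule exponential_functional_power_moments[OF alpha \<phi>_pos'])
  have prod_pos: "0 < (\<Prod>k=1..n. \<phi> (\<alpha> * real k))" for n
    using alpha by (intro prod_pos \<phi>_pos) auto
  have R_nn: "(\<integral>\<^sup>+\<omega>. ennreal (R \<omega> ^ n) \<partial>N) = ennreal (\<Prod>k=1..n. \<phi> (\<alpha> * real k))" for n
  proof (cases "n = 0")
    case False
    then have "has_bochner_integral N (\<lambda>\<omega>. R \<omega> ^ n) (\<Prod>k=1..n. \<phi> (\<alpha> * real k))"
      by (intro R_moments) simp
    then show ?thesis
      using R_nonneg by (subst nn_integral_eq_integral) (auto simp: has_bochner_integral_iff intro!: AE_I2)
  qed (simp add: N.emeasure_space_1)
  have RJ: "(\<integral>\<^sup>+\<omega>. ennreal (R \<omega> ^ n) \<partial>N) * (\<integral>\<^sup>+\<omega>. ennreal (J \<omega> ^ n) \<partial>M) = ennreal (fact n)" for n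
  proof -
    have "(\<Prod>k=1..n. \<phi> (\<alpha> * real k)) * (fact n / (\<Prod>k=1..n. \<phi> (\<alpha> * real k))) = fact n"
      using prod_pos[of n] by (metis less_irrefl nonzero_mult_div_cancel_left times_divide_eq_right)
    then show ?thesis
      unfolding R_nn J_moments using prod_pos[of n] by (metis ennreal_mult' less_imp_le)
  qed
  note inverse_moments = inverse_moments_of_exponential_product
    [OF N prob_space_axioms R_measurable J_meas R_nonneg J_nonneg RJ]
  have R_pos: "AE \<omega> in N. 0 < R \<omega>" by (rule inverse_moments(1))

  \<comment> \<open>The transforms E X^(z-1) of both variables\<close>
  define K where "K z = (\<integral>\<omega>. J \<omega> powr z \<partial>M)" for z
  have J_int: "integrable M J"
    using J_moments[of 1] J_nonneg by (intro integrableI_nonneg) (auto intro!: AE_I2)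
  \<comment> \<open>Weighted arithmetic-geometric mean again: one integrable bound 1 + J dominates
    the powers of all exponents in [0,1].\<close>
  have J_powr_le: "x powr z \<le> 1 + x" if "0 \<le> z" "z \<le> 1" "0 < x" for x z :: real
  proof -
    have "x powr z * 1 powr (1 - z) \<le> z * x + (1 - z) * 1"
      using that by (intro Youngs_inequality_0) auto
    also have "\<dots> \<le> 1 * x + 1 * 1" using that by (intro add_mono mult_right_mono) auto
    finally show ?thesis by simp
  qed
  have J_powr_int: "integrable M (\<lambda>\<omega>. J \<omega> powr z)" if "0 \<le> z" "z \<le> 1" for z
  proof (rule Bochner_Integration.integrable_bound)
    show "integrable M (\<lambda>\<omega>. 1 + J \<omega>)" using J_int by simp
    show "AE \<omega> in M. norm (J \<omega> powr z) \<le> norm (1 + J \<omega>)"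
      using J_pos by eventually_elim (use J_powr_le that in simp)
  qed measurable
  \<comment> \<open>This limit is what removes the unknown moment E I^z from both asymptotic
    formulas.\<close>
  have K_lim: "(K \<longlongrightarrow> 1) (at_right 0)"
  proof (rule tendsto_at_right_sequentially[of 0 1])
    fix S :: "nat \<Rightarrow> real" assume S: "\<And>n. 0 < S n" "\<And>n. S n < 1" "S \<longlonglongrightarrow> 0"
    have "(\<lambda>n. \<integral>\<omega>. J \<omega> powr S n \<partial>M) \<longlonglongrightarrow> (\<integral>\<omega>. (1::real) \<partial>M)"
    proof (rule integral_dominated_convergence[where w = "\<lambda>\<omega>. 1 + J \<omega>"])
      show "AE \<omega> in M. (\<lambda>n. J \<omega> powr S n) \<longlonglongrightarrow> 1"
        using J_pos
      proof eventually_elim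
        case (elim \<omega>)
        have "(\<lambda>n. J \<omega> powr S n) \<longlonglongrightarrow> J \<omega> powr 0" using elim S(3) by (intro tendsto_intros) auto
        then show ?case using elim by simp
      qed
      show "AE \<omega> in M. norm (J \<omega> powr S n) \<le> 1 + J \<omega>" for n
        using J_pos by eventually_elim (use J_powr_le S in \<open>simp add: less_imp_le\<close>)
    qed (use J_int in auto)
    then show "(\<lambda>n. K (S n)) \<longlonglongrightarrow> 1" by (simp add: K_def prob_space)
  qed simp
  have J_inv: "(\<integral>\<^sup>+\<omega>. ennreal (J \<omega> powr (z - 1)) \<partial>M) = ennreal (K z * \<phi> (\<alpha> * z) / z)"
    if z: "0 < z" "z \<le> 1" for z
  proof -
    have \<phi>z: "0 < \<phi> (\<alpha> * z)" using z alpha by (intro \<phi>_pos) simp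
    have "(\<integral>\<^sup>+\<omega>. ennreal (J \<omega> powr z) \<partial>M) = ennreal (K z)"
      unfolding K_def using J_powr_int[of z] z by (intro nn_integral_eq_integral) auto
    then have "(\<integral>\<^sup>+\<omega>. ennreal (J \<omega> powr (z - 1)) \<partial>M) * ennreal (z / \<phi> (\<alpha> * z)) = ennreal (K z)"
      using exponential_functional_moment_recursion[OF alpha z(1) \<phi>_pos']
      unfolding J_def I_tail phi by (simp add: mult.commute)
    moreover have "0 \<le> K z" by (simp add: K_def)
    ultimately have "(\<integral>\<^sup>+\<omega>. ennreal (J \<omega> powr (z - 1)) \<partial>M) = ennreal (K z / (z / \<phi> (\<alpha> * z)))"
      using z \<phi>z by (intro ennreal_eq_divideI) auto
    then show ?thesis by simp
  qed
  \<comment> \<open>The product of the two transforms is Gamma(z); dividing by the one of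
    \<open>J\<close> and using z Gamma(z) = Gamma(1+z) leaves a numerator that tends to 1 with z
    tending to 0.\<close>
  have R_inv: "(\<integral>\<^sup>+\<omega>. ennreal (R \<omega> powr (z - 1)) \<partial>N) = ennreal (Gamma (1 + z) / (K z * \<phi> (\<alpha> * z)))"
    if z: "0 < z" "z < 1" for z
  proof -
    have \<phi>z: "0 < \<phi> (\<alpha> * z)" using z alpha by (intro \<phi>_pos) simp
    have G: "0 < Gamma z" using z by (intro Gamma_real_pos)
    have eq: "(\<integral>\<^sup>+\<omega>. ennreal (R \<omega> powr (z - 1)) \<partial>N) * ennreal (K z * \<phi> (\<alpha> * z) / z) = ennreal (Gamma z)"
      using inverse_moments(2)[of "1 - z"] z by (simp add: J_inv)
    have "K z \<noteq> 0" using eq G by (intro notI) simp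
    then have "0 < K z" by (simp add: K_def less_le)
    then have "(\<integral>\<^sup>+\<omega>. ennreal (R \<omega> powr (z - 1)) \<partial>N) = ennreal (Gamma z / (K z * \<phi> (\<alpha> * z) / z))"
      using eq \<phi>z z G by (intro ennreal_eq_divideI) auto
    moreover have "Gamma (1 + z) = z * Gamma z"
    proof -
      have "z \<notin> \<int>\<^sub>\<le>\<^sub>0" using z by (auto dest: nonpos_Ints_nonpos)
      then show ?thesis using Gamma_plus1[of z] by (simp add: add.commute)
    qed
    ultimately show ?thesis using z by (simp add: mult.commute)
  qed
  have ev1: "eventually (\<lambda>z::real. 0 < z \<and> z < 1) (at_right 0)"
    by (auto simp: eventually_at_right_field intro!: exI[of _ 1])
  have K_pos: "eventually (\<lambda>z. 0 < K z) (at_right 0)" using K_lim by (rule order_tendstoD) simp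
  have Gam: "0 < Gamma (1 + \<beta>)" "0 < Gamma (2 - \<beta>)" using beta by (auto intro!: Gamma_real_pos)
  have a_pos: "0 < \<alpha> powr \<beta>" using alpha by simp
  have log_pos: "0 < 1 / ln (1 / s)" if "0 < s" "s < 1" for s :: real using that by simp

  \<comment> \<open>Tauberian theorem for \<open>R\<close>, with index
    \<open>\<beta>\<close>\<close>
  define \<psi>R where "\<psi>R z = 1 / (\<alpha> powr \<beta> * \<phi> z)" for z
  have R_asymp: "((\<lambda>z. (\<integral>\<omega>. R \<omega> powr (z - 1) \<partial>N) / \<psi>R z) \<longlongrightarrow> 1) (at_right 0)"
  proof -
    have "((\<lambda>z. Gamma (1 + z) / K z * (\<alpha> powr \<beta> / (\<phi> (\<alpha> * z) / \<phi> z))) \<longlongrightarrow> Gamma (1 + 0) / 1 * (\<alpha> powr \<beta> / \<alpha> powr \<beta>)) (at_right 0)"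
      using rv[OF alpha] K_lim a_pos by (intro tendsto_intros) (auto dest: nonpos_Ints_nonpos)
    moreover have "eventually (\<lambda>z. Gamma (1 + z) / K z * (\<alpha> powr \<beta> / (\<phi> (\<alpha> * z) / \<phi> z))
      = (\<integral>\<omega>. R \<omega> powr (z - 1) \<partial>N) / \<psi>R z) (at_right 0)"
      using ev1 K_pos
    proof eventually_elim
      case (elim z)
      have "0 < \<phi> (\<alpha> * z)" using elim alpha by (intro \<phi>_pos) simp
      moreover have "0 < Gamma (1 + z)" using elim by (intro Gamma_real_pos) simp
      ultimately have "(\<integral>\<omega>. R \<omega> powr (z - 1) \<partial>N) = Gamma (1 + z) / (K z * \<phi> (\<alpha> * z))"
        using R_inv[of z] elim R_measurable by (subst integral_eq_nn_integral) auto
      then show ?case by (simp add: \<psi>R_def)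
    qed
    ultimately show ?thesis by (rule Lim_transform_eventually[THEN tendsto_eq_rhs]) (use a_pos in auto)
  qed
  have R_int: "integrable N (\<lambda>\<omega>. R \<omega> powr (z - 1))" if z: "0 < z" "z \<le> 1" for z
  proof (cases "z = 1")
    case True
    have "integrable N (\<lambda>\<omega>. 1::real)" by simp
    then show ?thesis
    proof (rule Bochner_Integration.integrable_bound)
      show "AE \<omega> in N. norm (R \<omega> powr (z - 1)) \<le> norm (1::real)"
        by (rule AE_I2) (simp add: True powr_zero_eq_one)
    qed (use R_measurable in measurable)
  next
    case False
    then show ?thesis using R_inv[of z] z R_measurable by (intro integrableI_nonneg) auto
  qed
  have R_rv: "((\<lambda>z. \<psi>R (c * z) / \<psi>R z) \<longlongrightarrow> c powr - \<beta>) (at_right 0)" if "0 < c" for c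
    using tendsto_inverse[OF rv[OF that]] that a_pos by (simp add: \<psi>R_def powr_minus)
  note R_main = N.tauberian_inverse_moment[OF R_measurable R_pos R_int R_asymp beta(1) R_rv]

  \<comment> \<open>Tauberian theorem for the exponential functional, with index
    \<open>1 - \<beta>\<close>\<close>
  define \<psi>I where "\<psi>I z = \<alpha> powr \<beta> * \<phi> z / z" for z
  have J_asymp: "((\<lambda>z. (\<integral>\<omega>. J \<omega> powr (z - 1) \<partial>M) / \<psi>I z) \<longlongrightarrow> 1) (at_right 0)"
  proof -
    have "((\<lambda>z. K z * (\<phi> (\<alpha> * z) / \<phi> z / \<alpha> powr \<beta>)) \<longlongrightarrow> 1 * (\<alpha> powr \<beta> / \<alpha> powr \<beta>)) (at_right 0)"
      using rv[OF alpha] K_lim a_pos by (intro tendsto_intros) auto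
    moreover have "eventually (\<lambda>z. K z * (\<phi> (\<alpha> * z) / \<phi> z / \<alpha> powr \<beta>)
      = (\<integral>\<omega>. J \<omega> powr (z - 1) \<partial>M) / \<psi>I z) (at_right 0)"
      using ev1 K_pos
    proof eventually_elim
      case (elim z)
      have "0 < \<phi> (\<alpha> * z)" using elim alpha by (intro \<phi>_pos) simp
      then have "(\<integral>\<omega>. J \<omega> powr (z - 1) \<partial>M) = K z * \<phi> (\<alpha> * z) / z"
        using J_inv[of z] elim by (subst integral_eq_nn_integral) auto
      then show ?case using elim by (simp add: \<psi>I_def)
    qed
    ultimately show ?thesis by (rule Lim_transform_eventually[THEN tendsto_eq_rhs]) (use a_pos in auto)
  qed
  have J_int': "integrable M (\<lambda>\<omega>. J \<omega> powr (z - 1))" if "0 < z" "z \<le> 1" for z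
    using J_inv[OF that] by (intro integrableI_nonneg) auto
  \<comment> \<open>The factor 1/z contributes c^(-1) to the ratio, which turns the index \<beta> of
    \<open>\<phi>\<close> into \<beta> - 1.\<close>
  have J_rv: "((\<lambda>z. \<psi>I (c * z) / \<psi>I z) \<longlongrightarrow> c powr - (1 - \<beta>)) (at_right 0)" if c: "0 < c" for c
  proof -
    have "((\<lambda>z. \<phi> (c * z) / \<phi> z / c) \<longlongrightarrow> c powr \<beta> / c) (at_right 0)"
      using c by (intro tendsto_intros rv) auto
    moreover have "eventually (\<lambda>z. \<phi> (c * z) / \<phi> z / c = \<psi>I (c * z) / \<psi>I z) (at_right 0)"
      using ev1 by eventually_elim (use c a_pos in \<open>simp add: \<psi>I_def mult_ac\<close>)
    moreover have "c powr \<beta> / c = c powr - (1 - \<beta>)" using c by (simp add: powr_diff)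
    ultimately show ?thesis by (simp only: Lim_transform_eventually)
  qed
  have \<beta>': "0 \<le> 1 - \<beta>" using beta by simp
  note J_main = tauberian_inverse_moment[OF J_meas J_pos J_int' J_asymp \<beta>' J_rv]

  \<comment> \<open>Return from \<open>J\<close> to \<open>I\<close> and to the stated
    normalisations\<close>
  have I_truncated: "eventually (\<lambda>s. (\<integral>\<omega>. indicator {ennreal s<..} (I \<omega>) * (1 / enn2real (I \<omega>)) \<partial>M)
    = (\<integral>\<omega>. indicator {s<..} (J \<omega>) * (1 / J \<omega>) \<partial>M)) (at_right 0)"
    using ev1
  proof eventually_elim
    case (elim s)
    show ?case
    proof (rule integral_cong_AE)
      show "AE \<omega> in M. indicator {ennreal s<..} (I \<omega>) * (1 / enn2real (I \<omega>)) = indicator {s<..} (J \<omega>) * (1 / J \<omega>)"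
        using I_J by eventually_elim (use elim J_nonneg in \<open>auto simp: indicator_def ennreal_less_iff\<close>)
    qed measurable
  qed
  have I_prob: "eventually (\<lambda>s. measure M {\<omega> \<in> space M. I \<omega> < ennreal s} = measure M {\<omega> \<in> space M. J \<omega> < s}) (at_right 0)"
    using ev1
  proof eventually_elim
    case (elim s)
    show ?case
    proof (rule finite_measure_eq_AE)
      show "AE \<omega> in M. (\<omega> \<in> {\<omega> \<in> space M. I \<omega> < ennreal s}) = (\<omega> \<in> {\<omega> \<in> space M. J \<omega> < s})"
        using I_J by eventually_elim (use elim J_nonneg in \<open>auto simp: ennreal_less_iff\<close>)
    qed measurable
  qed
  have R1: "(\<lambda>s. \<integral>\<omega>. indicator {s<..} (R \<omega>) * (1 / R \<omega>) \<partial>N)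
    \<sim>[at_right 0] (\<lambda>s. 1 / (\<alpha> powr \<beta> * Gamma (1 + \<beta>) * \<phi> (1 / ln (1 / s))))"
  proof (rule asymp_equivI')
    have "((\<lambda>s. (\<integral>\<omega>. indicator {s<..} (R \<omega>) * (1 / R \<omega>) \<partial>N) / \<psi>R (1 / ln (1 / s)) * Gamma (1 + \<beta>))
      \<longlongrightarrow> 1 / Gamma (1 + \<beta>) * Gamma (1 + \<beta>)) (at_right 0)"
      by (intro tendsto_mult_right R_main(1))
    then show "((\<lambda>s. (\<integral>\<omega>. indicator {s<..} (R \<omega>) * (1 / R \<omega>) \<partial>N)
      / (1 / (\<alpha> powr \<beta> * Gamma (1 + \<beta>) * \<phi> (1 / ln (1 / s))))) \<longlongrightarrow> 1) (at_right 0)"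
      using Gam by (simp add: \<psi>R_def mult_ac)
  qed
  have R2: "(\<lambda>s. measure N {\<omega> \<in> space N. R \<omega> < s})
    \<in> o[at_right 0](\<lambda>s. s / (\<alpha> powr \<beta> * Gamma (1 + \<beta>) * \<phi> (1 / ln (1 / s))))"
  proof (rule smalloI_tendsto)
    have "((\<lambda>s. measure N {\<omega> \<in> space N. R \<omega> < s} / (s * \<psi>R (1 / ln (1 / s))) * Gamma (1 + \<beta>))
      \<longlongrightarrow> 0 * Gamma (1 + \<beta>)) (at_right 0)"
      by (intro tendsto_mult_right R_main(2))
    then show "((\<lambda>s. measure N {\<omega> \<in> space N. R \<omega> < s}
      / (s / (\<alpha> powr \<beta> * Gamma (1 + \<beta>) * \<phi> (1 / ln (1 / s))))) \<longlongrightarrow> 0) (at_right 0)"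
      by (simp add: \<psi>R_def mult_ac)
    show "eventually (\<lambda>s. s / (\<alpha> powr \<beta> * Gamma (1 + \<beta>) * \<phi> (1 / ln (1 / s))) \<noteq> 0) (at_right 0)"
      using ev1
    proof eventually_elim
      case (elim s)
      then show ?case using \<phi>_pos[OF log_pos, of s] Gam a_pos by simp
    qed
  qed
  \<comment> \<open>At z = 1/log(1/s) the factor 1/z in \<open>\<psi>I\<close> becomes log(1/s), and
    Gamma(1 + (1-\<beta>)) is Gamma(2-\<beta>).\<close>
  have I1: "(\<lambda>s. \<integral>\<omega>. indicator {ennreal s<..} (I \<omega>) * (1 / enn2real (I \<omega>)) \<partial>M)
    \<sim>[at_right 0] (\<lambda>s. \<alpha> powr \<beta> * ln (1 / s) * \<phi> (1 / ln (1 / s)) / Gamma (2 - \<beta>))"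
  proof (rule asymp_equivI')
    have "((\<lambda>s. (\<integral>\<omega>. indicator {s<..} (J \<omega>) * (1 / J \<omega>) \<partial>M) / \<psi>I (1 / ln (1 / s)) * Gamma (2 - \<beta>))
      \<longlongrightarrow> 1 / Gamma (1 + (1 - \<beta>)) * Gamma (2 - \<beta>)) (at_right 0)"
      by (intro tendsto_mult_right J_main(1))
    moreover have "eventually (\<lambda>s. (\<integral>\<omega>. indicator {s<..} (J \<omega>) * (1 / J \<omega>) \<partial>M) / \<psi>I (1 / ln (1 / s)) * Gamma (2 - \<beta>)
      = (\<integral>\<omega>. indicator {ennreal s<..} (I \<omega>) * (1 / enn2real (I \<omega>)) \<partial>M)
        / (\<alpha> powr \<beta> * ln (1 / s) * \<phi> (1 / ln (1 / s)) / Gamma (2 - \<beta>))) (at_right 0)"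
      using I_truncated by eventually_elim (simp add: \<psi>I_def mult_ac)
    ultimately show "((\<lambda>s. (\<integral>\<omega>. indicator {ennreal s<..} (I \<omega>) * (1 / enn2real (I \<omega>)) \<partial>M)
        / (\<alpha> powr \<beta> * ln (1 / s) * \<phi> (1 / ln (1 / s)) / Gamma (2 - \<beta>))) \<longlongrightarrow> 1) (at_right 0)"
      by (rule Lim_transform_eventually[THEN tendsto_eq_rhs]) (use Gam in auto)
  qed
  have I2: "(\<lambda>s. measure M {\<omega> \<in> space M. I \<omega> < ennreal s})
    \<in> o[at_right 0](\<lambda>s. \<alpha> powr \<beta> * s * ln (1 / s) * \<phi> (1 / ln (1 / s)) / Gamma (2 - \<beta>))"
  proof (rule smalloI_tendsto)
    have "((\<lambda>s. measure M {\<omega> \<in> space M. J \<omega> < s} / (s * \<psi>I (1 / ln (1 / s))) * Gamma (2 - \<beta>))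
      \<longlongrightarrow> 0 * Gamma (2 - \<beta>)) (at_right 0)"
      by (intro tendsto_mult_right J_main(2))
    moreover have "eventually (\<lambda>s. measure M {\<omega> \<in> space M. J \<omega> < s} / (s * \<psi>I (1 / ln (1 / s))) * Gamma (2 - \<beta>)
      = measure M {\<omega> \<in> space M. I \<omega> < ennreal s}
        / (\<alpha> powr \<beta> * s * ln (1 / s) * \<phi> (1 / ln (1 / s)) / Gamma (2 - \<beta>))) (at_right 0)"
      using I_prob by eventually_elim (simp add: \<psi>I_def mult_ac)
    ultimately show "((\<lambda>s. measure M {\<omega> \<in> space M. I \<omega> < ennreal s}
        / (\<alpha> powr \<beta> * s * ln (1 / s) * \<phi> (1 / ln (1 / s)) / Gamma (2 - \<beta>))) \<longlongrightarrow> 0) (at_right 0)"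
      by (rule Lim_transform_eventually[THEN tendsto_eq_rhs]) auto
    show "eventually (\<lambda>s. \<alpha> powr \<beta> * s * ln (1 / s) * \<phi> (1 / ln (1 / s)) / Gamma (2 - \<beta>) \<noteq> 0) (at_right 0)"
      using ev1
    proof eventually_elim
      case (elim s)
      then show ?case using \<phi>_pos[OF log_pos, of s] Gam a_pos by simp
    qed
  qed
  show ?thesis using R1 R2 I1 I2 by blast
qed

end
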